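(* Let $(R,\mathfrak{m},k)$ be a local ring of prime characteristic $p>0$ with perfect residue field $k$, and let $x\in\mathfrak{m}$ be a regular element. If $R/xR$ has FLC and is $F$-injective, then $R$ is $F$-injective.
   Context: All rings are commutative and noetherian. $H^i_{\mathfrak{m}}(-)$ denotes local cohomology with support in $\mathfrak{m}$. A regular element is a nonzerodivisor. A local ring $(A,\mathfrak{n})$ of prime characteristic $p>0$ is called $F$-injective if for every $i\ge 0$ the Frobenius action on $H^i_{\mathfrak{n}}(A)$ (the additive, $p$-linear map induced by the Frobenius map $a\mapsto a^p$ of $A$) is injective. A module $M$ over a local ring $(R,\mathfrak{m})$ has FLC (finite local cohomology) if $H^i_{\mathfrak{m}}(M)$ has finite length for all $i\le \dim M-1$; thus $R/xR$ has FLC if $H^i_{\mathfrak{m}}(R/xR)$ has finite length for all $i\le\dim (R/xR)-1$. *)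

theory Defs
  imports "HOL-Computational_Algebra.Primes" "HOL-Algebra.Ring_Divisibility" "HOL-Algebra.Module" "HOL-Library.Extended_Nat" "HOL-Library.FuncSet"
begin

section \<open>Local rings\<close>

definition noetherian_local_ring :: "('a, 'c) ring_scheme \<Rightarrow> 'a set \<Rightarrow> bool" where
  "noetherian_local_ring R \<mm> \<longleftrightarrow>
     cring R \<and> noetherian_ring R \<and> maximalideal \<mm> R \<and> (\<forall>J. maximalideal J R \<longrightarrow> J = \<mm>)"

definition regular_element :: "('a, 'c) ring_scheme \<Rightarrow> 'a \<Rightarrow> bool" where
  "regular_element R x \<longleftrightarrow>
     x \<in> carrier R \<and> (\<forall>a \<in> carrier R. x \<otimes>\<^bsub>R\<^esub> a = \<zero>\<^bsub>R\<^esub> \<longrightarrow> a = \<zero>\<^bsub>R\<^esub>)"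

text \<open>For nonzero rings and a prime number \<open>p\<close> this says that the characteristic is exactly \<open>p\<close>.\<close>

definition prime_characteristic :: "nat \<Rightarrow> ('a, 'c) ring_scheme \<Rightarrow> bool" where
  "prime_characteristic p R \<longleftrightarrow>
     Factorial_Ring.prime p \<and> \<one>\<^bsub>R\<^esub> \<noteq> \<zero>\<^bsub>R\<^esub> \<and> add_pow R p \<one>\<^bsub>R\<^esub> = \<zero>\<^bsub>R\<^esub>"

definition perfect_field :: "nat \<Rightarrow> ('a, 'c) ring_scheme \<Rightarrow> bool" where
  "perfect_field p k \<longleftrightarrow>
     field k \<and> prime_characteristic p k \<and> (\<lambda>a. a [^]\<^bsub>k\<^esub> p) ` carrier k = carrier k"

section \<open>Modules\<close>

text \<open>A module record extends a ring record; the fields \<open>mult\<close> and \<open>one\<close> play no role for modules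
  and are left unspecified in the constructions below.\<close>

definition ring_as_module :: "('a, 'c) ring_scheme \<Rightarrow> ('a, 'a) module" where
  "ring_as_module R =
     \<lparr>carrier = carrier R, monoid.mult = monoid.mult R, one = \<one>\<^bsub>R\<^esub>, ring.zero = \<zero>\<^bsub>R\<^esub>,
      ring.add = ring.add R, smult = monoid.mult R\<rparr>"

text \<open>The subquotient \<open>Z/B\<close> for submodules \<open>B \<subseteq> Z\<close> of \<open>M\<close>.\<close>

definition subquotient ::
    "('a, 'm, 'd) module_scheme \<Rightarrow> 'm set \<Rightarrow> 'm set \<Rightarrow> ('a, 'm set) module" where
  "subquotient M Z B =
     \<lparr>carrier = (\<lambda>z. B +>\<^bsub>M\<^esub> z) ` Z, monoid.mult = undefined, one = undefined, ring.zero = B,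
      ring.add = set_add M, smult = (\<lambda>r U. \<Union>z\<in>U. B +>\<^bsub>M\<^esub> (r \<odot>\<^bsub>M\<^esub> z))\<rparr>"

definition quotient_by_element :: "('a, 'c) ring_scheme \<Rightarrow> 'a \<Rightarrow> ('a, 'a set) module" where
  "quotient_by_element R x = subquotient (ring_as_module R) (carrier R) (PIdl\<^bsub>R\<^esub> x)"

definition finite_length :: "('a, 'c) ring_scheme \<Rightarrow> ('a, 'm, 'd) module_scheme \<Rightarrow> bool" where
  "finite_length R M \<longleftrightarrow>
     (\<exists>n::nat. \<forall>(N :: nat \<Rightarrow> 'm set) k.
        (\<forall>j\<le>k. submodule (N j) R M) \<and> (\<forall>j<k. N j \<subset> N (Suc j)) \<longrightarrow> k \<le> n)"

definition krull_dim :: "('a, 'c) ring_scheme \<Rightarrow> enat" where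
  "krull_dim R =
     Sup {enat n | n. \<exists>P :: nat \<Rightarrow> 'a set.
        (\<forall>j\<le>n. primeideal (P j) R) \<and> (\<forall>j<n. P j \<subset> P (Suc j))}"

definition annihilator :: "('a, 'c) ring_scheme \<Rightarrow> ('a, 'm, 'd) module_scheme \<Rightarrow> 'a set" where
  "annihilator R M = {r \<in> carrier R. \<forall>m \<in> carrier M. r \<odot>\<^bsub>M\<^esub> m = \<zero>\<^bsub>M\<^esub>}"

definition module_dim :: "('a, 'c) ring_scheme \<Rightarrow> ('a, 'm, 'd) module_scheme \<Rightarrow> enat" where
  "module_dim R M = krull_dim (R Quot annihilator R M)"

section \<open>Localization\<close>

text \<open>\<open>D\<close> is a multiplicative subset of \<open>R\<close>; a pair \<open>(m, s)\<close> represents the fraction \<open>m/s\<close>.\<close>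

definition loc_rel ::
    "('a, 'c) ring_scheme \<Rightarrow> 'a set \<Rightarrow> ('a, 'm, 'd) module_scheme \<Rightarrow> (('m \<times> 'a) \<times> ('m \<times> 'a)) set" where
  "loc_rel R D M =
     {((m, s), (n, t)). m \<in> carrier M \<and> n \<in> carrier M \<and> s \<in> D \<and> t \<in> D \<and>
        (\<exists>u\<in>D. u \<odot>\<^bsub>M\<^esub> (t \<odot>\<^bsub>M\<^esub> m) = u \<odot>\<^bsub>M\<^esub> (s \<odot>\<^bsub>M\<^esub> n))}"

definition fraction ::
    "('a, 'c) ring_scheme \<Rightarrow> 'a set \<Rightarrow> ('a, 'm, 'd) module_scheme \<Rightarrow> 'm \<Rightarrow> 'a \<Rightarrow> ('m \<times> 'a) set" where
  "fraction R D M m s = loc_rel R D M `` {(m, s)}"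

definition localization ::
    "('a, 'c) ring_scheme \<Rightarrow> 'a set \<Rightarrow> ('a, 'm, 'd) module_scheme \<Rightarrow> ('a, ('m \<times> 'a) set) module" where
  "localization R D M =
     \<lparr>carrier = (carrier M \<times> D) // loc_rel R D M, monoid.mult = undefined, one = undefined,
      ring.zero = fraction R D M \<zero>\<^bsub>M\<^esub> \<one>\<^bsub>R\<^esub>,
      ring.add = (\<lambda>U V. \<Union>(m, s)\<in>U. \<Union>(n, t)\<in>V.
               fraction R D M (t \<odot>\<^bsub>M\<^esub> m \<oplus>\<^bsub>M\<^esub> s \<odot>\<^bsub>M\<^esub> n) (s \<otimes>\<^bsub>R\<^esub> t)),
      smult = (\<lambda>r U. \<Union>(m, s)\<in>U. fraction R D M (r \<odot>\<^bsub>M\<^esub> m) s)\<rparr>"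

section \<open>The Cech complex and local cohomology\<close>

text \<open>The multiplicative set generated by the \<open>f\<^sub>s\<close> with \<open>s \<in> S\<close>. Localizing at it is the same as
  inverting the single element \<open>\<Prod>\<^sub>s f\<^sub>s\<close>, and the localization maps for \<open>S \<subseteq> T\<close> become \<open>m/s \<mapsto> m/s\<close>.\<close>

definition denominators :: "('a, 'c) ring_scheme \<Rightarrow> 'a list \<Rightarrow> nat set \<Rightarrow> 'a set" where
  "denominators R fs S =
     {finprod R (\<lambda>s. (fs ! s) [^]\<^bsub>R\<^esub> (e s)) S | e :: nat \<Rightarrow> nat. True}"

abbreviation cech_loc ::
    "('a, 'c) ring_scheme \<Rightarrow> 'a list \<Rightarrow> ('a, 'm, 'd) module_scheme \<Rightarrow> nat set \<Rightarrow>
     ('a, ('m \<times> 'a) set) module" where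
  "cech_loc R fs M S \<equiv> localization R (denominators R fs S) M"

definition cech_index :: "'a list \<Rightarrow> nat \<Rightarrow> nat set set" where
  "cech_index fs i = {S. S \<subseteq> {..<length fs} \<and> card S = i}"

text \<open>The cochain module \<open>C\<^sup>i\<close> is the direct sum, over the subsets \<open>S\<close> of the index set with \<open>i\<close>
  elements, of the localizations of \<open>M\<close> at \<open>\<Prod>\<^sub>s f\<^sub>s\<close>, \<open>s \<in> S\<close>.\<close>

definition cech_cochains ::
    "('a, 'c) ring_scheme \<Rightarrow> 'a list \<Rightarrow> ('a, 'm, 'd) module_scheme \<Rightarrow> nat \<Rightarrow>
     ('a, nat set \<Rightarrow> ('m \<times> 'a) set) module" where
  "cech_cochains R fs M i =
     \<lparr>carrier = (\<Pi>\<^sub>E S\<in>cech_index fs i. carrier (cech_loc R fs M S)),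
      monoid.mult = undefined, one = undefined,
      ring.zero = (\<lambda>S\<in>cech_index fs i. \<zero>\<^bsub>cech_loc R fs M S\<^esub>),
      ring.add = (\<lambda>c c'. \<lambda>S\<in>cech_index fs i. c S \<oplus>\<^bsub>cech_loc R fs M S\<^esub> c' S),
      smult = (\<lambda>r c. \<lambda>S\<in>cech_index fs i. r \<odot>\<^bsub>cech_loc R fs M S\<^esub> c S)\<rparr>"

definition cech_restrict ::
    "('a, 'c) ring_scheme \<Rightarrow> 'a list \<Rightarrow> ('a, 'm, 'd) module_scheme \<Rightarrow> nat set \<Rightarrow>
     ('m \<times> 'a) set \<Rightarrow> ('m \<times> 'a) set" where
  "cech_restrict R fs M T U = (\<Union>(m, s)\<in>U. fraction R (denominators R fs T) M m s)"

definition cech_diff ::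
    "('a, 'c) ring_scheme \<Rightarrow> 'a list \<Rightarrow> ('a, 'm, 'd) module_scheme \<Rightarrow> nat \<Rightarrow>
     (nat set \<Rightarrow> ('m \<times> 'a) set) \<Rightarrow> nat set \<Rightarrow> ('m \<times> 'a) set" where
  "cech_diff R fs M i c =
     (\<lambda>T\<in>cech_index fs (Suc i).
        \<Oplus>\<^bsub>cech_loc R fs M T\<^esub>j\<in>T.
          (let y = cech_restrict R fs M T (c (T - {j}))
           in if even (card {s \<in> T. s < j}) then y else \<ominus>\<^bsub>cech_loc R fs M T\<^esub> y))"

definition cech_cocycles ::
    "('a, 'c) ring_scheme \<Rightarrow> 'a list \<Rightarrow> ('a, 'm, 'd) module_scheme \<Rightarrow> nat \<Rightarrow>
     (nat set \<Rightarrow> ('m \<times> 'a) set) set" where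
  "cech_cocycles R fs M i =
     {c \<in> carrier (cech_cochains R fs M i).
        cech_diff R fs M i c = \<zero>\<^bsub>cech_cochains R fs M (Suc i)\<^esub>}"

fun cech_coboundaries ::
    "('a, 'c) ring_scheme \<Rightarrow> 'a list \<Rightarrow> ('a, 'm, 'd) module_scheme \<Rightarrow> nat \<Rightarrow>
     (nat set \<Rightarrow> ('m \<times> 'a) set) set" where
  "cech_coboundaries R fs M 0 = {\<zero>\<^bsub>cech_cochains R fs M 0\<^esub>}"
| "cech_coboundaries R fs M (Suc i) = cech_diff R fs M i ` carrier (cech_cochains R fs M i)"

text \<open>Local cohomology of \<open>M\<close> with support in the ideal generated by the entries of \<open>fs\<close>.\<close>

definition local_cohomology ::
    "('a, 'c) ring_scheme \<Rightarrow> 'a list \<Rightarrow> ('a, 'm, 'd) module_scheme \<Rightarrow> nat \<Rightarrow>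
     ('a, (nat set \<Rightarrow> ('m \<times> 'a) set) set) module" where
  "local_cohomology R fs M i =
     subquotient (cech_cochains R fs M i) (cech_cocycles R fs M i) (cech_coboundaries R fs M i)"

text \<open>Different finite generating sequences of an ideal give canonically isomorphic local cohomology
  (also as modules with Frobenius action), so properties of local cohomology with support in an ideal
  are required for every such sequence.\<close>

definition generates :: "('a, 'c) ring_scheme \<Rightarrow> 'a list \<Rightarrow> 'a set \<Rightarrow> bool" where
  "generates R fs I \<longleftrightarrow> set fs \<subseteq> carrier R \<and> Idl\<^bsub>R\<^esub> (set fs) = I"

definition FLC ::
    "('a, 'c) ring_scheme \<Rightarrow> 'a set \<Rightarrow> ('a, 'm, 'd) module_scheme \<Rightarrow> bool" where
  "FLC R \<mm> M \<longleftrightarrow>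
     (\<forall>fs. generates R fs \<mm> \<longrightarrow>
        (\<forall>i. enat i < module_dim R M \<longrightarrow> finite_length R (local_cohomology R fs M i)))"

section \<open>The Frobenius action\<close>

definition cech_frobenius ::
    "nat \<Rightarrow> ('a, 'c) ring_scheme \<Rightarrow> 'a list \<Rightarrow> nat \<Rightarrow>
     (nat set \<Rightarrow> ('a \<times> 'a) set) \<Rightarrow> nat set \<Rightarrow> ('a \<times> 'a) set" where
  "cech_frobenius p A fs i c =
     (\<lambda>S\<in>cech_index fs i. \<Union>(a, s)\<in>c S.
        fraction A (denominators A fs S) (ring_as_module A) (a [^]\<^bsub>A\<^esub> p) (s [^]\<^bsub>A\<^esub> p))"

definition frobenius_action ::
    "nat \<Rightarrow> ('a, 'c) ring_scheme \<Rightarrow> 'a list \<Rightarrow> nat \<Rightarrow>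
     (nat set \<Rightarrow> ('a \<times> 'a) set) set \<Rightarrow> (nat set \<Rightarrow> ('a \<times> 'a) set) set" where
  "frobenius_action p A fs i U =
     (\<Union>c\<in>U. cech_coboundaries A fs (ring_as_module A) i
        +>\<^bsub>cech_cochains A fs (ring_as_module A) i\<^esub> cech_frobenius p A fs i c)"

definition F_injective :: "nat \<Rightarrow> ('a, 'c) ring_scheme \<Rightarrow> 'a set \<Rightarrow> bool" where
  "F_injective p A \<nn> \<longleftrightarrow>
     (\<forall>fs. generates A fs \<nn> \<longrightarrow>
        (\<forall>i. inj_on (frobenius_action p A fs i)
               (carrier (local_cohomology A fs (ring_as_module A) i))))"

end

theory Submission
  imports Defs
begin

text \<open>
  Write \<open>H\<^sup>i(M)\<close> for the cohomology of the Cech complex of a generating sequence of the maximal ideal.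
  For \<open>i < dim R/xR\<close> the module \<open>H\<^sup>i(R/xR)\<close> has finite length and an injective Frobenius action, so it
  is a finite-dimensional vector space over the residue field. As this field is perfect, the Frobenius
  images of \<open>H\<^sup>i(R/xR)\<close> are subspaces of the same dimension, and Frobenius is bijective. The
  \<open>p\<^sup>e\<close>-th power of a cochain that is a cocycle modulo \<open>x\<close> is a cocycle modulo the \<open>p\<^sup>e\<close>-th power
  of \<open>x\<close>; hence \<open>H\<^sup>i(R/x\<^sup>nR) \<rightarrow> H\<^sup>i(R/xR)\<close> is surjective for all \<open>n\<close>. For \<open>i \<ge> dim R/xR\<close> the same
  holds because the cohomology of \<open>R/xR\<close> in degree \<open>i + 1\<close>
  vanishes. Consequently multiplication by \<open>x\<close> is surjective on every \<open>H\<^sup>i(R)\<close>, the connecting map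
  embeds \<open>H\<^sup>i\<^sup>-\<^sup>1(R/xR)\<close> into \<open>H\<^sup>i(R)\<close> as the kernel of \<open>x\<close>, and it carries the Frobenius of \<open>R/xR\<close> to
  \<open>x\<close> to the \<open>p - 1\<close> times the Frobenius of \<open>R\<close>. So no nonzero class killed by \<open>x\<close> is killed by Frobenius, and
  since every class is killed by a power of \<open>x\<close>, the Frobenius of \<open>R\<close> is injective.
\<close>

section \<open>Arithmetic of submodules and cosets in carrier-based modules\<close>

section \<open>Submodules and cosets\<close>

text \<open>For n > 1 the quotient R/x^nR is never formed. The argument takes place in one Cech
  complex C of R, on which x is injective: a cocycle of C/x^nC is a cochain c with d c in x^n C, and
  a class of C/xC is zero when it lies in d C + x C. The connecting map is the passage from b with d
  b = x z to z. On this level the gain from Frobenius is visible: d c = x u gives d (F^e c) =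
  x^(p^e) F^e u. The vector space structure on H^i(R/xR) has this reason: by finite length, for each
  r in the maximal ideal some n has r^n H^i = 0, and F^n(r c) = r^(p^n) F^n(c) = 0 because p^n \<ge>
  n; injectivity gives r c = 0. Perfectness enters through a F(b) = F(s b), valid when a = s^p
  modulo the maximal ideal. The vanishing above the dimension is proved for all R/I together, with I
  C in place of a quotient complex, so that noetherian induction can range over the ideals of
  R.\<close>

lemma UN_constant:
  assumes "a \<in> A" "\<And>b. b \<in> A \<Longrightarrow> f b = c" shows "(\<Union>b\<in>A. f b) = c"
  using assms by blast

context module
begin

lemma set_add_iff: "v \<in> H <+>\<^bsub>M\<^esub> K \<longleftrightarrow> (\<exists>h\<in>H. \<exists>k\<in>K. v = h \<oplus>\<^bsub>M\<^esub> k)"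
  by (auto simp: set_add_def')

lemma a_4_comm:
  assumes "a \<in> carrier M" "b \<in> carrier M" "c \<in> carrier M" "e \<in> carrier M"
  shows "(a \<oplus>\<^bsub>M\<^esub> b) \<oplus>\<^bsub>M\<^esub> (c \<oplus>\<^bsub>M\<^esub> e) = (a \<oplus>\<^bsub>M\<^esub> c) \<oplus>\<^bsub>M\<^esub> (b \<oplus>\<^bsub>M\<^esub> e)"
  using assms by (simp add: M.a_ac)

lemma submodule_zero:
  assumes "submodule H R M" shows "\<zero>\<^bsub>M\<^esub> \<in> H"
  using subgroup.one_closed[OF submodule.axioms(1)[OF assms]] by simp

lemma submodule_subset:
  assumes "submodule H R M" "a \<in> H" shows "a \<in> carrier M"
  using submoduleE(1)[OF assms(1)] assms(2) by (rule subsetD)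

lemma submodule_diff:
  assumes "submodule H R M" "a \<in> H" "b \<in> H" shows "a \<ominus>\<^bsub>M\<^esub> b \<in> H"
  unfolding M.minus_eq
  by (rule submoduleE(5)[OF assms(1) assms(2) submoduleE(3)[OF assms(1,3)]])

lemma diff_add_cancel:
  assumes "a \<in> carrier M" "b \<in> carrier M"
  shows "(a \<ominus>\<^bsub>M\<^esub> b) \<oplus>\<^bsub>M\<^esub> b = a"
  using assms by (simp add: M.minus_eq M.a_assoc M.l_neg)

lemma add_diff_cancel:
  assumes "a \<in> carrier M" "b \<in> carrier M"
  shows "(a \<oplus>\<^bsub>M\<^esub> b) \<ominus>\<^bsub>M\<^esub> b = a" and "(b \<oplus>\<^bsub>M\<^esub> a) \<ominus>\<^bsub>M\<^esub> b = a"
proof -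
  show 1: "(a \<oplus>\<^bsub>M\<^esub> b) \<ominus>\<^bsub>M\<^esub> b = a"
    using assms by (simp add: M.minus_eq M.a_assoc M.r_neg)
  show "(b \<oplus>\<^bsub>M\<^esub> a) \<ominus>\<^bsub>M\<^esub> b = a"
    using 1 assms by (simp add: M.a_comm)
qed

lemma submodule_add_cancel:
  assumes "submodule H R M" "a \<oplus>\<^bsub>M\<^esub> b \<in> H" "a \<in> carrier M" "b \<in> carrier M"
  shows "a \<in> H \<Longrightarrow> b \<in> H" and "b \<in> H \<Longrightarrow> a \<in> H"
proof -
  assume "a \<in> H"
  from submodule_diff[OF assms(1,2) this] show "b \<in> H"
    using add_diff_cancel(2)[OF assms(4,3)] by simp
next
  assume "b \<in> H"
  from submodule_diff[OF assms(1,2) this] show "a \<in> H"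
    using add_diff_cancel(1)[OF assms(3,4)] by simp
qed

lemma smult_r_diff:
  assumes "a \<in> carrier R" "x \<in> carrier M" "y \<in> carrier M"
  shows "a \<odot>\<^bsub>M\<^esub> (x \<ominus>\<^bsub>M\<^esub> y) = a \<odot>\<^bsub>M\<^esub> x \<ominus>\<^bsub>M\<^esub> a \<odot>\<^bsub>M\<^esub> y"
  using assms by (simp add: M.minus_eq smult_r_distr smult_r_minus)

lemma smult_comm:
  assumes "a \<in> carrier R" "b \<in> carrier R" "x \<in> carrier M"
  shows "a \<odot>\<^bsub>M\<^esub> (b \<odot>\<^bsub>M\<^esub> x) = b \<odot>\<^bsub>M\<^esub> (a \<odot>\<^bsub>M\<^esub> x)"
  using smult_assoc1[OF assms] smult_assoc1[OF assms(2,1,3)] R.m_comm[OF assms(1,2)] by simp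

lemma submodule_set_add:
  assumes H: "submodule H R M" and K: "submodule K R M"
  shows "submodule (H <+>\<^bsub>M\<^esub> K) R M"
proof (rule submoduleI)
  note c = submodule_subset[OF H] submodule_subset[OF K]
  show "H <+>\<^bsub>M\<^esub> K \<subseteq> carrier M"
    by (rule M.setadd_subset_G[OF submoduleE(1)[OF H] submoduleE(1)[OF K]])
  show "\<zero>\<^bsub>M\<^esub> \<in> H <+>\<^bsub>M\<^esub> K"
    unfolding set_add_iff
    by (rule bexI[OF _ submodule_zero[OF H]], rule bexI[OF _ submodule_zero[OF K]]) simp
  show "\<ominus>\<^bsub>M\<^esub> a \<in> H <+>\<^bsub>M\<^esub> K" if a: "a \<in> H <+>\<^bsub>M\<^esub> K" for a
  proof -
    from a obtain h k where hk: "h \<in> H" "k \<in> K" "a = h \<oplus>\<^bsub>M\<^esub> k"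
      unfolding set_add_iff by blast
    have "\<ominus>\<^bsub>M\<^esub> a = \<ominus>\<^bsub>M\<^esub> h \<oplus>\<^bsub>M\<^esub> \<ominus>\<^bsub>M\<^esub> k"
      using hk c by (simp add: M.minus_add)
    then show ?thesis
      unfolding set_add_iff using submoduleE(3)[OF H hk(1)] submoduleE(3)[OF K hk(2)] by blast
  qed
  show "a \<oplus>\<^bsub>M\<^esub> b \<in> H <+>\<^bsub>M\<^esub> K" if a: "a \<in> H <+>\<^bsub>M\<^esub> K" and b: "b \<in> H <+>\<^bsub>M\<^esub> K" for a b
  proof -
    from a obtain h k where hk: "h \<in> H" "k \<in> K" "a = h \<oplus>\<^bsub>M\<^esub> k"
      unfolding set_add_iff by blast
    from b obtain h' k' where hk': "h' \<in> H" "k' \<in> K" "b = h' \<oplus>\<^bsub>M\<^esub> k'"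
      unfolding set_add_iff by blast
    have "a \<oplus>\<^bsub>M\<^esub> b = (h \<oplus>\<^bsub>M\<^esub> h') \<oplus>\<^bsub>M\<^esub> (k \<oplus>\<^bsub>M\<^esub> k')"
      unfolding hk hk' by (rule a_4_comm) (use c hk hk' in simp_all)
    then show ?thesis
      unfolding set_add_iff
      using submoduleE(5)[OF H hk(1) hk'(1)] submoduleE(5)[OF K hk(2) hk'(2)] by blast
  qed
  show "a \<odot>\<^bsub>M\<^esub> b \<in> H <+>\<^bsub>M\<^esub> K" if a: "a \<in> carrier R" and b: "b \<in> H <+>\<^bsub>M\<^esub> K" for a b
  proof -
    from b obtain h k where hk: "h \<in> H" "k \<in> K" "b = h \<oplus>\<^bsub>M\<^esub> k"
      unfolding set_add_iff by blast
    have "a \<odot>\<^bsub>M\<^esub> b = a \<odot>\<^bsub>M\<^esub> h \<oplus>\<^bsub>M\<^esub> a \<odot>\<^bsub>M\<^esub> k"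
      using a hk c by (simp add: smult_r_distr)
    then show ?thesis
      unfolding set_add_iff using submoduleE(4)[OF H a hk(1)] submoduleE(4)[OF K a hk(2)] by blast
  qed
qed

lemma set_add_subset1:
  assumes "submodule H R M" "submodule K R M" "h \<in> H"
  shows "h \<in> H <+>\<^bsub>M\<^esub> K"
  unfolding set_add_iff
  by (rule bexI[OF _ assms(3)], rule bexI[OF _ submodule_zero[OF assms(2)]])
    (simp add: submodule_subset[OF assms(1,3)])

lemma set_add_subset2:
  assumes "submodule H R M" "submodule K R M" "k \<in> K"
  shows "k \<in> H <+>\<^bsub>M\<^esub> K"
  unfolding set_add_iff
  by (rule bexI[OF _ submodule_zero[OF assms(1)]], rule bexI[OF _ assms(3)])
    (simp add: submodule_subset[OF assms(2,3)])

lemma submodule_multiples: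
  assumes r: "r \<in> carrier R"
  shows "submodule ((\<odot>\<^bsub>M\<^esub>) r ` carrier M) R M"
proof (rule submoduleI)
  show "(\<odot>\<^bsub>M\<^esub>) r ` carrier M \<subseteq> carrier M"
    using r by blast
  show "\<zero>\<^bsub>M\<^esub> \<in> (\<odot>\<^bsub>M\<^esub>) r ` carrier M"
    by (rule image_eqI[where x="\<zero>\<^bsub>M\<^esub>"]) (use r in simp_all)
  show "\<ominus>\<^bsub>M\<^esub> a \<in> (\<odot>\<^bsub>M\<^esub>) r ` carrier M" if "a \<in> (\<odot>\<^bsub>M\<^esub>) r ` carrier M" for a
  proof -
    from that obtain c where c: "c \<in> carrier M" "a = r \<odot>\<^bsub>M\<^esub> c" by blast
    show ?thesis
      by (rule image_eqI[where x="\<ominus>\<^bsub>M\<^esub> c"]) (use r c in \<open>simp_all add: smult_r_minus\<close>)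
  qed
  show "a \<oplus>\<^bsub>M\<^esub> b \<in> (\<odot>\<^bsub>M\<^esub>) r ` carrier M"
    if "a \<in> (\<odot>\<^bsub>M\<^esub>) r ` carrier M" "b \<in> (\<odot>\<^bsub>M\<^esub>) r ` carrier M" for a b
  proof -
    from that obtain c c' where c: "c \<in> carrier M" "a = r \<odot>\<^bsub>M\<^esub> c" "c' \<in> carrier M" "b = r \<odot>\<^bsub>M\<^esub> c'"
      by blast
    show ?thesis
      by (rule image_eqI[where x="c \<oplus>\<^bsub>M\<^esub> c'"]) (use r c in \<open>simp_all add: smult_r_distr\<close>)
  qed
  show "a \<odot>\<^bsub>M\<^esub> b \<in> (\<odot>\<^bsub>M\<^esub>) r ` carrier M"
    if a: "a \<in> carrier R" and b: "b \<in> (\<odot>\<^bsub>M\<^esub>) r ` carrier M" for a b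
  proof -
    from b obtain c where c: "c \<in> carrier M" "b = r \<odot>\<^bsub>M\<^esub> c" by blast
    show ?thesis
      by (rule image_eqI[where x="a \<odot>\<^bsub>M\<^esub> c"]) (use r a c in \<open>simp_all add: smult_comm\<close>)
  qed
qed

lemma submodule_finsum:
  assumes H: "submodule H R M" and f: "\<And>j. j \<in> A \<Longrightarrow> f j \<in> H"
  shows "(\<Oplus>\<^bsub>M\<^esub>j\<in>A. f j) \<in> H"
  using f
proof (induction A rule: infinite_finite_induct)
  case (infinite A)
  then show ?case using submodule_zero[OF H] by (simp add: M.finsum_infinite)
next
  case empty
  then show ?case using submodule_zero[OF H] by simp
next
  case (insert a A)
  have 1: "f a \<in> H" "(\<Oplus>\<^bsub>M\<^esub>j\<in>A. f j) \<in> H" using insert by blast+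
  have "f \<in> A \<rightarrow> carrier M" using insert.prems submodule_subset[OF H] by blast
  then have "(\<Oplus>\<^bsub>M\<^esub>j\<in>insert a A. f j) = f a \<oplus>\<^bsub>M\<^esub> (\<Oplus>\<^bsub>M\<^esub>j\<in>A. f j)"
    using insert.hyps submodule_subset[OF H 1(1)] by (simp add: M.finsum_insert)
  then show ?case using submoduleE(5)[OF H 1] by simp
qed

lemma mem_coset_iff: "v \<in> B +>\<^bsub>M\<^esub> z \<longleftrightarrow> (\<exists>b\<in>B. v = b \<oplus>\<^bsub>M\<^esub> z)"
  unfolding a_r_coset_def' by blast

lemma coset_eq_iff:
  assumes B: "submodule B R M" and z: "z \<in> carrier M" "z' \<in> carrier M"
  shows "B +>\<^bsub>M\<^esub> z = B +>\<^bsub>M\<^esub> z' \<longleftrightarrow> z \<ominus>\<^bsub>M\<^esub> z' \<in> B"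
proof
  assume eq: "B +>\<^bsub>M\<^esub> z = B +>\<^bsub>M\<^esub> z'"
  have "z = \<zero>\<^bsub>M\<^esub> \<oplus>\<^bsub>M\<^esub> z" using z by simp
  then have "z \<in> B +>\<^bsub>M\<^esub> z" unfolding mem_coset_iff using submodule_zero[OF B] by blast
  then obtain b where b: "b \<in> B" "z = b \<oplus>\<^bsub>M\<^esub> z'" unfolding eq mem_coset_iff by blast
  then show "z \<ominus>\<^bsub>M\<^esub> z' \<in> B"
    using add_diff_cancel(1)[OF submodule_subset[OF B b(1)] z(2)] by simp
next
  assume d: "z \<ominus>\<^bsub>M\<^esub> z' \<in> B"
  have "z \<in> B +>\<^bsub>M\<^esub> z'"
    unfolding mem_coset_iff using d diff_add_cancel[OF z] by metis
  then show "B +>\<^bsub>M\<^esub> z = B +>\<^bsub>M\<^esub> z'"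
    using M.a_repr_independence[OF _ z(2) submodule.axioms(1)[OF B]] by simp
qed

lemma coset_zero:
  assumes B: "submodule B R M" shows "B +>\<^bsub>M\<^esub> \<zero>\<^bsub>M\<^esub> = B"
  by (rule M.a_coset_add_zero[OF submoduleE(1)[OF B]])

lemma coset_eq_self_iff:
  assumes B: "submodule B R M" and z: "z \<in> carrier M"
  shows "B +>\<^bsub>M\<^esub> z = B \<longleftrightarrow> z \<in> B"
  using coset_eq_iff[OF B z M.zero_closed] coset_zero[OF B] z add_diff_cancel(1)[OF z M.zero_closed] by simp

lemma coset_add:
  assumes B: "submodule B R M" and z: "z \<in> carrier M" "z' \<in> carrier M"
  shows "(B +>\<^bsub>M\<^esub> z) <+>\<^bsub>M\<^esub> (B +>\<^bsub>M\<^esub> z') = B +>\<^bsub>M\<^esub> (z \<oplus>\<^bsub>M\<^esub> z')"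
proof -
  interpret abelian_subgroup B M
    by (rule abelian_subgroupI3[OF additive_subgroup.intro[OF submodule.axioms(1)[OF B]] M.abelian_group_axioms])
  show ?thesis by (rule a_rcos_sum[OF z])
qed

text \<open>The scalar action of \<open>subquotient\<close> is a union over all representatives of a
  coset. Its members agree because \<open>r\<close> maps \<open>B\<close> into \<open>B\<close>, so
  the union collapses to one coset and later proofs may compute with a chosen
  representative.\<close>

lemma coset_smult:
  assumes B: "submodule B R M" and r: "r \<in> carrier R" and z: "z \<in> carrier M"
  shows "(\<Union>v\<in>B +>\<^bsub>M\<^esub> z. B +>\<^bsub>M\<^esub> (r \<odot>\<^bsub>M\<^esub> v)) = B +>\<^bsub>M\<^esub> (r \<odot>\<^bsub>M\<^esub> z)"
proof (rule UN_constant)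
  have "z = \<zero>\<^bsub>M\<^esub> \<oplus>\<^bsub>M\<^esub> z" using z by simp
  then show "z \<in> B +>\<^bsub>M\<^esub> z" unfolding mem_coset_iff using submodule_zero[OF B] by blast
  fix v assume "v \<in> B +>\<^bsub>M\<^esub> z"
  then obtain b where b: "b \<in> B" "v = b \<oplus>\<^bsub>M\<^esub> z" unfolding mem_coset_iff by blast
  have bc: "b \<in> carrier M" by (rule submodule_subset[OF B b(1)])
  have "r \<odot>\<^bsub>M\<^esub> v \<ominus>\<^bsub>M\<^esub> r \<odot>\<^bsub>M\<^esub> z = r \<odot>\<^bsub>M\<^esub> b"
    unfolding b(2) smult_r_distr[OF r bc z] by (rule add_diff_cancel(1)) (use r bc z in simp_all)
  then have "r \<odot>\<^bsub>M\<^esub> v \<ominus>\<^bsub>M\<^esub> r \<odot>\<^bsub>M\<^esub> z \<in> B" using submoduleE(4)[OF B r b(1)] by simp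
  then show "B +>\<^bsub>M\<^esub> (r \<odot>\<^bsub>M\<^esub> v) = B +>\<^bsub>M\<^esub> (r \<odot>\<^bsub>M\<^esub> z)"
    by (subst coset_eq_iff[OF B]) (use r b z bc in simp_all)
qed

lemma subquotient_simps:
  "carrier (subquotient M Z B) = (\<lambda>z. B +>\<^bsub>M\<^esub> z) ` Z" "\<zero>\<^bsub>subquotient M Z B\<^esub> = B"
  "U \<oplus>\<^bsub>subquotient M Z B\<^esub> V = U <+>\<^bsub>M\<^esub> V"
  "r \<odot>\<^bsub>subquotient M Z B\<^esub> U = (\<Union>z\<in>U. B +>\<^bsub>M\<^esub> (r \<odot>\<^bsub>M\<^esub> z))"
  unfolding subquotient_def by simp_all

lemma module_subquotient:
  assumes B: "submodule B R M" and Z: "submodule Z R M"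
  shows "module R (subquotient M Z B)"
proof (rule moduleI[OF R.is_cring])
  note Zc = submodule_subset[OF Z]
  note Z' = submoduleE(3-5)[OF Z]
  let ?Q = "subquotient M Z B"
  have E: "\<exists>z\<in>Z. U = B +>\<^bsub>M\<^esub> z" if "U \<in> carrier ?Q" for U
    using that unfolding subquotient_simps by blast
  have C: "B +>\<^bsub>M\<^esub> z \<in> carrier ?Q" if "z \<in> Z" for z
    using that unfolding subquotient_simps by blast
  have add: "(B +>\<^bsub>M\<^esub> z) \<oplus>\<^bsub>?Q\<^esub> (B +>\<^bsub>M\<^esub> z') = B +>\<^bsub>M\<^esub> (z \<oplus>\<^bsub>M\<^esub> z')" if "z \<in> Z" "z' \<in> Z" for z z'
    unfolding subquotient_simps by (rule coset_add[OF B Zc[OF that(1)] Zc[OF that(2)]])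
  have smult: "r \<odot>\<^bsub>?Q\<^esub> (B +>\<^bsub>M\<^esub> z) = B +>\<^bsub>M\<^esub> (r \<odot>\<^bsub>M\<^esub> z)" if "r \<in> carrier R" "z \<in> Z" for r z
    unfolding subquotient_simps by (rule coset_smult[OF B that(1) Zc[OF that(2)]])
  have zero: "\<zero>\<^bsub>?Q\<^esub> = B +>\<^bsub>M\<^esub> \<zero>\<^bsub>M\<^esub>" unfolding subquotient_simps coset_zero[OF B] ..
  note simps = add smult Z' Zc C
  show "abelian_group ?Q"
  proof (rule abelian_groupI)
    fix U V assume U: "U \<in> carrier ?Q" and V: "V \<in> carrier ?Q"
    obtain u v where uv: "u \<in> Z" "U = B +>\<^bsub>M\<^esub> u" "v \<in> Z" "V = B +>\<^bsub>M\<^esub> v" using E[OF U] E[OF V] by blast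
    show "U \<oplus>\<^bsub>?Q\<^esub> V \<in> carrier ?Q" unfolding uv using uv(1,3) by (simp add: simps)
    show "U \<oplus>\<^bsub>?Q\<^esub> V = V \<oplus>\<^bsub>?Q\<^esub> U" unfolding uv using uv(1,3) by (simp add: simps M.a_comm)
    fix W assume W: "W \<in> carrier ?Q"
    obtain w where w: "w \<in> Z" "W = B +>\<^bsub>M\<^esub> w" using E[OF W] by blast
    show "U \<oplus>\<^bsub>?Q\<^esub> V \<oplus>\<^bsub>?Q\<^esub> W = U \<oplus>\<^bsub>?Q\<^esub> (V \<oplus>\<^bsub>?Q\<^esub> W)"
      unfolding uv w using uv(1,3) w(1) by (simp add: simps M.a_assoc)
  next
    show "\<zero>\<^bsub>?Q\<^esub> \<in> carrier ?Q" unfolding zero by (rule C[OF submodule_zero[OF Z]])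
  next
    fix U assume U: "U \<in> carrier ?Q"
    obtain u where u: "u \<in> Z" "U = B +>\<^bsub>M\<^esub> u" using E[OF U] by blast
    show "\<zero>\<^bsub>?Q\<^esub> \<oplus>\<^bsub>?Q\<^esub> U = U"
      unfolding zero u using u(1) submodule_zero[OF Z] by (simp add: simps)
    have "(B +>\<^bsub>M\<^esub> (\<ominus>\<^bsub>M\<^esub> u)) \<oplus>\<^bsub>?Q\<^esub> U = \<zero>\<^bsub>?Q\<^esub>"
      unfolding zero u using u(1) by (simp add: simps M.l_neg)
    then show "\<exists>V\<in>carrier ?Q. V \<oplus>\<^bsub>?Q\<^esub> U = \<zero>\<^bsub>?Q\<^esub>"
      by (rule bexI) (rule C[OF Z'(1)[OF u(1)]])
  qed
  fix r s U V assume r: "r \<in> carrier R" and U: "U \<in> carrier ?Q"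
  obtain u where u: "u \<in> Z" "U = B +>\<^bsub>M\<^esub> u" using E[OF U] by blast
  show "r \<odot>\<^bsub>?Q\<^esub> U \<in> carrier ?Q" unfolding u using u(1) r by (simp add: simps)
  { assume s: "s \<in> carrier R"
    show "(r \<oplus> s) \<odot>\<^bsub>?Q\<^esub> U = r \<odot>\<^bsub>?Q\<^esub> U \<oplus>\<^bsub>?Q\<^esub> s \<odot>\<^bsub>?Q\<^esub> U"
      unfolding u using u(1) r s by (simp add: simps smult_l_distr)
    show "(r \<otimes> s) \<odot>\<^bsub>?Q\<^esub> U = r \<odot>\<^bsub>?Q\<^esub> (s \<odot>\<^bsub>?Q\<^esub> U)"
      unfolding u using u(1) r s by (simp add: simps smult_assoc1) }
  { assume V: "V \<in> carrier ?Q"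
    obtain v where v: "v \<in> Z" "V = B +>\<^bsub>M\<^esub> v" using E[OF V] by blast
    show "r \<odot>\<^bsub>?Q\<^esub> (U \<oplus>\<^bsub>?Q\<^esub> V) = r \<odot>\<^bsub>?Q\<^esub> U \<oplus>\<^bsub>?Q\<^esub> r \<odot>\<^bsub>?Q\<^esub> V"
      unfolding u v using u(1) v(1) r by (simp add: simps smult_r_distr) }
next
  fix U assume "U \<in> carrier (subquotient M Z B)"
  then obtain u where u: "u \<in> Z" "U = B +>\<^bsub>M\<^esub> u" unfolding subquotient_simps by blast
  have uc: "u \<in> carrier M" by (rule submodule_subset[OF Z u(1)])
  show "\<one> \<odot>\<^bsub>subquotient M Z B\<^esub> U = U"
    unfolding u subquotient_simps coset_smult[OF B R.one_closed uc] using uc by simp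
qed

end

lemma ring_as_module_simps [simp]:
  "carrier (ring_as_module R) = carrier R" "\<zero>\<^bsub>ring_as_module R\<^esub> = \<zero>\<^bsub>R\<^esub>"
  "add (ring_as_module R) = add R" "smult (ring_as_module R) = monoid.mult R"
  unfolding ring_as_module_def by simp_all

lemma (in cring) module_ring_as_module: "module R (ring_as_module R)"
proof (rule moduleI[OF is_cring])
  show "abelian_group (ring_as_module R)"
  proof (rule abelian_groupI)
    fix a assume "a \<in> carrier (ring_as_module R)"
    then show "\<exists>b\<in>carrier (ring_as_module R). b \<oplus>\<^bsub>ring_as_module R\<^esub> a = \<zero>\<^bsub>ring_as_module R\<^esub>"
      by (intro bexI[of _ "\<ominus> a"]) (simp_all add: l_neg)
  qed (simp_all add: a_ac)
qed (simp_all add: l_distr r_distr m_assoc)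

lemma a_r_coset_ring_as_module [simp]: "J +>\<^bsub>ring_as_module R\<^esub> a = J +>\<^bsub>R\<^esub> a"
  unfolding a_r_coset_def' by simp

lemma (in cring) ideal_submodule:
  assumes J: "ideal J R" shows "submodule J R (ring_as_module R)"
proof -
  interpret RM: module R "ring_as_module R" by (rule module_ring_as_module)
  interpret J: ideal J R by (rule J)
  have car: "J \<subseteq> carrier (ring_as_module R)" using J.a_subset by simp
  have smult: "r \<odot>\<^bsub>ring_as_module R\<^esub> a \<in> J" if "r \<in> carrier R" "a \<in> J" for r a
    using J.I_l_closed[OF that(2,1)] by simp
  show ?thesis
  proof (rule RM.submoduleI[OF car])
    show "\<ominus>\<^bsub>ring_as_module R\<^esub> a \<in> J" if a: "a \<in> J" for a
      using smult[of "\<ominus> \<one>" a] RM.smult_l_minus[of \<one> a] subsetD[OF car a] a RM.smult_one by simp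
  qed (use smult in simp_all)
qed

section \<open>Cocycles modulo powers of an element on which the complex is torsion-free\<close>

section \<open>Lifting cocycles along powers of an element\<close>

text \<open>The lifting argument uses only a linear differential of square zero, so it is carried
  out for an arbitrary complex. The Cech complex becomes an instance later, both over R and over its
  quotients.\<close>

locale cochain_complex = cring R for R :: "('a, 'c) ring_scheme" (structure) +
  fixes C :: "nat \<Rightarrow> ('a, 'b, 'e) module_scheme" and d :: "nat \<Rightarrow> 'b \<Rightarrow> 'b"
  assumes module_C: "module R (C i)"
    and d_closed: "c \<in> carrier (C i) \<Longrightarrow> d i c \<in> carrier (C (Suc i))"
    and d_add: "\<lbrakk>c \<in> carrier (C i); c' \<in> carrier (C i)\<rbrakk>
      \<Longrightarrow> d i (c \<oplus>\<^bsub>C i\<^esub> c') = d i c \<oplus>\<^bsub>C (Suc i)\<^esub> d i c'"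
    and d_smult: "\<lbrakk>r \<in> carrier R; c \<in> carrier (C i)\<rbrakk>
      \<Longrightarrow> d i (r \<odot>\<^bsub>C i\<^esub> c) = r \<odot>\<^bsub>C (Suc i)\<^esub> d i c"
    and d_d: "c \<in> carrier (C i) \<Longrightarrow> d (Suc i) (d i c) = \<zero>\<^bsub>C (Suc (Suc i))\<^esub>"
begin

sublocale K: module R "C i" for i
  by (rule module_C)

fun coboundaries :: "nat \<Rightarrow> 'b set" where
  "coboundaries 0 = {\<zero>\<^bsub>C 0\<^esub>}"
| "coboundaries (Suc i) = d i ` carrier (C i)"

lemma d_zero: "d i \<zero>\<^bsub>C i\<^esub> = \<zero>\<^bsub>C (Suc i)\<^esub>"
  using d_smult[of \<zero> "\<zero>\<^bsub>C i\<^esub>" i] d_closed[of "\<zero>\<^bsub>C i\<^esub>" i] by simp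

lemma d_neg:
  assumes "c \<in> carrier (C i)"
  shows "d i (\<ominus>\<^bsub>C i\<^esub> c) = \<ominus>\<^bsub>C (Suc i)\<^esub> d i c"
proof -
  have "d i (\<ominus>\<^bsub>C i\<^esub> c) = d i ((\<ominus> \<one>) \<odot>\<^bsub>C i\<^esub> c)"
    using assms by (simp add: K.smult_l_minus)
  also have "\<dots> = \<ominus>\<^bsub>C (Suc i)\<^esub> d i c"
    using assms d_closed[OF assms] d_smult[of "\<ominus> \<one>" c i] by (simp add: K.smult_l_minus)
  finally show ?thesis .
qed

lemma d_diff:
  assumes "c \<in> carrier (C i)" "c' \<in> carrier (C i)"
  shows "d i (c \<ominus>\<^bsub>C i\<^esub> c') = d i c \<ominus>\<^bsub>C (Suc i)\<^esub> d i c'"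
  using assms by (simp add: K.minus_eq d_add d_neg)

lemma submodule_coboundaries: "submodule (coboundaries i) R (C i)"
proof (cases i)
  case 0
  show ?thesis unfolding 0
    by (rule K.submoduleI) simp_all
next
  case (Suc j)
  show ?thesis unfolding Suc coboundaries.simps
  proof (rule K.submoduleI)
    show "d j ` carrier (C j) \<subseteq> carrier (C (Suc j))"
      using d_closed by blast
    show "\<zero>\<^bsub>C (Suc j)\<^esub> \<in> d j ` carrier (C j)"
      by (rule image_eqI[where x="\<zero>\<^bsub>C j\<^esub>"]) (simp_all add: d_zero)
    show "\<ominus>\<^bsub>C (Suc j)\<^esub> a \<in> d j ` carrier (C j)" if "a \<in> d j ` carrier (C j)" for a
    proof -
      from that obtain c where c: "c \<in> carrier (C j)" "a = d j c" by blast
      show ?thesis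
        by (rule image_eqI[where x="\<ominus>\<^bsub>C j\<^esub> c"]) (use c in \<open>simp_all add: d_neg\<close>)
    qed
    show "a \<oplus>\<^bsub>C (Suc j)\<^esub> b \<in> d j ` carrier (C j)"
      if "a \<in> d j ` carrier (C j)" "b \<in> d j ` carrier (C j)" for a b
    proof -
      from that obtain c c' where c: "c \<in> carrier (C j)" "a = d j c" "c' \<in> carrier (C j)" "b = d j c'"
        by blast
      show ?thesis
        by (rule image_eqI[where x="c \<oplus>\<^bsub>C j\<^esub> c'"]) (use c in \<open>simp_all add: d_add\<close>)
    qed
    show "a \<odot>\<^bsub>C (Suc j)\<^esub> b \<in> d j ` carrier (C j)"
      if a: "a \<in> carrier R" and b: "b \<in> d j ` carrier (C j)" for a b
    proof -
      from b obtain c where c: "c \<in> carrier (C j)" "b = d j c" by blast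
      show ?thesis
        by (rule image_eqI[where x="a \<odot>\<^bsub>C j\<^esub> c"]) (use a c in \<open>simp_all add: d_smult\<close>)
    qed
  qed
qed

lemma coboundaries_subset: "b \<in> coboundaries i \<Longrightarrow> b \<in> carrier (C i)"
  by (rule K.submodule_subset[OF submodule_coboundaries])

lemma d_coboundaries:
  assumes "b \<in> coboundaries i" shows "d i b = \<zero>\<^bsub>C (Suc i)\<^esub>"
proof (cases i)
  case 0
  then show ?thesis using assms by (simp add: d_zero)
next
  case (Suc j)
  then show ?thesis using assms d_d by auto
qed

lemma d_image_coboundaries: "c \<in> carrier (C i) \<Longrightarrow> d i c \<in> coboundaries (Suc i)"
  by simp

lemma submodule_cocycles:
  "submodule {c \<in> carrier (C i). d i c = \<zero>\<^bsub>C (Suc i)\<^esub>} R (C i)"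
  by (rule K.submoduleI) (auto simp: d_zero d_neg d_add d_smult)

text \<open>For the Cech complex of R these are the cochains that become zero over R/rR. Hence
  \<open>d i c \<in> multiples r (Suc i)\<close> says that \<open>c\<close> is a cocycle modulo
  \<open>r\<close>, without a quotient complex.\<close>

definition multiples :: "'a \<Rightarrow> nat \<Rightarrow> 'b set" where
  "multiples r i = (\<odot>\<^bsub>C i\<^esub>) r ` carrier (C i)"

lemma submodule_multiples: "r \<in> carrier R \<Longrightarrow> submodule (multiples r i) R (C i)"
  unfolding multiples_def by (rule K.submodule_multiples)

lemma multiplesI: "c \<in> carrier (C i) \<Longrightarrow> r \<odot>\<^bsub>C i\<^esub> c \<in> multiples r i"
  unfolding multiples_def by (rule imageI)

lemma multiplesE:
  assumes "v \<in> multiples r i"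
  obtains c where "c \<in> carrier (C i)" "v = r \<odot>\<^bsub>C i\<^esub> c"
  using assms unfolding multiples_def by blast

lemma multiples_pow_subset:
  fixes n m :: nat
  assumes "r \<in> carrier R" "n \<le> m" "v \<in> multiples (r [^] m) i"
  shows "v \<in> multiples (r [^] n) i"
proof -
  from assms(3) obtain c where c: "c \<in> carrier (C i)" "v = (r [^] m) \<odot>\<^bsub>C i\<^esub> c" by (rule multiplesE)
  have "r [^] m = r [^] n \<otimes> r [^] (m - n)"
    using assms(1,2) by (simp add: nat_pow_mult)
  then have "v = (r [^] n) \<odot>\<^bsub>C i\<^esub> ((r [^] (m - n)) \<odot>\<^bsub>C i\<^esub> c)"
    using c assms(1) by (simp add: K.smult_assoc1)
  then show ?thesis
    using multiplesI[of "(r [^] (m - n)) \<odot>\<^bsub>C i\<^esub> c" i] c(1) assms(1) by simp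
qed

end

text \<open>Injectivity of x on every C^i makes 0 -> C -> C -> C/xC -> 0 exact, with x as the first
  map. The connecting map of this sequence is used below in the form d b = x z.\<close>

locale torsion_free_complex = cochain_complex R C d
  for R :: "('a, 'c) ring_scheme" (structure) and C :: "nat \<Rightarrow> ('a, 'b, 'e) module_scheme" and d +
  fixes x :: 'a
  assumes x_closed: "x \<in> carrier R"
    and torsion_free: "\<lbrakk>c \<in> carrier (C i); x \<odot>\<^bsub>C i\<^esub> c = \<zero>\<^bsub>C i\<^esub>\<rbrakk> \<Longrightarrow> c = \<zero>\<^bsub>C i\<^esub>"
begin

lemma torsion_free_pow:
  assumes "c \<in> carrier (C i)" "(x [^] (n::nat)) \<odot>\<^bsub>C i\<^esub> c = \<zero>\<^bsub>C i\<^esub>"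
  shows "c = \<zero>\<^bsub>C i\<^esub>"
  using assms(2)
proof (induction n)
  case 0
  then show ?case using assms(1) by simp
next
  case (Suc n)
  have "x \<odot>\<^bsub>C i\<^esub> ((x [^] n) \<odot>\<^bsub>C i\<^esub> c) = (x [^] Suc n) \<odot>\<^bsub>C i\<^esub> c"
    using x_closed assms(1) by (simp add: K.smult_comm K.smult_assoc1)
  then have "(x [^] n) \<odot>\<^bsub>C i\<^esub> c = \<zero>\<^bsub>C i\<^esub>"
    using torsion_free[of "(x [^] n) \<odot>\<^bsub>C i\<^esub> c" i] Suc.prems x_closed assms(1) by simp
  then show ?case by (rule Suc.IH)
qed

lemma smult_pow_cancel:
  assumes "a \<in> carrier (C i)" "b \<in> carrier (C i)"
    "(x [^] (n::nat)) \<odot>\<^bsub>C i\<^esub> a = (x [^] n) \<odot>\<^bsub>C i\<^esub> b"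
  shows "a = b"
proof -
  have "(x [^] n) \<odot>\<^bsub>C i\<^esub> (a \<ominus>\<^bsub>C i\<^esub> b) = \<zero>\<^bsub>C i\<^esub>"
    using K.smult_r_diff[of "x [^] n" a i b] assms x_closed by (simp add: K.minus_eq K.r_neg)
  then have "a \<ominus>\<^bsub>C i\<^esub> b = \<zero>\<^bsub>C i\<^esub>"
    using torsion_free_pow[of "a \<ominus>\<^bsub>C i\<^esub> b" i n] assms by simp
  then show ?thesis
    using K.diff_add_cancel[OF assms(1,2)] assms by simp
qed

lemma smult_cancel:
  assumes "a \<in> carrier (C i)" "b \<in> carrier (C i)" "x \<odot>\<^bsub>C i\<^esub> a = x \<odot>\<^bsub>C i\<^esub> b"
  shows "a = b"
  using smult_pow_cancel[of a i b 1] assms x_closed by simp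

text \<open>The preimage in C^i of the coboundaries of C/xC, that is, the cochains whose class
  modulo x is zero.\<close>

definition reduced_coboundaries :: "nat \<Rightarrow> 'b set" where
  "reduced_coboundaries i = coboundaries i <+>\<^bsub>C i\<^esub> multiples x i"

lemma submodule_reduced_coboundaries: "submodule (reduced_coboundaries i) R (C i)"
  unfolding reduced_coboundaries_def
  by (rule K.submodule_set_add[OF submodule_coboundaries submodule_multiples[OF x_closed]])

lemma reduced_coboundariesE:
  assumes "v \<in> reduced_coboundaries i"
  obtains b c where "b \<in> coboundaries i" "c \<in> carrier (C i)" "v = b \<oplus>\<^bsub>C i\<^esub> x \<odot>\<^bsub>C i\<^esub> c"
  using assms unfolding reduced_coboundaries_def K.set_add_iff multiples_def by blast

lemma reduced_coboundariesI1: "b \<in> coboundaries i \<Longrightarrow> b \<in> reduced_coboundaries i"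
  unfolding reduced_coboundaries_def
  by (rule K.set_add_subset1[OF submodule_coboundaries submodule_multiples[OF x_closed]])

lemma reduced_coboundariesI2: "v \<in> multiples x i \<Longrightarrow> v \<in> reduced_coboundaries i"
  unfolding reduced_coboundaries_def
  by (rule K.set_add_subset2[OF submodule_coboundaries submodule_multiples[OF x_closed]])

lemma d_reduced_coboundaries:
  assumes "v \<in> reduced_coboundaries i" shows "d i v \<in> multiples x (Suc i)"
proof -
  from assms obtain b c where bc: "b \<in> coboundaries i" "c \<in> carrier (C i)"
    "v = b \<oplus>\<^bsub>C i\<^esub> x \<odot>\<^bsub>C i\<^esub> c" by (rule reduced_coboundariesE)
  have "d i v = x \<odot>\<^bsub>C (Suc i)\<^esub> d i c"
    unfolding bc(3)
    using bc(1,2) x_closed d_closed[OF bc(2)] coboundaries_subset[OF bc(1)]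
    by (simp add: d_add d_smult d_coboundaries)
  then show ?thesis using multiplesI[OF d_closed[OF bc(2)]] by simp
qed

text \<open>Surjectivity of H^i(C/x^nC) -> H^i(C/xC) for all n, written on cochains:
  \<open>c\<close> is a cocycle modulo x, and \<open>c'\<close> is a cocycle modulo x^n in the same
  class modulo x.\<close>

definition liftable :: "nat \<Rightarrow> bool" where
  "liftable i \<longleftrightarrow> (\<forall>c\<in>carrier (C i). d i c \<in> multiples x (Suc i) \<longrightarrow>
     (\<forall>n::nat. \<exists>c'\<in>carrier (C i). \<exists>v\<in>reduced_coboundaries i.
        c = c' \<oplus>\<^bsub>C i\<^esub> v \<and> d i c' \<in> multiples (x [^] n) (Suc i)))"

lemma liftableE:
  assumes "liftable i" "c \<in> carrier (C i)" "d i c \<in> multiples x (Suc i)"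
  obtains c' v where "c' \<in> carrier (C i)" "v \<in> reduced_coboundaries i" "c = c' \<oplus>\<^bsub>C i\<^esub> v"
    "d i c' \<in> multiples (x [^] (n::nat)) (Suc i)"
  using assms unfolding liftable_def by blast

text \<open>In cohomological terms: if the classes of degree \<open>i - 1\<close> modulo \<open>x\<close> lift modulo every power
  of \<open>x\<close>, then multiplication by \<open>x\<close> is surjective on \<open>x\<close>-power torsion of degree \<open>i\<close>.\<close>

lemma torsion_cocycle_reduced_coboundary:
  assumes lift: "\<And>j. i = Suc j \<Longrightarrow> liftable j"
    and z: "z \<in> carrier (C i)" "d i z = \<zero>\<^bsub>C (Suc i)\<^esub>"
      "(x [^] (n::nat)) \<odot>\<^bsub>C i\<^esub> z \<in> coboundaries i"
  shows "z \<in> reduced_coboundaries i"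
proof (cases i)
  case 0
  have "z = \<zero>\<^bsub>C i\<^esub>"
    using torsion_free_pow[OF z(1)] z(3) 0 by simp
  then show ?thesis
    using K.submodule_zero[OF submodule_reduced_coboundaries] by simp
next
  case (Suc j)
  show ?thesis using z
  proof (induction n arbitrary: z)
    case 0
    then show ?case using reduced_coboundariesI1 by simp
  next
    case (Suc n z)
    note zc = Suc.prems(1)
    \<comment> \<open>Since d b = x (x^n z), \<open>b\<close> is a cocycle modulo x and can be
      lifted. The lift is taken modulo x^(n+2), one power above the exponent at hand: after x is
      cancelled from the equation for d b, the lifted part reads x^n (x w), so that \<open>z\<close>
      is compared with a multiple of x.\<close>
    let ?k = "Suc (Suc n)"
    obtain b where b: "b \<in> carrier (C j)" "(x [^] Suc n) \<odot>\<^bsub>C i\<^esub> z = d j b"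
      using Suc.prems(3) unfolding \<open>i = Suc j\<close> by auto
    have "d j b = x \<odot>\<^bsub>C i\<^esub> ((x [^] n) \<odot>\<^bsub>C i\<^esub> z)"
      unfolding b(2)[symmetric] using x_closed zc by (simp add: K.smult_comm K.smult_assoc1)
    then have "d j b \<in> multiples x (Suc j)"
      using multiplesI[of "(x [^] n) \<odot>\<^bsub>C i\<^esub> z" i x] zc x_closed \<open>i = Suc j\<close> by simp
    from liftableE[OF lift[OF \<open>i = Suc j\<close>] b(1) this, where n = ?k]
    obtain b' v where b': "b' \<in> carrier (C j)" "v \<in> reduced_coboundaries j"
      "b = b' \<oplus>\<^bsub>C j\<^esub> v" "d j b' \<in> multiples (x [^] ?k) (Suc j)" by metis
    obtain w where w: "w \<in> carrier (C i)" "d j b' = (x [^] ?k) \<odot>\<^bsub>C i\<^esub> w"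
      using b'(4) \<open>i = Suc j\<close> by (auto elim: multiplesE)
    obtain e b3 where v: "e \<in> coboundaries j" "b3 \<in> carrier (C j)" "v = e \<oplus>\<^bsub>C j\<^esub> x \<odot>\<^bsub>C j\<^esub> b3"
      using b'(2) by (rule reduced_coboundariesE)
    have vc: "v \<in> carrier (C j)" using v coboundaries_subset x_closed by simp
    have dv: "d j v = x \<odot>\<^bsub>C i\<^esub> d j b3"
      unfolding v(3) \<open>i = Suc j\<close>
      using v(1,2) x_closed d_closed[OF v(2)] coboundaries_subset[OF v(1)]
      by (simp add: d_add d_smult d_coboundaries)
    have db3: "d j b3 \<in> carrier (C i)" using d_closed[OF v(2)] \<open>i = Suc j\<close> by simp
    have xk: "(x [^] ?k) \<odot>\<^bsub>C i\<^esub> w = x \<odot>\<^bsub>C i\<^esub> ((x [^] n) \<odot>\<^bsub>C i\<^esub> (x \<odot>\<^bsub>C i\<^esub> w))"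
      using x_closed w(1) by (simp add: K.smult_assoc1[symmetric] m_ac)
    have xn: "(x [^] Suc n) \<odot>\<^bsub>C i\<^esub> z = x \<odot>\<^bsub>C i\<^esub> ((x [^] n) \<odot>\<^bsub>C i\<^esub> z)"
      using x_closed zc by (simp add: K.smult_assoc1[symmetric] m_ac)
    have "d j b = (x [^] ?k) \<odot>\<^bsub>C i\<^esub> w \<oplus>\<^bsub>C i\<^esub> x \<odot>\<^bsub>C i\<^esub> d j b3"
      unfolding b'(3) using d_add[OF b'(1) vc] w(2) dv \<open>i = Suc j\<close> by simp
    then have "x \<odot>\<^bsub>C i\<^esub> ((x [^] n) \<odot>\<^bsub>C i\<^esub> z) =
      x \<odot>\<^bsub>C i\<^esub> ((x [^] n) \<odot>\<^bsub>C i\<^esub> (x \<odot>\<^bsub>C i\<^esub> w) \<oplus>\<^bsub>C i\<^esub> d j b3)"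
      using b(2) xk xn x_closed w(1) db3 by (simp add: K.smult_r_distr)
    then have eq: "(x [^] n) \<odot>\<^bsub>C i\<^esub> z = (x [^] n) \<odot>\<^bsub>C i\<^esub> (x \<odot>\<^bsub>C i\<^esub> w) \<oplus>\<^bsub>C i\<^esub> d j b3"
      by (rule smult_cancel[rotated 2]) (use x_closed w(1) db3 zc in simp_all)
    \<comment> \<open>The difference z - x w is killed by x^n in cohomology, so the induction
      hypothesis covers it, and x w is zero modulo x by its form. What remains is that
      \<open>w\<close> is a cocycle, which holds because x^(n+2) d w = d (d b') = 0.\<close>
    let ?z = "z \<ominus>\<^bsub>C i\<^esub> x \<odot>\<^bsub>C i\<^esub> w"
    have xw: "x \<odot>\<^bsub>C i\<^esub> w \<in> carrier (C i)" using x_closed w(1) by simp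
    have zc': "?z \<in> carrier (C i)" using zc xw by simp
    have "(x [^] n) \<odot>\<^bsub>C i\<^esub> ?z = d j b3"
      using eq K.smult_r_diff[of "x [^] n" z i "x \<odot>\<^bsub>C i\<^esub> w"] zc xw x_closed db3
      by (simp add: K.add_diff_cancel)
    then have cob: "(x [^] n) \<odot>\<^bsub>C i\<^esub> ?z \<in> coboundaries i"
      using v(2) \<open>i = Suc j\<close> by simp
    have "(x [^] ?k) \<odot>\<^bsub>C (Suc i)\<^esub> d i w = d i (d j b')"
      unfolding w(2) by (rule d_smult[symmetric]) (use x_closed w(1) in simp_all)
    also have "\<dots> = \<zero>\<^bsub>C (Suc i)\<^esub>" using d_d[OF b'(1)] \<open>i = Suc j\<close> by simp
    finally have "d i w = \<zero>\<^bsub>C (Suc i)\<^esub>" by (rule torsion_free_pow[OF d_closed[OF w(1)]])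
    then have "d i ?z = \<zero>\<^bsub>C (Suc i)\<^esub>"
      using d_diff[OF zc xw] d_smult[OF x_closed w(1)] x_closed Suc.prems(2)
      by (simp add: K.minus_eq)
    from Suc.IH[OF zc' this cob] have "?z \<in> reduced_coboundaries i" .
    moreover have "x \<odot>\<^bsub>C i\<^esub> w \<in> reduced_coboundaries i"
      by (rule reduced_coboundariesI2[OF multiplesI[OF w(1)]])
    ultimately have "?z \<oplus>\<^bsub>C i\<^esub> x \<odot>\<^bsub>C i\<^esub> w \<in> reduced_coboundaries i"
      by (rule K.submoduleE(5)[OF submodule_reduced_coboundaries])
    then show ?case using K.diff_add_cancel[OF zc xw] by simp
  qed
qed

text \<open>If d c' = x^n e, then \<open>e\<close> is a cocycle, and its class in H^(i+1)(C/xC) is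
  the obstruction to passing from x^n to x^(n+1). Where this class is zero, e = d b' + x e', and
  subtracting x^n b' from \<open>c'\<close> gains one power of x.\<close>

lemma vanishing_imp_liftable:
  assumes van: "\<And>c. \<lbrakk>c \<in> carrier (C (Suc i)); d (Suc i) c \<in> multiples x (Suc (Suc i))\<rbrakk>
      \<Longrightarrow> c \<in> reduced_coboundaries (Suc i)"
  shows "liftable i"
  unfolding liftable_def
proof (intro ballI impI allI)
  fix c and n :: nat
  assume c: "c \<in> carrier (C i)" "d i c \<in> multiples x (Suc i)"
  \<comment> \<open>The exponents start at 1: the correction x^(n+1) b' has to be a multiple of x in
    order not to change the class modulo x, and this would fail for x^0.\<close>
  have "\<exists>c'\<in>carrier (C i). \<exists>v\<in>reduced_coboundaries i.
      c = c' \<oplus>\<^bsub>C i\<^esub> v \<and> d i c' \<in> multiples (x [^] Suc n) (Suc i)"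
  proof (induction n)
    case 0
    have "d i c \<in> multiples (x [^] Suc 0) (Suc i)" using c(2) x_closed by simp
    moreover have "c = c \<oplus>\<^bsub>C i\<^esub> \<zero>\<^bsub>C i\<^esub>" using c by simp
    ultimately show ?case
      using c(1) K.submodule_zero[OF submodule_reduced_coboundaries[of i]] by blast
  next
    case (Suc n)
    then obtain c' v where c': "c' \<in> carrier (C i)" "v \<in> reduced_coboundaries i"
      "c = c' \<oplus>\<^bsub>C i\<^esub> v" "d i c' \<in> multiples (x [^] Suc n) (Suc i)" by blast
    have vc: "v \<in> carrier (C i)" by (rule K.submodule_subset[OF submodule_reduced_coboundaries c'(2)])
    let ?y = "x [^] Suc n"
    have y: "?y \<in> carrier R" using x_closed by simp
    obtain e where e: "e \<in> carrier (C (Suc i))" "d i c' = ?y \<odot>\<^bsub>C (Suc i)\<^esub> e"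
      using c'(4) by (rule multiplesE)
    have "?y \<odot>\<^bsub>C (Suc (Suc i))\<^esub> d (Suc i) e = d (Suc i) (d i c')"
      unfolding e(2) by (rule d_smult[OF y e(1), symmetric])
    then have "d (Suc i) e = \<zero>\<^bsub>C (Suc (Suc i))\<^esub>"
      using torsion_free_pow[OF d_closed[OF e(1)], of "Suc n"] d_d[OF c'(1)] by simp
    then have "d (Suc i) e \<in> multiples x (Suc (Suc i))"
      using K.submodule_zero[OF submodule_multiples[OF x_closed]] by simp
    from van[OF e(1) this] obtain b e' where be: "b \<in> coboundaries (Suc i)"
      "e' \<in> carrier (C (Suc i))" "e = b \<oplus>\<^bsub>C (Suc i)\<^esub> x \<odot>\<^bsub>C (Suc i)\<^esub> e'"
      by (rule reduced_coboundariesE)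
    obtain b' where b': "b' \<in> carrier (C i)" "b = d i b'" using be(1) by auto
    let ?c = "c' \<ominus>\<^bsub>C i\<^esub> ?y \<odot>\<^bsub>C i\<^esub> b'"
    let ?v = "?y \<odot>\<^bsub>C i\<^esub> b' \<oplus>\<^bsub>C i\<^esub> v"
    have yb: "?y \<odot>\<^bsub>C i\<^esub> b' \<in> carrier (C i)" using y b' by simp
    have cc: "?c \<in> carrier (C i)" using yb c' by simp
    have "?y \<odot>\<^bsub>C i\<^esub> b' \<in> multiples (x [^] (1::nat)) i"
      by (rule multiples_pow_subset[OF x_closed _ multiplesI[OF b'(1)]]) simp
    then have "?y \<odot>\<^bsub>C i\<^esub> b' \<in> reduced_coboundaries i"
      using reduced_coboundariesI2 x_closed by simp
    then have v': "?v \<in> reduced_coboundaries i"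
      by (rule K.submoduleE(5)[OF submodule_reduced_coboundaries _ c'(2)])
    have "?c \<oplus>\<^bsub>C i\<^esub> ?v = (?c \<oplus>\<^bsub>C i\<^esub> ?y \<odot>\<^bsub>C i\<^esub> b') \<oplus>\<^bsub>C i\<^esub> v"
      by (rule K.a_assoc[symmetric, OF cc yb vc])
    then have eq: "c = ?c \<oplus>\<^bsub>C i\<^esub> ?v"
      using K.diff_add_cancel[OF c'(1) yb] c'(3) by simp
    have bc: "d i b' \<in> carrier (C (Suc i))" by (rule d_closed[OF b'(1)])
    have "d i ?c = ?y \<odot>\<^bsub>C (Suc i)\<^esub> e \<ominus>\<^bsub>C (Suc i)\<^esub> ?y \<odot>\<^bsub>C (Suc i)\<^esub> d i b'"
      using d_diff[OF c'(1) yb] e(2) d_smult[OF y b'(1)] by simp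
    also have "\<dots> = ?y \<odot>\<^bsub>C (Suc i)\<^esub> (e \<ominus>\<^bsub>C (Suc i)\<^esub> d i b')"
      by (rule K.smult_r_diff[symmetric, OF y e(1) bc])
    also have "e \<ominus>\<^bsub>C (Suc i)\<^esub> d i b' = x \<odot>\<^bsub>C (Suc i)\<^esub> e'"
      unfolding be(3) b'(2) by (rule K.add_diff_cancel(2)) (use x_closed be(2) bc in simp_all)
    also have "?y \<odot>\<^bsub>C (Suc i)\<^esub> (x \<odot>\<^bsub>C (Suc i)\<^esub> e') = (x [^] Suc (Suc n)) \<odot>\<^bsub>C (Suc i)\<^esub> e'"
      using x_closed be(2) by (simp add: K.smult_assoc1)
    finally have "d i ?c \<in> multiples (x [^] Suc (Suc n)) (Suc i)"
      using multiplesI[OF be(2)] by simp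
    then show ?case using cc v' eq by blast
  qed
  then obtain c' v where c': "c' \<in> carrier (C i)" "v \<in> reduced_coboundaries i"
    "c = c' \<oplus>\<^bsub>C i\<^esub> v" "d i c' \<in> multiples (x [^] Suc n) (Suc i)" by blast
  have "d i c' \<in> multiples (x [^] n) (Suc i)"
    by (rule multiples_pow_subset[OF x_closed _ c'(4)]) simp
  then show "\<exists>c'\<in>carrier (C i). \<exists>v\<in>reduced_coboundaries i.
      c = c' \<oplus>\<^bsub>C i\<^esub> v \<and> d i c' \<in> multiples (x [^] n) (Suc i)"
    using c' by blast
qed

end

section \<open>Frobenius on a complex: bijectivity on finite-length cohomology, and
  injectivity\<close>

section \<open>Frobenius on a complex\<close>

text \<open>Finite length of Z/W, expressed by the submodules of M between W and Z. With W the
  coboundaries and Z the cocycles modulo x, chain conditions on cohomology can be applied to sets of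
  cochains.\<close>

definition bounded_chains ::
    "('a, 'c) ring_scheme \<Rightarrow> ('a, 'b, 'e) module_scheme \<Rightarrow> 'b set \<Rightarrow> 'b set \<Rightarrow> bool" where
  "bounded_chains R M W Z \<longleftrightarrow>
     (\<exists>n::nat. \<forall>(N :: nat \<Rightarrow> 'b set) k.
        (\<forall>j\<le>k. submodule (N j) R M \<and> W \<subseteq> N j \<and> N j \<subseteq> Z) \<and> (\<forall>j<k. N j \<subset> N (Suc j)) \<longrightarrow> k \<le> n)"

lemma bounded_chains_ascending:
  assumes "bounded_chains R M W Z"
    and N: "\<And>j. submodule (N j) R M \<and> W \<subseteq> N j \<and> N j \<subseteq> Z" and mono: "\<And>j. N j \<subseteq> N (Suc j)"
  shows "\<exists>j. N (Suc j) = N j"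
proof (rule ccontr)
  assume "\<nexists>j. N (Suc j) = N j"
  then have strict: "N j \<subset> N (Suc j)" for j using mono[of j] by blast
  obtain n :: nat where n: "\<And>N k.
      (\<forall>j\<le>k. submodule (N j) R M \<and> W \<subseteq> N j \<and> N j \<subseteq> Z) \<and> (\<forall>j<k. N j \<subset> N (Suc j)) \<Longrightarrow> k \<le> n"
    using assms(1) unfolding bounded_chains_def by metis
  have "Suc n \<le> n" by (rule n[of "Suc n" N]) (use N strict in blast)
  then show False by simp
qed

lemma bounded_chains_descending:
  assumes "bounded_chains R M W Z"
    and N: "\<And>j. submodule (N j) R M \<and> W \<subseteq> N j \<and> N j \<subseteq> Z" and mono: "\<And>j. N (Suc j) \<subseteq> N j"
  shows "\<exists>j. N (Suc j) = N j"
proof (rule ccontr)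
  assume "\<nexists>j. N (Suc j) = N j"
  then have strict: "N (Suc j) \<subset> N j" for j using mono[of j] by blast
  obtain n :: nat where n: "\<And>N k.
      (\<forall>j\<le>k. submodule (N j) R M \<and> W \<subseteq> N j \<and> N j \<subseteq> Z) \<and> (\<forall>j<k. N j \<subset> N (Suc j)) \<Longrightarrow> k \<le> n"
    using assms(1) unfolding bounded_chains_def by metis
  \<comment> \<open>The bound concerns increasing chains, so the first n + 2 terms of the decreasing
    chain are read backwards.\<close>
  have "N (Suc n - j) \<subset> N (Suc n - Suc j)" if "j < Suc n" for j
    using strict[of "Suc n - Suc j"] that by (simp add: Suc_diff_le)
  then have "Suc n \<le> n" by (intro n[of "Suc n" "\<lambda>j. N (Suc n - j)"]) (use N in blast)
  then show False by simp
qed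

text \<open>\<open>\<phi>\<close> is a chain map that is p-linear over R, hence it descends to C/xC.
  The last assumption is the injectivity of the descended map on cohomology, which for the Cech
  complex is F-injectivity of R/xR.\<close>

locale frobenius_complex = torsion_free_complex R C d x
  for R :: "('a, 'c) ring_scheme" (structure) and C :: "nat \<Rightarrow> ('a, 'b, 'e) module_scheme" and d x +
  fixes p :: nat and \<phi> :: "nat \<Rightarrow> 'b \<Rightarrow> 'b"
  assumes p_ge_2: "2 \<le> p"
    and \<phi>_closed: "c \<in> carrier (C i) \<Longrightarrow> \<phi> i c \<in> carrier (C i)"
    and \<phi>_add: "\<lbrakk>c \<in> carrier (C i); c' \<in> carrier (C i)\<rbrakk>
      \<Longrightarrow> \<phi> i (c \<oplus>\<^bsub>C i\<^esub> c') = \<phi> i c \<oplus>\<^bsub>C i\<^esub> \<phi> i c'"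
    and \<phi>_smult: "\<lbrakk>r \<in> carrier R; c \<in> carrier (C i)\<rbrakk>
      \<Longrightarrow> \<phi> i (r \<odot>\<^bsub>C i\<^esub> c) = (r [^] p) \<odot>\<^bsub>C i\<^esub> \<phi> i c"
    and \<phi>_d: "c \<in> carrier (C i) \<Longrightarrow> \<phi> (Suc i) (d i c) = d i (\<phi> i c)"
    and injective_mod: "\<lbrakk>c \<in> carrier (C i); d i c \<in> multiples x (Suc i);
      \<phi> i c \<in> reduced_coboundaries i\<rbrakk> \<Longrightarrow> c \<in> reduced_coboundaries i"
begin

definition reduced_cocycles :: "nat \<Rightarrow> 'b set" where
  "reduced_cocycles i = {c \<in> carrier (C i). d i c \<in> multiples x (Suc i)}"

lemma reduced_cocyclesD:
  assumes "c \<in> reduced_cocycles i" shows "c \<in> carrier (C i)" "d i c \<in> multiples x (Suc i)"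
  using assms unfolding reduced_cocycles_def by blast+

lemma submodule_reduced_cocycles: "submodule (reduced_cocycles i) R (C i)"
proof (rule K.submoduleI)
  note S = submodule_multiples[OF x_closed, of "Suc i"]
  show "reduced_cocycles i \<subseteq> carrier (C i)" unfolding reduced_cocycles_def by blast
  show "\<zero>\<^bsub>C i\<^esub> \<in> reduced_cocycles i"
    unfolding reduced_cocycles_def using K.submodule_zero[OF S] by (simp add: d_zero)
  show "\<ominus>\<^bsub>C i\<^esub> a \<in> reduced_cocycles i" if "a \<in> reduced_cocycles i" for a
    using that K.submoduleE(3)[OF S] unfolding reduced_cocycles_def by (simp add: d_neg)
  show "a \<oplus>\<^bsub>C i\<^esub> b \<in> reduced_cocycles i" if "a \<in> reduced_cocycles i" "b \<in> reduced_cocycles i" for a b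
    using that K.submoduleE(5)[OF S] unfolding reduced_cocycles_def by (simp add: d_add)
  show "r \<odot>\<^bsub>C i\<^esub> b \<in> reduced_cocycles i" if "r \<in> carrier R" "b \<in> reduced_cocycles i" for r b
    using that K.submoduleE(4)[OF S] unfolding reduced_cocycles_def by (simp add: d_smult)
qed

lemma reduced_coboundaries_subset_cocycles: "reduced_coboundaries i \<subseteq> reduced_cocycles i"
  unfolding reduced_cocycles_def
  using K.submodule_subset[OF submodule_reduced_coboundaries] d_reduced_coboundaries by blast

lemma \<phi>_zero: "\<phi> i \<zero>\<^bsub>C i\<^esub> = \<zero>\<^bsub>C i\<^esub>"
proof -
  have "\<phi> i \<zero>\<^bsub>C i\<^esub> \<oplus>\<^bsub>C i\<^esub> \<phi> i \<zero>\<^bsub>C i\<^esub> = \<phi> i \<zero>\<^bsub>C i\<^esub>"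
    using \<phi>_add[of "\<zero>\<^bsub>C i\<^esub>" i "\<zero>\<^bsub>C i\<^esub>"] by simp
  then show ?thesis
    using \<phi>_closed[of "\<zero>\<^bsub>C i\<^esub>" i] by (metis K.add.r_cancel_one' K.zero_closed)
qed

lemma \<phi>_coboundaries:
  assumes "b \<in> coboundaries i" shows "\<phi> i b \<in> coboundaries i"
proof (cases i)
  case 0
  then show ?thesis using assms \<phi>_zero by simp
next
  case (Suc j)
  then obtain c where "c \<in> carrier (C j)" "b = d j c" using assms by auto
  then show ?thesis using \<phi>_d \<phi>_closed Suc by simp
qed

lemma \<phi>_multiples:
  assumes r: "r \<in> carrier R" and v: "v \<in> multiples (r [^] n) i"
  shows "\<phi> i v \<in> multiples (r [^] (n * p)) i"
proof -
  from v obtain c where c: "c \<in> carrier (C i)" "v = (r [^] n) \<odot>\<^bsub>C i\<^esub> c" by (rule multiplesE)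
  have "\<phi> i v = (r [^] (n * p)) \<odot>\<^bsub>C i\<^esub> \<phi> i c"
    unfolding c(2) using r \<phi>_smult[OF _ c(1), of "r [^] n"] by (simp add: nat_pow_pow)
  then show ?thesis using multiplesI[OF \<phi>_closed[OF c(1)]] by simp
qed

lemma \<phi>_reduced_coboundaries:
  assumes "v \<in> reduced_coboundaries i" shows "\<phi> i v \<in> reduced_coboundaries i"
proof -
  from assms obtain b c where bc: "b \<in> coboundaries i" "c \<in> carrier (C i)"
    "v = b \<oplus>\<^bsub>C i\<^esub> x \<odot>\<^bsub>C i\<^esub> c" by (rule reduced_coboundariesE)
  have xc: "x \<odot>\<^bsub>C i\<^esub> c \<in> multiples (x [^] (1::nat)) i" using multiplesI[OF bc(2)] x_closed by simp
  have "\<phi> i (x \<odot>\<^bsub>C i\<^esub> c) \<in> multiples (x [^] (1::nat)) i"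
    by (rule multiples_pow_subset[OF x_closed _ \<phi>_multiples[OF x_closed xc]]) (use p_ge_2 in simp)
  then have 1: "\<phi> i (x \<odot>\<^bsub>C i\<^esub> c) \<in> reduced_coboundaries i"
    using reduced_coboundariesI2 x_closed by simp
  have 2: "\<phi> i b \<in> reduced_coboundaries i"
    by (rule reduced_coboundariesI1[OF \<phi>_coboundaries[OF bc(1)]])
  have "\<phi> i v = \<phi> i b \<oplus>\<^bsub>C i\<^esub> \<phi> i (x \<odot>\<^bsub>C i\<^esub> c)"
    unfolding bc(3) by (rule \<phi>_add[OF coboundaries_subset[OF bc(1)]]) (use x_closed bc(2) in simp)
  then show ?thesis
    using K.submoduleE(5)[OF submodule_reduced_coboundaries 2 1] by simp
qed

lemma iter_closed: "c \<in> carrier (C i) \<Longrightarrow> (\<phi> i ^^ e) c \<in> carrier (C i)"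
  by (induction e) (simp_all add: \<phi>_closed)

lemma iter_add:
  assumes "c \<in> carrier (C i)" "c' \<in> carrier (C i)"
  shows "(\<phi> i ^^ e) (c \<oplus>\<^bsub>C i\<^esub> c') = (\<phi> i ^^ e) c \<oplus>\<^bsub>C i\<^esub> (\<phi> i ^^ e) c'"
  by (induction e) (simp_all add: \<phi>_add iter_closed assms)

lemma iter_smult:
  assumes "r \<in> carrier R" "c \<in> carrier (C i)"
  shows "(\<phi> i ^^ e) (r \<odot>\<^bsub>C i\<^esub> c) = (r [^] (p ^ e)) \<odot>\<^bsub>C i\<^esub> (\<phi> i ^^ e) c"
  by (induction e) (simp_all add: \<phi>_smult iter_closed assms nat_pow_pow mult.commute)

lemma iter_d: "c \<in> carrier (C i) \<Longrightarrow> (\<phi> (Suc i) ^^ e) (d i c) = d i ((\<phi> i ^^ e) c)"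
  by (induction e) (simp_all add: \<phi>_d iter_closed)

text \<open>This is the source of all lifts. From d c = x u follows d (F^e c) = x^(p^e) F^e u, so an
  iterate of Frobenius turns a cocycle modulo x into one modulo x^(p^e).\<close>

lemma iter_d_multiples:
  assumes "c \<in> reduced_cocycles i"
  shows "d i ((\<phi> i ^^ e) c) \<in> multiples (x [^] (p ^ e)) (Suc i)"
proof -
  note c = reduced_cocyclesD[OF assms]
  obtain u where u: "u \<in> carrier (C (Suc i))" "d i c = x \<odot>\<^bsub>C (Suc i)\<^esub> u"
    using c(2) by (rule multiplesE)
  have "d i ((\<phi> i ^^ e) c) = (x [^] (p ^ e)) \<odot>\<^bsub>C (Suc i)\<^esub> (\<phi> (Suc i) ^^ e) u"
    using iter_d[OF c(1), of e] iter_smult[OF x_closed u(1)] u(2) by simp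
  then show ?thesis using multiplesI[OF iter_closed[OF u(1)]] by simp
qed

lemma iter_reduced_cocycles:
  assumes "c \<in> reduced_cocycles i" shows "(\<phi> i ^^ e) c \<in> reduced_cocycles i"
proof -
  have "1 \<le> p ^ e" using p_ge_2 by simp
  then have "d i ((\<phi> i ^^ e) c) \<in> multiples (x [^] (1::nat)) (Suc i)"
    by (rule multiples_pow_subset[OF x_closed _ iter_d_multiples[OF assms]])
  then show ?thesis
    using iter_closed[OF reduced_cocyclesD(1)[OF assms]] x_closed unfolding reduced_cocycles_def by simp
qed

lemma \<phi>_reduced_cocycles:
  assumes "c \<in> reduced_cocycles i" shows "\<phi> i c \<in> reduced_cocycles i"
  using iter_reduced_cocycles[OF assms, of 1] by simp

lemma iter_reduced_coboundaries:
  "v \<in> reduced_coboundaries i \<Longrightarrow> (\<phi> i ^^ e) v \<in> reduced_coboundaries i"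
  by (induction e) (simp_all add: \<phi>_reduced_coboundaries)

lemma iter_injective_mod:
  assumes "c \<in> reduced_cocycles i" "(\<phi> i ^^ e) c \<in> reduced_coboundaries i"
  shows "c \<in> reduced_coboundaries i"
  using assms(2)
proof (induction e)
  case 0
  then show ?case by simp
next
  case (Suc e)
  note ce = iter_reduced_cocycles[OF assms(1), of e]
  have "(\<phi> i ^^ e) c \<in> reduced_coboundaries i"
    by (rule injective_mod[OF reduced_cocyclesD(1,2)[OF ce]]) (use Suc.prems in simp)
  then show ?case by (rule Suc.IH)
qed

text \<open>The classes killed by r^n form an ascending chain, which stops, so one n serves for all
  classes. Then F^n(r c) = r^(p^n) F^n(c) is zero, since p^n \<ge> n and r^n kills the class of
  F^n(c) as well. Injectivity of F^n gives r c = 0. Applied to all r in the maximal ideal, this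
  turns the cohomology modulo x into a vector space over the residue field.\<close>

lemma annihilated_by_torsion:
  assumes bc: "bounded_chains R (C i) (reduced_coboundaries i) (reduced_cocycles i)"
    and r: "r \<in> carrier R"
    and torsion: "\<And>c. c \<in> reduced_cocycles i \<Longrightarrow> \<exists>n::nat. (r [^] n) \<odot>\<^bsub>C i\<^esub> c \<in> reduced_coboundaries i"
    and c: "c \<in> reduced_cocycles i"
  shows "r \<odot>\<^bsub>C i\<^esub> c \<in> reduced_coboundaries i"
proof -
  note W = submodule_reduced_coboundaries[of i] and Z = submodule_reduced_cocycles[of i]
  note Zc = K.submodule_subset[OF Z]
  define T where "T n = {c \<in> reduced_cocycles i. (r [^] n) \<odot>\<^bsub>C i\<^esub> c \<in> reduced_coboundaries i}" for n :: nat
  have rn: "r [^] n \<in> carrier R" for n :: nat using r by simp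
  have sub: "submodule (T n) R (C i)" for n
  proof (rule K.submoduleI)
    show "T n \<subseteq> carrier (C i)" unfolding T_def using Zc by blast
    show "\<zero>\<^bsub>C i\<^esub> \<in> T n" unfolding T_def using K.submodule_zero[OF Z] K.submodule_zero[OF W] rn by simp
    show "\<ominus>\<^bsub>C i\<^esub> a \<in> T n" if "a \<in> T n" for a
      using that K.submoduleE(3)[OF Z] K.submoduleE(3)[OF W] rn Zc unfolding T_def
      by (simp add: K.smult_r_minus)
    show "a \<oplus>\<^bsub>C i\<^esub> b \<in> T n" if "a \<in> T n" "b \<in> T n" for a b
      using that K.submoduleE(5)[OF Z] K.submoduleE(5)[OF W] rn Zc unfolding T_def
      by (simp add: K.smult_r_distr)
    show "s \<odot>\<^bsub>C i\<^esub> b \<in> T n" if "s \<in> carrier R" "b \<in> T n" for s b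
    proof -
      have "(r [^] n) \<odot>\<^bsub>C i\<^esub> (s \<odot>\<^bsub>C i\<^esub> b) = s \<odot>\<^bsub>C i\<^esub> ((r [^] n) \<odot>\<^bsub>C i\<^esub> b)"
        by (rule K.smult_comm) (use rn that Zc T_def in simp_all)
      then show ?thesis
        using that K.submoduleE(4)[OF Z] K.submoduleE(4)[OF W] unfolding T_def by simp
    qed
  qed
  have step: "(r [^] Suc n) \<odot>\<^bsub>C i\<^esub> c = (r [^] n) \<odot>\<^bsub>C i\<^esub> (r \<odot>\<^bsub>C i\<^esub> c)"
    and step': "(r [^] Suc n) \<odot>\<^bsub>C i\<^esub> c = r \<odot>\<^bsub>C i\<^esub> ((r [^] n) \<odot>\<^bsub>C i\<^esub> c)"
    if "c \<in> reduced_cocycles i" for n c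
    using r Zc[OF that] by (simp_all add: K.smult_assoc1 K.smult_comm)
  have mono: "T n \<subseteq> T (Suc n)" for n
    unfolding T_def using step' K.submoduleE(4)[OF W r] by auto
  have "\<exists>n. T (Suc n) = T n"
  proof (rule bounded_chains_ascending[OF bc])
    fix n
    have "reduced_coboundaries i \<subseteq> T n"
      unfolding T_def using reduced_coboundaries_subset_cocycles K.submoduleE(4)[OF W rn] by blast
    moreover have "T n \<subseteq> reduced_cocycles i" unfolding T_def by blast
    ultimately show "submodule (T n) R (C i) \<and> reduced_coboundaries i \<subseteq> T n \<and> T n \<subseteq> reduced_cocycles i"
      using sub by blast
  qed (rule mono)
  then obtain n where n: "T (Suc n) = T n" by blast
  \<comment> \<open>One equality \<open>T (Suc n) = T n\<close> makes the chain constant from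
    \<open>n\<close> on: \<open>r\<close> maps \<open>T (n + m + 1)\<close> into
    \<open>T (n + m)\<close>, hence by induction into \<open>T n\<close>, so the original class lies
    in \<open>T (Suc n)\<close>.\<close>
  have all: "c \<in> T n" if "c \<in> T (n + m)" for c m
    using that
  proof (induction m arbitrary: c)
    case (Suc m)
    have cz: "c \<in> reduced_cocycles i" using Suc.prems unfolding T_def by blast
    have rc: "r \<odot>\<^bsub>C i\<^esub> c \<in> reduced_cocycles i" by (rule K.submoduleE(4)[OF Z r cz])
    have "r \<odot>\<^bsub>C i\<^esub> c \<in> T (n + m)"
      using Suc.prems rc step[OF cz, of "n + m"] unfolding T_def by simp
    then have "r \<odot>\<^bsub>C i\<^esub> c \<in> T n" by (rule Suc.IH)
    then have "c \<in> T (Suc n)"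
      using cz step[OF cz, of n] unfolding T_def by simp
    then show ?case using n by simp
  qed simp
  have unif: "(r [^] n) \<odot>\<^bsub>C i\<^esub> c \<in> reduced_coboundaries i" if c: "c \<in> reduced_cocycles i" for c
  proof -
    obtain m :: nat where m: "(r [^] m) \<odot>\<^bsub>C i\<^esub> c \<in> reduced_coboundaries i" using torsion[OF c] by blast
    have "T m \<subseteq> T (n + m)" by (rule lift_Suc_mono_le[of T, OF mono]) simp
    moreover have "c \<in> T m" using m c unfolding T_def by simp
    ultimately have "c \<in> T n" using all by blast
    then show ?thesis unfolding T_def by blast
  qed
  have le: "n \<le> p ^ n" using power_gt_expt[of p n] p_ge_2 by simp
  have cK: "c \<in> carrier (C i)" by (rule Zc[OF c])
  have fc: "(\<phi> i ^^ n) c \<in> reduced_cocycles i" by (rule iter_reduced_cocycles[OF c])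
  have "r [^] (p ^ n) = r [^] (p ^ n - n) \<otimes> r [^] n"
    using le r by (simp add: nat_pow_mult)
  then have "(\<phi> i ^^ n) (r \<odot>\<^bsub>C i\<^esub> c) = (r [^] (p ^ n - n)) \<odot>\<^bsub>C i\<^esub> ((r [^] n) \<odot>\<^bsub>C i\<^esub> (\<phi> i ^^ n) c)"
    using iter_smult[OF r cK, of n] rn Zc[OF fc] by (simp add: K.smult_assoc1)
  then have "(\<phi> i ^^ n) (r \<odot>\<^bsub>C i\<^esub> c) \<in> reduced_coboundaries i"
    using K.submoduleE(4)[OF W rn unif[OF fc]] by simp
  then show ?thesis
    by (rule iter_injective_mod[OF K.submoduleE(4)[OF Z r c]])
qed

text \<open>Since the residue field is perfect, the Frobenius images of the finite-dimensional vector
  space of classes modulo \<open>x\<close> are subspaces; by injectivity the chain of these images is constant.\<close>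

lemma finite_length_imp_liftable:
  assumes bc: "bounded_chains R (C i) (reduced_coboundaries i) (reduced_cocycles i)"
    and I: "I \<subseteq> carrier R"
    and perfect: "\<And>a. a \<in> carrier R \<Longrightarrow> \<exists>b\<in>carrier R. \<exists>r\<in>I. a = b [^] p \<oplus> r"
    and torsion: "\<And>r c. \<lbrakk>r \<in> I; c \<in> reduced_cocycles i\<rbrakk>
      \<Longrightarrow> \<exists>n::nat. (r [^] n) \<odot>\<^bsub>C i\<^esub> c \<in> reduced_coboundaries i"
  shows "liftable i"
proof -
  let ?W = "reduced_coboundaries i" and ?Z = "reduced_cocycles i"
  note W = submodule_reduced_coboundaries[of i] and Z = submodule_reduced_cocycles[of i]
  note Zc = K.submodule_subset[OF Z] and Wc = K.submodule_subset[OF W]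
  have ann: "r \<odot>\<^bsub>C i\<^esub> c \<in> ?W" if "r \<in> I" "c \<in> ?Z" for r c
    by (rule annihilated_by_torsion[OF bc _ torsion that(2)]) (use that I in auto)
  \<comment> \<open>\<open>G N\<close> is the preimage of the Frobenius image of N/W. Adding
    \<open>?W\<close> keeps it between \<open>?W\<close> and \<open>?Z\<close>, where the chain
    bound applies.\<close>
  define G where "G N = \<phi> i ` N <+>\<^bsub>C i\<^esub> ?W" for N
  have GI: "v \<in> G N \<longleftrightarrow> (\<exists>b\<in>N. \<exists>w\<in>?W. v = \<phi> i b \<oplus>\<^bsub>C i\<^esub> w)" for v N
    unfolding G_def K.set_add_iff by blast
  have subG: "submodule (G N) R (C i)" and WG: "?W \<subseteq> G N" and GZ: "G N \<subseteq> ?Z"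
    if N: "submodule N R (C i)" and NZ: "N \<subseteq> ?Z" for N
  proof -
    note Nc = K.submodule_subset[OF N]
    show GZ: "G N \<subseteq> ?Z"
    proof
      fix v assume "v \<in> G N"
      then obtain b w where bw: "b \<in> N" "w \<in> ?W" "v = \<phi> i b \<oplus>\<^bsub>C i\<^esub> w" unfolding GI by blast
      have "\<phi> i b \<in> ?Z" using bw(1) NZ \<phi>_reduced_cocycles by blast
      moreover have "w \<in> ?Z" using bw(2) reduced_coboundaries_subset_cocycles by blast
      ultimately show "v \<in> ?Z" unfolding bw(3) by (rule K.submoduleE(5)[OF Z])
    qed
    show WG: "?W \<subseteq> G N"
    proof
      fix w assume w: "w \<in> ?W"
      have "w = \<phi> i \<zero>\<^bsub>C i\<^esub> \<oplus>\<^bsub>C i\<^esub> w" using Wc[OF w] \<phi>_zero by simp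
      then show "w \<in> G N" unfolding GI using K.submodule_zero[OF N] w by blast
    qed
    have smult: "a \<odot>\<^bsub>C i\<^esub> v \<in> G N" if a: "a \<in> carrier R" and v: "v \<in> G N" for a v
    proof -
      obtain b w where bw: "b \<in> N" "w \<in> ?W" "v = \<phi> i b \<oplus>\<^bsub>C i\<^esub> w" using v unfolding GI by blast
      \<comment> \<open>A p-linear image is closed under scalars only where p-th roots exist. With a
        = s^p + r the first part is absorbed as s^p F(b) = F(s b), and r F(b) is zero in cohomology
        because \<open>I\<close> annihilates it.\<close>
      obtain s r where sr: "s \<in> carrier R" "r \<in> I" "a = s [^] p \<oplus> r" using perfect[OF a] by blast
      have bZ: "b \<in> ?Z" using bw(1) NZ by blast
      have fb: "\<phi> i b \<in> carrier (C i)" by (rule \<phi>_closed[OF Zc[OF bZ]])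
      have r: "r \<in> carrier R" using sr(2) I by blast
      have rb: "r \<odot>\<^bsub>C i\<^esub> \<phi> i b \<in> ?W" by (rule ann[OF sr(2) \<phi>_reduced_cocycles[OF bZ]])
      have aw: "a \<odot>\<^bsub>C i\<^esub> w \<in> ?W" by (rule K.submoduleE(4)[OF W a bw(2)])
      have "a \<odot>\<^bsub>C i\<^esub> v = a \<odot>\<^bsub>C i\<^esub> \<phi> i b \<oplus>\<^bsub>C i\<^esub> a \<odot>\<^bsub>C i\<^esub> w"
        unfolding bw(3) by (rule K.smult_r_distr[OF a fb Wc[OF bw(2)]])
      also have "a \<odot>\<^bsub>C i\<^esub> \<phi> i b = \<phi> i (s \<odot>\<^bsub>C i\<^esub> b) \<oplus>\<^bsub>C i\<^esub> r \<odot>\<^bsub>C i\<^esub> \<phi> i b"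
        unfolding sr(3) using sr(1) r fb Zc[OF bZ] by (simp add: K.smult_l_distr \<phi>_smult)
      also have "\<phi> i (s \<odot>\<^bsub>C i\<^esub> b) \<oplus>\<^bsub>C i\<^esub> r \<odot>\<^bsub>C i\<^esub> \<phi> i b \<oplus>\<^bsub>C i\<^esub> a \<odot>\<^bsub>C i\<^esub> w =
          \<phi> i (s \<odot>\<^bsub>C i\<^esub> b) \<oplus>\<^bsub>C i\<^esub> (r \<odot>\<^bsub>C i\<^esub> \<phi> i b \<oplus>\<^bsub>C i\<^esub> a \<odot>\<^bsub>C i\<^esub> w)"
        by (rule K.a_assoc) (use sr(1) Zc[OF bZ] Wc[OF rb] Wc[OF aw] in \<open>simp_all add: \<phi>_closed\<close>)
      finally show ?thesis
        unfolding GI using K.submoduleE(4)[OF N sr(1) bw(1)] K.submoduleE(5)[OF W rb aw] by blast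
    qed
    have add: "u \<oplus>\<^bsub>C i\<^esub> v \<in> G N" if u: "u \<in> G N" and v: "v \<in> G N" for u v
    proof -
      obtain b w where bw: "b \<in> N" "w \<in> ?W" "u = \<phi> i b \<oplus>\<^bsub>C i\<^esub> w" using u unfolding GI by blast
      obtain b' w' where bw': "b' \<in> N" "w' \<in> ?W" "v = \<phi> i b' \<oplus>\<^bsub>C i\<^esub> w'" using v unfolding GI by blast
      have "u \<oplus>\<^bsub>C i\<^esub> v = (\<phi> i b \<oplus>\<^bsub>C i\<^esub> \<phi> i b') \<oplus>\<^bsub>C i\<^esub> (w \<oplus>\<^bsub>C i\<^esub> w')"
        unfolding bw(3) bw'(3)
        by (rule K.a_4_comm) (use Nc bw bw' Wc in \<open>simp_all add: \<phi>_closed\<close>)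
      also have "\<phi> i b \<oplus>\<^bsub>C i\<^esub> \<phi> i b' = \<phi> i (b \<oplus>\<^bsub>C i\<^esub> b')"
        by (rule \<phi>_add[symmetric]) (use Nc bw bw' in simp_all)
      finally show ?thesis
        unfolding GI using K.submoduleE(5)[OF N bw(1) bw'(1)] K.submoduleE(5)[OF W bw(2) bw'(2)] by blast
    qed
    show "submodule (G N) R (C i)"
    proof (rule K.submoduleI)
      show "G N \<subseteq> carrier (C i)" using GZ Zc by blast
      show "\<zero>\<^bsub>C i\<^esub> \<in> G N" using WG K.submodule_zero[OF W] by blast
      show "\<ominus>\<^bsub>C i\<^esub> a \<in> G N" if "a \<in> G N" for a
        using smult[of "\<ominus> \<one>" a] that GZ Zc K.smult_l_minus[of \<one> a i] by auto
    qed (use add smult in blast)+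
  qed
  define N where "N e = (G ^^ e) ?Z" for e
  have N: "submodule (N e) R (C i) \<and> N e \<subseteq> ?Z \<and> ?W \<subseteq> N e" for e
  proof (induction e)
    case 0
    show ?case unfolding N_def using Z reduced_coboundaries_subset_cocycles by simp
  next
    case (Suc e)
    have "N (Suc e) = G (N e)" unfolding N_def by simp
    then show ?case using subG WG GZ Suc by simp
  qed
  have NS: "N (Suc e) = G (N e)" for e unfolding N_def by simp
  have Gmono: "G A \<subseteq> G B" if "A \<subseteq> B" for A B using that GI by blast
  have desc: "N (Suc e) \<subseteq> N e" for e
  proof (induction e)
    case 0
    show ?case using N[of 1] unfolding N_def by simp
  next
    case (Suc e)
    show ?case unfolding NS[of "Suc e"] NS[of e] by (rule Gmono) (use Suc in \<open>simp add: NS\<close>)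
  qed
  have "\<exists>e. N (Suc e) = N e"
    by (rule bounded_chains_descending[OF bc]) (use N desc in blast)+
  then obtain e where e: "N (Suc e) = N e" by blast
  \<comment> \<open>Injectivity moves an equality down the chain. If N(e+2) = N(e+1) and b is in
    N(e), then F(b) lies in N(e+1) = N(e+2), so F(b) agrees with F(b') in cohomology for some b' in
    N(e+1). Hence b - b' is in \<open>?W\<close>, and b is in N(e+1). At the bottom this says that
    Frobenius is surjective on cohomology.\<close>
  have "N 1 = N 0"
    using e
  proof (induction e)
    case (Suc e)
    have "N e \<subseteq> N (Suc e)"
    proof
      fix b assume b: "b \<in> N e"
      have bZ: "b \<in> ?Z" using N b by blast
      have fb: "\<phi> i b \<in> ?Z" by (rule \<phi>_reduced_cocycles[OF bZ])
      have "\<phi> i b = \<phi> i b \<oplus>\<^bsub>C i\<^esub> \<zero>\<^bsub>C i\<^esub>" using Zc[OF fb] by simp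
      then have "\<phi> i b \<in> N (Suc (Suc e))"
        unfolding Suc.prems NS[of e] GI using b K.submodule_zero[OF W] by blast
      then obtain b' w where bw: "b' \<in> N (Suc e)" "w \<in> ?W" "\<phi> i b = \<phi> i b' \<oplus>\<^bsub>C i\<^esub> w"
        unfolding NS[of "Suc e"] GI by blast
      have b'Z: "b' \<in> ?Z" using N bw(1) by blast
      let ?u = "b \<ominus>\<^bsub>C i\<^esub> b'"
      have uZ: "?u \<in> ?Z" by (rule K.submodule_diff[OF Z bZ b'Z])
      have "\<phi> i ?u \<oplus>\<^bsub>C i\<^esub> \<phi> i b' = \<phi> i b"
        using \<phi>_add[OF Zc[OF uZ] Zc[OF b'Z]] K.diff_add_cancel[OF Zc[OF bZ] Zc[OF b'Z]] by simp
      then have "\<phi> i ?u \<oplus>\<^bsub>C i\<^esub> \<phi> i b' = w \<oplus>\<^bsub>C i\<^esub> \<phi> i b'"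
        using bw(3) K.a_comm[OF Wc[OF bw(2)] \<phi>_closed[OF Zc[OF b'Z]]] by simp
      then have "\<phi> i ?u = w"
        by (rule K.add.r_cancel)
          (use \<phi>_closed[OF Zc[OF b'Z]] \<phi>_closed[OF Zc[OF uZ]] Wc[OF bw(2)] in simp_all)
      then have "?u \<in> ?W"
        using injective_mod[OF reduced_cocyclesD[OF uZ]] bw(2) by simp
      then have "?u \<in> N (Suc e)" using N by blast
      then have "?u \<oplus>\<^bsub>C i\<^esub> b' \<in> N (Suc e)"
        using K.submoduleE(5)[of "N (Suc e)" i ?u b'] N bw(1) by blast
      then show "b \<in> N (Suc e)" using K.diff_add_cancel[OF Zc[OF bZ] Zc[OF b'Z]] by simp
    qed
    then have "N (Suc e) = N e" using desc by blast
    then show ?case by (rule Suc.IH)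
  qed simp
  then have GZ_eq: "G ?Z = ?Z" unfolding N_def by simp
  have surj: "\<exists>b\<in>?Z. \<exists>w\<in>?W. c = (\<phi> i ^^ e) b \<oplus>\<^bsub>C i\<^esub> w" if "c \<in> ?Z" for e c
    using that
  proof (induction e arbitrary: c)
    case 0
    have "c = c \<oplus>\<^bsub>C i\<^esub> \<zero>\<^bsub>C i\<^esub>" using Zc[OF 0] by simp
    then show ?case using 0 K.submodule_zero[OF W] by auto
  next
    case (Suc e)
    obtain b w where bw: "b \<in> ?Z" "w \<in> ?W" "c = (\<phi> i ^^ e) b \<oplus>\<^bsub>C i\<^esub> w" using Suc by blast
    obtain b' w' where bw': "b' \<in> ?Z" "w' \<in> ?W" "b = \<phi> i b' \<oplus>\<^bsub>C i\<^esub> w'"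
      using bw(1) GZ_eq GI[of b ?Z] by blast
    have w'': "(\<phi> i ^^ e) w' \<in> ?W" by (rule iter_reduced_coboundaries[OF bw'(2)])
    have "(\<phi> i ^^ e) b = (\<phi> i ^^ e) (\<phi> i b') \<oplus>\<^bsub>C i\<^esub> (\<phi> i ^^ e) w'"
      unfolding bw'(3) by (rule iter_add[OF \<phi>_closed[OF Zc[OF bw'(1)]] Wc[OF bw'(2)]])
    also have "(\<phi> i ^^ e) (\<phi> i b') = (\<phi> i ^^ Suc e) b'" by (simp add: funpow_swap1)
    finally have "c = (\<phi> i ^^ Suc e) b' \<oplus>\<^bsub>C i\<^esub> (\<phi> i ^^ e) w' \<oplus>\<^bsub>C i\<^esub> w"
      using bw(3) by simp
    also have "\<dots> = (\<phi> i ^^ Suc e) b' \<oplus>\<^bsub>C i\<^esub> ((\<phi> i ^^ e) w' \<oplus>\<^bsub>C i\<^esub> w)"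
      by (rule K.a_assoc[OF iter_closed[OF Zc[OF bw'(1)]] Wc[OF w''] Wc[OF bw(2)]])
    finally show ?case using bw'(1) K.submoduleE(5)[OF W w'' bw(2)] by blast
  qed
  show ?thesis
    unfolding liftable_def
  proof (intro ballI impI allI)
    fix c and n :: nat
    assume c: "c \<in> carrier (C i)" "d i c \<in> multiples x (Suc i)"
    have "c \<in> ?Z" using c unfolding reduced_cocycles_def by simp
    from surj[OF this, of n] obtain b w where bw: "b \<in> ?Z" "w \<in> ?W" "c = (\<phi> i ^^ n) b \<oplus>\<^bsub>C i\<^esub> w"
      by blast
    \<comment> \<open>Every class is the n-th Frobenius image of some \<open>b\<close>, and the
      differential of that image is divisible by x^(p^n). As n \<le> p^n, the lift modulo x^n is the
      Frobenius image itself.\<close>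
    have le: "n \<le> p ^ n" using power_gt_expt[of p n] p_ge_2 by simp
    have "d i ((\<phi> i ^^ n) b) \<in> multiples (x [^] n) (Suc i)"
      by (rule multiples_pow_subset[OF x_closed le iter_d_multiples[OF bw(1)]])
    then show "\<exists>c'\<in>carrier (C i). \<exists>v\<in>?W. c = c' \<oplus>\<^bsub>C i\<^esub> v \<and> d i c' \<in> multiples (x [^] n) (Suc i)"
      using iter_closed[OF Zc[OF bw(1)], of n] bw(2,3) by blast
  qed
qed

text \<open>A class killed by Frobenius and by x^(n+1) yields x^n z, which is killed by x and still
  by Frobenius, since F(x^n z) = x^(n p) F(z). So the kernel of x decides everything, and n descends
  to 0.\<close>

theorem \<phi>_injective:
  assumes lift: "\<And>i. liftable i"
    and torsion: "\<And>i z. \<lbrakk>z \<in> carrier (C i); d i z = \<zero>\<^bsub>C (Suc i)\<^esub>\<rbrakk>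
      \<Longrightarrow> \<exists>n::nat. (x [^] n) \<odot>\<^bsub>C i\<^esub> z \<in> coboundaries i"
    and z: "z \<in> carrier (C i)" "d i z = \<zero>\<^bsub>C (Suc i)\<^esub>" "\<phi> i z \<in> coboundaries i"
  shows "z \<in> coboundaries i"
proof -
  have reduced: "z \<in> reduced_coboundaries i"
    if "z \<in> carrier (C i)" "d i z = \<zero>\<^bsub>C (Suc i)\<^esub>" for z i
    using torsion[OF that] torsion_cocycle_reduced_coboundary[OF lift that] by blast
  have simple: "z \<in> coboundaries i"
    if z: "z \<in> carrier (C i)" "\<phi> i z \<in> coboundaries i" "x \<odot>\<^bsub>C i\<^esub> z \<in> coboundaries i" for z
  proof (cases i)
    case 0
    then show ?thesis using torsion_free[OF z(1)] z(3) by simp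
  next
    case (Suc j)
    obtain b where b: "b \<in> carrier (C j)" "x \<odot>\<^bsub>C i\<^esub> z = d j b" using z(3) Suc by auto
    obtain e where e: "e \<in> carrier (C j)" "\<phi> i z = d j e" using z(2) Suc by auto
    \<comment> \<open>The connecting map and Frobenius: x z = d b gives d F(b) = F(x z) = x^p F(z).
      If also F(z) = d e, then F(b) - x^p e is a cocycle over R, and all of these are zero modulo x,
      because x is surjective on the cohomology of C. Therefore F(b) is zero modulo x.\<close>
    let ?y = "x [^] p" and ?u = "\<phi> j b \<ominus>\<^bsub>C j\<^esub> (x [^] p) \<odot>\<^bsub>C j\<^esub> e"
    have y: "?y \<in> carrier R" using x_closed by simp
    have fb: "\<phi> j b \<in> carrier (C j)" by (rule \<phi>_closed[OF b(1)])
    have ye: "?y \<odot>\<^bsub>C j\<^esub> e \<in> carrier (C j)" using y e by simp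
    have de: "d j e \<in> carrier (C i)" using d_closed[OF e(1)] Suc by simp
    have "d j (\<phi> j b) = \<phi> i (x \<odot>\<^bsub>C i\<^esub> z)" using \<phi>_d[OF b(1)] b(2) Suc by simp
    also have "\<dots> = ?y \<odot>\<^bsub>C i\<^esub> d j e" using \<phi>_smult[OF x_closed z(1)] e(2) by simp
    also have "\<dots> = d j (?y \<odot>\<^bsub>C j\<^esub> e)" using d_smult[OF y e(1)] Suc by simp
    finally have "d j ?u = \<zero>\<^bsub>C (Suc j)\<^esub>"
      using d_diff[OF fb ye] d_closed[OF ye] by (simp add: K.minus_eq K.r_neg)
    then have "?u \<in> reduced_coboundaries j" using reduced fb ye by simp
    moreover have "?y \<odot>\<^bsub>C j\<^esub> e \<in> multiples (x [^] (1::nat)) j"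
      by (rule multiples_pow_subset[OF x_closed _ multiplesI[OF e(1)]]) (use p_ge_2 in simp)
    then have "?y \<odot>\<^bsub>C j\<^esub> e \<in> reduced_coboundaries j"
      using reduced_coboundariesI2 x_closed by simp
    ultimately have "?u \<oplus>\<^bsub>C j\<^esub> ?y \<odot>\<^bsub>C j\<^esub> e \<in> reduced_coboundaries j"
      by (rule K.submoduleE(5)[OF submodule_reduced_coboundaries])
    then have "\<phi> j b \<in> reduced_coboundaries j" using K.diff_add_cancel[OF fb ye] by simp
    moreover have "d j b \<in> multiples x (Suc j)"
      using multiplesI[OF z(1), of x] b(2) Suc by simp
    ultimately have "b \<in> reduced_coboundaries j" using injective_mod[OF b(1)] by blast
    \<comment> \<open>Injectivity modulo x makes \<open>b\<close> itself zero modulo x. Writing b =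
      f + x g with d f = 0, the equation x z = d b = x d g can be cancelled by x.\<close>
    then obtain f g where fg: "f \<in> coboundaries j" "g \<in> carrier (C j)"
      "b = f \<oplus>\<^bsub>C j\<^esub> x \<odot>\<^bsub>C j\<^esub> g" by (rule reduced_coboundariesE)
    have "d j b = x \<odot>\<^bsub>C i\<^esub> d j g"
      unfolding fg(3) using coboundaries_subset[OF fg(1)] fg(2) x_closed d_closed[OF fg(2)] Suc
      by (simp add: d_add d_smult d_coboundaries[OF fg(1)])
    then have "x \<odot>\<^bsub>C i\<^esub> z = x \<odot>\<^bsub>C i\<^esub> d j g" using b(2) by simp
    then have "z = d j g"
      by (rule smult_cancel[rotated 2]) (use z(1) d_closed[OF fg(2)] Suc in simp_all)
    then show ?thesis using fg(2) Suc by simp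
  qed
  obtain n :: nat where "(x [^] n) \<odot>\<^bsub>C i\<^esub> z \<in> coboundaries i" using torsion[OF z(1,2)] by blast
  then show ?thesis
  proof (induction n)
    case 0
    then show ?case using z(1) by simp
  next
    case (Suc n)
    let ?w = "(x [^] n) \<odot>\<^bsub>C i\<^esub> z"
    have xn: "x [^] n \<in> carrier R" using x_closed by simp
    have "?w \<in> coboundaries i"
    proof (rule simple)
      show "?w \<in> carrier (C i)" using xn z(1) by simp
      show "\<phi> i ?w \<in> coboundaries i"
        unfolding \<phi>_smult[OF xn z(1)]
        by (rule K.submoduleE(4)[OF submodule_coboundaries _ z(3)]) (use xn in simp)
      have "(x [^] Suc n) \<odot>\<^bsub>C i\<^esub> z = x \<odot>\<^bsub>C i\<^esub> ?w"
        using x_closed z(1) by (simp add: K.smult_assoc1 K.smult_comm)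
      then show "x \<odot>\<^bsub>C i\<^esub> ?w \<in> coboundaries i" using Suc.prems by simp
    qed
    then show ?case by (rule Suc.IH)
  qed
qed

end

section \<open>Vanishing of cohomology above the dimension, by noetherian induction over
  ideals\<close>

section \<open>Grothendieck vanishing\<close>

text \<open>In a noetherian ring a nonempty chain of ideals contains its union, so Zorn's lemma
  finds a maximal ideal among those that violate \<open>P\<close>, and \<open>step\<close> refutes
  it.\<close>

lemma (in noetherian_ring) noetherian_induct [consumes 1, case_names step]:
  assumes "ideal I R"
    and step: "\<And>I. \<lbrakk>ideal I R; \<And>J. \<lbrakk>ideal J R; I \<subset> J\<rbrakk> \<Longrightarrow> P J\<rbrakk> \<Longrightarrow> P I"
  shows "P I"
proof (rule ccontr)
  let ?A = "{J. ideal J R \<and> \<not> P J}"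
  assume "\<not> P I"
  then have "?A \<noteq> {}" using assms(1) by blast
  moreover have "\<Union>\<C> \<in> ?A" if "\<C> \<noteq> {}" "subset.chain ?A \<C>" for \<C>
  proof -
    have "subset.chain {J. ideal J R} \<C>"
      using that(2) unfolding subset.chain_def by blast
    then have "\<Union>\<C> \<in> \<C>" by (rule ideal_chain_is_trivial[OF that(1)])
    then show ?thesis using that(2) unfolding subset.chain_def by blast
  qed
  ultimately have "\<exists>M\<in>?A. \<forall>X\<in>?A. M \<subseteq> X \<longrightarrow> X = M"
    by (rule subset_Zorn_nonempty)
  then obtain M where M: "ideal M R" "\<not> P M" "\<And>J. \<lbrakk>ideal J R; M \<subset> J\<rbrakk> \<Longrightarrow> P J"
    by blast
  from step[OF M(1,3)] M(2) show False by blast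
qed

context cring
begin

lemma cring_idealI:
  assumes "I \<subseteq> carrier R" "\<zero> \<in> I" and add: "\<And>a b. \<lbrakk>a \<in> I; b \<in> I\<rbrakk> \<Longrightarrow> a \<oplus> b \<in> I"
    and mult: "\<And>r a. \<lbrakk>r \<in> carrier R; a \<in> I\<rbrakk> \<Longrightarrow> r \<otimes> a \<in> I"
  shows "ideal I R"
proof (rule idealI[OF ring_axioms])
  note sub = subsetD[OF assms(1)]
  have neg: "\<ominus> a \<in> I" if "a \<in> I" for a
    using mult[of "\<ominus> \<one>" a] sub[OF that] that by (simp add: l_minus)
  show "subgroup I (add_monoid R)"
  proof (rule add.subgroupI)
    show "I \<subseteq> carrier R" by (rule assms(1))
    show "I \<noteq> {}" using assms(2) by blast
  qed (simp_all add: neg add)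
  show "r \<otimes> a \<in> I" if "a \<in> I" "r \<in> carrier R" for r a
    by (rule mult[OF that(2,1)])
  show "a \<otimes> r \<in> I" if "a \<in> I" "r \<in> carrier R" for r a
    using mult[OF that(2,1)] m_comm[OF sub[OF that(1)] that(2)] by simp
qed

text \<open>The colon ideal I : a, the kernel of multiplication by a from R to R/I. It gives the
  exact sequence 0 -> R/(I : a) -> R/I -> R/(I + (a)) -> 0.\<close>

definition ideal_quotient :: "'a set \<Rightarrow> 'a \<Rightarrow> 'a set" where
  "ideal_quotient I a = {b \<in> carrier R. a \<otimes> b \<in> I}"

lemma ideal_quotient_ideal:
  assumes I: "ideal I R" and a: "a \<in> carrier R"
  shows "ideal (ideal_quotient I a) R" and "I \<subseteq> ideal_quotient I a"
proof -
  interpret I: ideal I R by (rule I)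
  show "ideal (ideal_quotient I a) R"
  proof (rule cring_idealI)
    show "ideal_quotient I a \<subseteq> carrier R" unfolding ideal_quotient_def by blast
    show "\<zero> \<in> ideal_quotient I a" unfolding ideal_quotient_def using a by simp
    show "b \<oplus> c \<in> ideal_quotient I a" if "b \<in> ideal_quotient I a" "c \<in> ideal_quotient I a" for b c
      using that a unfolding ideal_quotient_def by (simp add: r_distr)
    show "r \<otimes> b \<in> ideal_quotient I a" if "r \<in> carrier R" "b \<in> ideal_quotient I a" for r b
      using that a I.I_l_closed[of "a \<otimes> b" r] m_lcomm[of a r b] unfolding ideal_quotient_def by simp
  qed
  show "I \<subseteq> ideal_quotient I a"
    using I.I_l_closed[OF _ a] I.a_subset unfolding ideal_quotient_def by blast
qed

lemma ideal_quotient_prime: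
  assumes "primeideal I R" "a \<in> carrier R" "a \<notin> I"
  shows "ideal_quotient I a = I"
proof -
  interpret I: primeideal I R by (rule assms(1))
  show ?thesis
    using I.I_prime[OF assms(2)] assms(3) ideal_quotient_ideal(2)[OF I.is_ideal assms(2)]
    unfolding ideal_quotient_def by blast
qed

lemma adjoin_ideal:
  assumes I: "ideal I R" and a: "a \<in> carrier R"
  shows "ideal (I <+>\<^bsub>R\<^esub> PIdl a) R" "I \<subseteq> I <+>\<^bsub>R\<^esub> PIdl a" "a \<in> I <+>\<^bsub>R\<^esub> PIdl a"
proof -
  interpret I: ideal I R by (rule I)
  interpret A: ideal "PIdl a" R by (rule cgenideal_ideal[OF a])
  show "ideal (I <+>\<^bsub>R\<^esub> PIdl a) R" by (rule add_ideals[OF I cgenideal_ideal[OF a]])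
  have "b \<in> I <+>\<^bsub>R\<^esub> PIdl a" if b: "b \<in> I" for b
  proof -
    have "b = b \<oplus> \<zero>" using subsetD[OF I.a_subset b] by simp
    then show ?thesis using b A.zero_closed unfolding set_add_def' by blast
  qed
  then show "I \<subseteq> I <+>\<^bsub>R\<^esub> PIdl a" by blast
  have "a = \<zero> \<oplus> a" using a by simp
  then show "a \<in> I <+>\<^bsub>R\<^esub> PIdl a"
    using I.zero_closed cgenideal_self[OF a] unfolding set_add_def' by blast
qed

text \<open>A strict chain of \<open>n + 1\<close> primes over \<open>I\<close>, that is, \<open>dim R/I \<ge> n\<close>.\<close>

definition prime_chain :: "'a set \<Rightarrow> nat \<Rightarrow> bool" where
  "prime_chain I n \<longleftrightarrow> (\<exists>P :: nat \<Rightarrow> 'a set.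
     (\<forall>j\<le>n. primeideal (P j) R \<and> I \<subseteq> P j) \<and> (\<forall>j<n. P j \<subset> P (Suc j)))"

lemma prime_chain_mono:
  assumes "prime_chain J n" "I \<subseteq> J" shows "prime_chain I n"
  using assms unfolding prime_chain_def by (meson order_trans)

lemma prime_chain_0: "primeideal I R \<Longrightarrow> prime_chain I 0"
  unfolding prime_chain_def by auto

text \<open>Prepending the prime \<open>I\<close> lengthens the chain. Read backwards, the dimension
  of the quotient drops when a prime ideal is replaced by a strictly larger ideal.\<close>

lemma prime_chain_Suc:
  assumes I: "primeideal I R" and J: "prime_chain J n" "I \<subset> J"
  shows "prime_chain I (Suc n)"
proof -
  obtain P where P: "\<And>j. j \<le> n \<Longrightarrow> primeideal (P j) R \<and> J \<subseteq> P j" "\<And>j. j < n \<Longrightarrow> P j \<subset> P (Suc j)"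
    using J(1) unfolding prime_chain_def by blast
  have 1: "primeideal (case_nat I P j) R \<and> I \<subseteq> case_nat I P j" if "j \<le> Suc n" for j
    using that P(1)[of "j - 1"] I J(2) by (cases j) auto
  have 2: "case_nat I P j \<subset> case_nat I P (Suc j)" if "j < Suc n" for j
    using that P(1)[of 0] P(2)[of "j - 1"] J(2) by (cases j) auto
  show ?thesis unfolding prime_chain_def
    by (intro exI[of _ "case_nat I P"] conjI allI impI) (use 1 2 in blast)+
qed

end

text \<open>\<open>E I i\<close> stands for \<open>I C\<^sup>i\<close> in a complex of flat modules in which \<open>C\<^sup>j\<close>, \<open>j > 0\<close>, and the
  cohomology behave as for the Cech complex of the sequence \<open>F\<close>.\<close>

locale extended_ideals = cochain_complex R C d
  for R :: "('a, 'c) ring_scheme" (structure) and C :: "nat \<Rightarrow> ('a, 'b, 'e) module_scheme" and d +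
  fixes E :: "'a set \<Rightarrow> nat \<Rightarrow> 'b set" and F :: "'a set"
  assumes F_subset: "F \<subseteq> carrier R"
    and E_submodule: "ideal I R \<Longrightarrow> submodule (E I i) R (C i)"
    and E_d: "\<lbrakk>ideal I R; c \<in> E I i\<rbrakk> \<Longrightarrow> d i c \<in> E I (Suc i)"
    and E_smult: "\<lbrakk>ideal I R; r \<in> I; c \<in> carrier (C i)\<rbrakk> \<Longrightarrow> r \<odot>\<^bsub>C i\<^esub> c \<in> E I i"
    and E_quotient: "\<lbrakk>ideal I R; a \<in> carrier R; c \<in> carrier (C i)\<rbrakk>
      \<Longrightarrow> a \<odot>\<^bsub>C i\<^esub> c \<in> E I i \<longleftrightarrow> c \<in> E (ideal_quotient I a) i"
    and E_adjoin: "\<lbrakk>ideal I R; a \<in> carrier R; c \<in> E (I <+>\<^bsub>R\<^esub> PIdl a) i\<rbrakk>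
      \<Longrightarrow> \<exists>e\<in>E I i. \<exists>u\<in>carrier (C i). c = e \<oplus>\<^bsub>C i\<^esub> a \<odot>\<^bsub>C i\<^esub> u"
    and E_mono: "\<lbrakk>ideal I R; ideal J R; I \<subseteq> J\<rbrakk> \<Longrightarrow> E I i \<subseteq> E J i"
    and E_top: "\<lbrakk>ideal I R; F \<subseteq> I; c \<in> carrier (C (Suc i))\<rbrakk> \<Longrightarrow> c \<in> E I (Suc i)"
    and E_torsion: "\<lbrakk>ideal I R; f \<in> F; c \<in> carrier (C i); d i c \<in> E I (Suc i)\<rbrakk>
      \<Longrightarrow> \<exists>n::nat. (f [^] n) \<odot>\<^bsub>C i\<^esub> c \<in> coboundaries i <+>\<^bsub>C i\<^esub> E I i"
begin

text \<open>The hypothesis I : f = I says that f is regular on R/I. In the long exact sequence of 0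
  -> R/I -> R/I -> R/(I + (f)) -> 0, vanishing of H^j for R/(I + (f)), given as \<open>ih\<close>,
  makes f injective on H^(j+1)(R/I).\<close>

lemma vanishing_aux:
  assumes I: "ideal I R" and f: "f \<in> carrier R" "ideal_quotient I f = I"
    and ih: "\<And>b. \<lbrakk>b \<in> carrier (C j); d j b \<in> E (I <+>\<^bsub>R\<^esub> PIdl f) (Suc j)\<rbrakk>
      \<Longrightarrow> b \<in> coboundaries j <+>\<^bsub>C j\<^esub> E (I <+>\<^bsub>R\<^esub> PIdl f) j"
    and u: "u \<in> carrier (C (Suc j))" "d (Suc j) u \<in> E I (Suc (Suc j))"
      "f \<odot>\<^bsub>C (Suc j)\<^esub> u \<in> coboundaries (Suc j) <+>\<^bsub>C (Suc j)\<^esub> E I (Suc j)"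
  shows "u \<in> coboundaries (Suc j) <+>\<^bsub>C (Suc j)\<^esub> E I (Suc j)"
proof -
  let ?I = "I <+>\<^bsub>R\<^esub> PIdl f"
  note I' = adjoin_ideal[OF I f(1)]
  note E = E_submodule[OF I, of "Suc j"]
  note Ec = K.submodule_subset[OF E]
  obtain b' e where be: "b' \<in> coboundaries (Suc j)" "e \<in> E I (Suc j)" "f \<odot>\<^bsub>C (Suc j)\<^esub> u = b' \<oplus>\<^bsub>C (Suc j)\<^esub> e"
    using u(3) unfolding K.set_add_iff by blast
  obtain b where b: "b \<in> carrier (C j)" "b' = d j b" using be(1) by auto
  have db: "d j b \<in> carrier (C (Suc j))" by (rule d_closed[OF b(1)])
  \<comment> \<open>Both f u and \<open>e\<close> have coefficients in I + (f), hence so has their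
    difference d b, and \<open>b\<close> is a cocycle for the larger ideal, to which
    \<open>ih\<close> applies.\<close>
  have "f \<odot>\<^bsub>C (Suc j)\<^esub> u \<in> E ?I (Suc j)" by (rule E_smult[OF I'(1,3) u(1)])
  moreover have "e \<in> E ?I (Suc j)" using E_mono[OF I I'(1,2)] be(2) by blast
  ultimately have "d j b \<in> E ?I (Suc j)"
    using K.submodule_add_cancel(2)[OF E_submodule[OF I'(1)] _ db Ec[OF be(2)]] be(3) b(2) by simp
  from ih[OF b(1) this] obtain g h where gh: "g \<in> coboundaries j" "h \<in> E ?I j" "b = g \<oplus>\<^bsub>C j\<^esub> h"
    unfolding K.set_add_iff by blast
  obtain e' v where ev: "e' \<in> E I j" "v \<in> carrier (C j)" "h = e' \<oplus>\<^bsub>C j\<^esub> f \<odot>\<^bsub>C j\<^esub> v"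
    using E_adjoin[OF I f(1) gh(2)] by blast
  have e'c: "e' \<in> carrier (C j)" by (rule K.submodule_subset[OF E_submodule[OF I] ev(1)])
  have dv: "d j v \<in> carrier (C (Suc j))" by (rule d_closed[OF ev(2)])
  have de': "d j e' \<in> E I (Suc j)" by (rule E_d[OF I ev(1)])
  have "d j b = d j e' \<oplus>\<^bsub>C (Suc j)\<^esub> f \<odot>\<^bsub>C (Suc j)\<^esub> d j v"
    unfolding gh(3) ev(3)
    using coboundaries_subset[OF gh(1)] e'c ev(2) f(1) dv Ec[OF de'] d_coboundaries[OF gh(1)]
    by (simp add: d_add d_smult)
  then have eq: "f \<odot>\<^bsub>C (Suc j)\<^esub> u = (d j e' \<oplus>\<^bsub>C (Suc j)\<^esub> e) \<oplus>\<^bsub>C (Suc j)\<^esub> f \<odot>\<^bsub>C (Suc j)\<^esub> d j v"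
    using be(3) b(2) f(1) dv Ec[OF de'] Ec[OF be(2)] by (simp add: K.a_ac)
  have s: "d j e' \<oplus>\<^bsub>C (Suc j)\<^esub> e \<in> E I (Suc j)" by (rule K.submoduleE(5)[OF E de' be(2)])
  \<comment> \<open>With b = g + e' + f v, the multiple f (u - d v) lies in I C. The colon condition
    cancels f, and d v is the required coboundary.\<close>
  have "f \<odot>\<^bsub>C (Suc j)\<^esub> (u \<ominus>\<^bsub>C (Suc j)\<^esub> d j v) = d j e' \<oplus>\<^bsub>C (Suc j)\<^esub> e"
    unfolding K.smult_r_diff[OF f(1) u(1) dv] eq
    by (rule K.add_diff_cancel(1)) (use f(1) dv Ec[OF s] in simp_all)
  then have "u \<ominus>\<^bsub>C (Suc j)\<^esub> d j v \<in> E I (Suc j)"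
    using E_quotient[OF I f(1), of "u \<ominus>\<^bsub>C (Suc j)\<^esub> d j v" "Suc j"] s u(1) dv f(2) by simp
  moreover have "u = d j v \<oplus>\<^bsub>C (Suc j)\<^esub> (u \<ominus>\<^bsub>C (Suc j)\<^esub> d j v)"
    using K.diff_add_cancel[OF u(1) dv] u(1) dv by (simp add: K.a_comm)
  ultimately show ?thesis unfolding K.set_add_iff using d_image_coboundaries[OF ev(2)] by blast
qed

text \<open>The failure of \<open>prime_chain I j\<close> means dim R/I < j. If \<open>I\<close> is
  prime and misses some f in \<open>F\<close>, then f is regular on R/I and the dimension drops for
  R/(I + (f)), so f is injective on H^j(R/I), which on the other hand is f-power torsion. If
  \<open>I\<close> is neither prime nor the whole ring, R/I is an extension of quotients by strictly
  larger ideals.\<close>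

theorem vanishing:
  assumes "noetherian_ring R" and I: "ideal I R"
    and "\<not> prime_chain I j" "c \<in> carrier (C j)" "d j c \<in> E I (Suc j)"
  shows "c \<in> coboundaries j <+>\<^bsub>C j\<^esub> E I j"
proof -
  interpret noetherian_ring R by (rule assms(1))
  have "\<forall>j c. \<not> prime_chain I j \<longrightarrow> c \<in> carrier (C j) \<longrightarrow> d j c \<in> E I (Suc j) \<longrightarrow>
      c \<in> coboundaries j <+>\<^bsub>C j\<^esub> E I j"
    using I
  proof (induction I rule: noetherian_induct)
    case (step I)
    note I = step.hyps(1)
    interpret I: ideal I R by (rule I)
    have IH: "c \<in> coboundaries j <+>\<^bsub>C j\<^esub> E J j"
      if "ideal J R" "I \<subset> J" "\<not> prime_chain J j" "c \<in> carrier (C j)" "d j c \<in> E J (Suc j)" for J j c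
      using step.IH[OF that(1,2)] that(3-5) by blast
    show ?case
    proof (intro allI impI)
      fix j c assume nc: "\<not> prime_chain I j" and c: "c \<in> carrier (C j)" "d j c \<in> E I (Suc j)"
      note B = submodule_coboundaries[of j] and E = E_submodule[OF I, of j]
      have nc': "\<not> prime_chain J j" if "I \<subseteq> J" for J using nc prime_chain_mono[OF _ that] by blast
      consider "I = carrier R" | "primeideal I R"
        | a b where "a \<in> carrier R" "b \<in> carrier R" "a \<otimes> b \<in> I" "a \<notin> I" "b \<notin> I"
        using primeidealI[OF I cring_axioms] by blast
      then show "c \<in> coboundaries j <+>\<^bsub>C j\<^esub> E I j"
      proof cases
        case 1
        have "\<one> \<odot>\<^bsub>C j\<^esub> c \<in> E I j" by (rule E_smult[OF I _ c(1)]) (simp add: 1)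
        then show ?thesis using c(1) K.set_add_subset2[OF B E] by simp
      next
        case 2
        \<comment> \<open>A prime ideal is by itself a chain of length 0, so \<open>j\<close> is
          positive. This provides the degree below for the induction hypothesis, and a degree in
          which \<open>E_top\<close> applies.\<close>
        obtain j' where j: "j = Suc j'" using nc prime_chain_0[OF 2] by (cases j) auto
        show ?thesis
        proof (cases "F \<subseteq> I")
          case True
          then show ?thesis using E_top[OF I True] c(1) j K.set_add_subset2[OF B E] by simp
        next
          case False
          then obtain f where f: "f \<in> F" "f \<notin> I" by blast
          have fR: "f \<in> carrier R" using f F_subset by blast
          have fn: "f [^] n \<in> carrier R" for n :: nat using fR by simp
          let ?I = "I <+>\<^bsub>R\<^esub> PIdl f"
          note I' = adjoin_ideal[OF I fR]
          have less: "I \<subset> ?I" using I'(2,3) f(2) by blast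
          have nch: "\<not> prime_chain ?I j'" using prime_chain_Suc[OF 2 _ less] nc j by blast
          have q: "ideal_quotient I f = I" by (rule ideal_quotient_prime[OF 2 fR f(2)])
          obtain n :: nat where n: "(f [^] n) \<odot>\<^bsub>C j\<^esub> c \<in> coboundaries j <+>\<^bsub>C j\<^esub> E I j"
            using E_torsion[OF I f(1) c] by blast
          \<comment> \<open>The powers of f are removed one at a time: injectivity of f on H^j(R/I)
            turns the vanishing of f^(n+1) c into that of f^n c.\<close>
          then show ?thesis
          proof (induction n)
            case 0
            then show ?case using c(1) by simp
          next
            case (Suc n)
            let ?u = "(f [^] n) \<odot>\<^bsub>C j\<^esub> c"
            have u: "?u \<in> carrier (C j)" using fn c(1) by simp
            have du: "d j ?u \<in> E I (Suc j)"
              unfolding d_smult[OF fn c(1)] by (rule K.submoduleE(4)[OF E_submodule[OF I] fn c(2)])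
            have fu: "f \<odot>\<^bsub>C j\<^esub> ?u = (f [^] Suc n) \<odot>\<^bsub>C j\<^esub> c"
              using fR c(1) by (simp add: K.smult_assoc1 K.smult_comm)
            have "?u \<in> coboundaries j <+>\<^bsub>C j\<^esub> E I j"
              unfolding j
            proof (rule vanishing_aux[OF I fR q IH[OF I'(1) less nch]])
              show "f \<odot>\<^bsub>C (Suc j')\<^esub> ((f [^] n) \<odot>\<^bsub>C (Suc j')\<^esub> c)
                \<in> coboundaries (Suc j') <+>\<^bsub>C (Suc j')\<^esub> E I (Suc j')"
                using fu Suc.prems j by simp
            qed (use u du j in simp_all)
            then show ?case by (rule Suc.IH)
          qed
        qed
      next
        case 3
        \<comment> \<open>Exact sequence 0 -> R/(I : a) -> R/I -> R/(I + (a)) -> 0. The class is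
          zero modulo I + (a), so up to terms that vanish it is a v, and \<open>v\<close> is then a
          cocycle modulo I : a. The colon ideal is strictly larger than \<open>I\<close> because it
          contains \<open>b\<close>.\<close>
        let ?I = "I <+>\<^bsub>R\<^esub> PIdl a" and ?J = "ideal_quotient I a"
        note I' = adjoin_ideal[OF I 3(1)] and J = ideal_quotient_ideal[OF I 3(1)]
        have EJ: "submodule (E ?J i) R (C i)" for i by (rule E_submodule[OF J(1)])
        have lessI: "I \<subset> ?I" using I'(2,3) 3(4) by blast
        have lessJ: "I \<subset> ?J" using J(2) 3 unfolding ideal_quotient_def by blast
        have "d j c \<in> E ?I (Suc j)" using E_mono[OF I I'(1,2)] c(2) by blast
        from IH[OF I'(1) lessI nc'[OF I'(2)] c(1) this]
        obtain g h where gh: "g \<in> coboundaries j" "h \<in> E ?I j" "c = g \<oplus>\<^bsub>C j\<^esub> h"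
          unfolding K.set_add_iff by blast
        obtain e v where ev: "e \<in> E I j" "v \<in> carrier (C j)" "h = e \<oplus>\<^bsub>C j\<^esub> a \<odot>\<^bsub>C j\<^esub> v"
          using E_adjoin[OF I 3(1) gh(2)] by blast
        have ec: "e \<in> carrier (C j)" by (rule K.submodule_subset[OF E ev(1)])
        have gc: "g \<in> carrier (C j)" by (rule coboundaries_subset[OF gh(1)])
        have av: "a \<odot>\<^bsub>C j\<^esub> v \<in> carrier (C j)" using 3(1) ev(2) by simp
        have dav: "d j (a \<odot>\<^bsub>C j\<^esub> v) \<in> carrier (C (Suc j))" by (rule d_closed[OF av])
        have de: "d j e \<in> E I (Suc j)" by (rule E_d[OF I ev(1)])
        have dec: "d j e \<in> carrier (C (Suc j))" by (rule d_closed[OF ec])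
        have "d j c = d j e \<oplus>\<^bsub>C (Suc j)\<^esub> d j (a \<odot>\<^bsub>C j\<^esub> v)"
          unfolding gh(3) ev(3) using gc ec av dav dec d_coboundaries[OF gh(1)] by (simp add: d_add)
        then have "d j (a \<odot>\<^bsub>C j\<^esub> v) \<in> E I (Suc j)"
          using K.submodule_add_cancel(1)[OF E_submodule[OF I] _ dec dav de] c(2) by simp
        then have "d j v \<in> E ?J (Suc j)"
          using E_quotient[OF I 3(1) d_closed[OF ev(2)]] d_smult[OF 3(1) ev(2)] by simp
        from IH[OF J(1) lessJ nc'[OF J(2)] ev(2) this]
        obtain g' h' where gh': "g' \<in> coboundaries j" "h' \<in> E ?J j" "v = g' \<oplus>\<^bsub>C j\<^esub> h'"
          unfolding K.set_add_iff by blast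
        have h'c: "h' \<in> carrier (C j)" by (rule K.submodule_subset[OF EJ gh'(2)])
        have g'c: "g' \<in> carrier (C j)" by (rule coboundaries_subset[OF gh'(1)])
        have ah: "a \<odot>\<^bsub>C j\<^esub> h' \<in> E I j" using E_quotient[OF I 3(1) h'c] gh'(2) by simp
        have ahc: "a \<odot>\<^bsub>C j\<^esub> h' \<in> carrier (C j)" using 3(1) h'c by simp
        have ag: "a \<odot>\<^bsub>C j\<^esub> g' \<in> coboundaries j" by (rule K.submoduleE(4)[OF B 3(1) gh'(1)])
        have agc: "a \<odot>\<^bsub>C j\<^esub> g' \<in> carrier (C j)" using 3(1) g'c by simp
        have "c = (g \<oplus>\<^bsub>C j\<^esub> a \<odot>\<^bsub>C j\<^esub> g') \<oplus>\<^bsub>C j\<^esub> (e \<oplus>\<^bsub>C j\<^esub> a \<odot>\<^bsub>C j\<^esub> h')"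
          unfolding gh(3) ev(3) gh'(3) using 3(1) gc ec g'c h'c agc ahc
          by (simp add: K.smult_r_distr K.a_ac)
        then show ?thesis
          unfolding K.set_add_iff
          using K.submoduleE(5)[OF B gh(1) ag] K.submoduleE(5)[OF E ev(1) ah] by blast
      qed
    qed
  qed
  then show ?thesis using assms(3-5) by blast
qed

end

section \<open>Localization of modules and semilinear maps between localizations\<close>

section \<open>Localization\<close>

locale fractions = module R M for R :: "('a, 'c) ring_scheme" (structure)
    and M :: "('a, 'm, 'd) module_scheme" +
  fixes D :: "'a set"
  assumes D_closed: "s \<in> D \<Longrightarrow> s \<in> carrier R"
    and one_D: "\<one> \<in> D"
    and mult_D: "\<lbrakk>s \<in> D; t \<in> D\<rbrakk> \<Longrightarrow> s \<otimes> t \<in> D"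
begin

lemma equiv_loc_rel: "equiv (carrier M \<times> D) (loc_rel R D M)"
proof (rule equivI)
  show "loc_rel R D M \<subseteq> (carrier M \<times> D) \<times> (carrier M \<times> D)"
    unfolding loc_rel_def by blast
  show "refl_on (carrier M \<times> D) (loc_rel R D M)"
    unfolding loc_rel_def refl_on_def using one_D by blast
  show "sym (loc_rel R D M)"
    unfolding loc_rel_def sym_def by clarify (metis (no_types, lifting))
  show "trans (loc_rel R D M)"
  proof (rule transI)
    fix x y z assume "(x, y) \<in> loc_rel R D M" "(y, z) \<in> loc_rel R D M"
    then obtain m s n t q r u v where x: "x = (m, s)" "y = (n, t)" "z = (q, r)"
      and c: "m \<in> carrier M" "n \<in> carrier M" "q \<in> carrier M" "s \<in> D" "t \<in> D" "r \<in> D" "u \<in> D" "v \<in> D"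
      and e: "u \<odot>\<^bsub>M\<^esub> (t \<odot>\<^bsub>M\<^esub> m) = u \<odot>\<^bsub>M\<^esub> (s \<odot>\<^bsub>M\<^esub> n)" "v \<odot>\<^bsub>M\<^esub> (r \<odot>\<^bsub>M\<^esub> n) = v \<odot>\<^bsub>M\<^esub> (t \<odot>\<^bsub>M\<^esub> q)"
      unfolding loc_rel_def by blast
    note R = c(4-8)[THEN D_closed]
    \<comment> \<open>The factor t is part of the witness: the first relation is multiplied by v r
      and the second by u s, and u v t is what the two outer fractions then have in common.\<close>
    let ?w = "u \<otimes> v \<otimes> t"
    have w: "?w \<in> D" using c mult_D by blast
    have "?w \<odot>\<^bsub>M\<^esub> (r \<odot>\<^bsub>M\<^esub> m) = (v \<otimes> r) \<odot>\<^bsub>M\<^esub> (u \<odot>\<^bsub>M\<^esub> (t \<odot>\<^bsub>M\<^esub> m))"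
      using R c(1-3) by (simp add: smult_assoc1[symmetric] R.m_ac)
    also have "\<dots> = (u \<otimes> s) \<odot>\<^bsub>M\<^esub> (v \<odot>\<^bsub>M\<^esub> (r \<odot>\<^bsub>M\<^esub> n))"
      unfolding e(1) using R c(1-3) by (simp add: smult_assoc1[symmetric] R.m_ac)
    also have "\<dots> = ?w \<odot>\<^bsub>M\<^esub> (s \<odot>\<^bsub>M\<^esub> q)"
      unfolding e(2) using R c(1-3) by (simp add: smult_assoc1[symmetric] R.m_ac)
    finally show "(x, z) \<in> loc_rel R D M"
      unfolding loc_rel_def x using c w by blast
  qed
qed

lemma fraction_eq_iff:
  assumes "m \<in> carrier M" "n \<in> carrier M" "s \<in> D" "t \<in> D"
  shows "fraction R D M m s = fraction R D M n t \<longleftrightarrow>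
    (\<exists>u\<in>D. u \<odot>\<^bsub>M\<^esub> (t \<odot>\<^bsub>M\<^esub> m) = u \<odot>\<^bsub>M\<^esub> (s \<odot>\<^bsub>M\<^esub> n))"
proof -
  have "fraction R D M m s = fraction R D M n t \<longleftrightarrow> ((m, s), (n, t)) \<in> loc_rel R D M"
    unfolding fraction_def by (rule eq_equiv_class_iff[OF equiv_loc_rel]) (use assms in simp_all)
  also have "\<dots> \<longleftrightarrow> (\<exists>u\<in>D. u \<odot>\<^bsub>M\<^esub> (t \<odot>\<^bsub>M\<^esub> m) = u \<odot>\<^bsub>M\<^esub> (s \<odot>\<^bsub>M\<^esub> n))"
    unfolding loc_rel_def using assms by simp
  finally show ?thesis .
qed

lemma fraction_self: "\<lbrakk>m \<in> carrier M; s \<in> D\<rbrakk> \<Longrightarrow> (m, s) \<in> fraction R D M m s"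
  unfolding fraction_def by (rule equiv_class_self[OF equiv_loc_rel]) simp

lemma in_fraction:
  assumes "(n, t) \<in> fraction R D M m s"
  shows "m \<in> carrier M" "n \<in> carrier M" "s \<in> D" "t \<in> D" "fraction R D M n t = fraction R D M m s"
proof -
  have r: "((m, s), (n, t)) \<in> loc_rel R D M" using assms unfolding fraction_def by simp
  then show "m \<in> carrier M" "n \<in> carrier M" "s \<in> D" "t \<in> D" unfolding loc_rel_def by simp_all
  show "fraction R D M n t = fraction R D M m s"
    unfolding fraction_def using equiv_class_eq[OF equiv_loc_rel r] by simp
qed

lemma fraction_closed:
  "\<lbrakk>m \<in> carrier M; s \<in> D\<rbrakk> \<Longrightarrow> fraction R D M m s \<in> carrier (localization R D M)"
  unfolding localization_def fraction_def by (simp add: quotientI)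

lemma localizationE:
  assumes "U \<in> carrier (localization R D M)"
  obtains m s where "m \<in> carrier M" "s \<in> D" "U = fraction R D M m s"
  using assms unfolding localization_def fraction_def quotient_def by auto

lemma fraction_expand:
  assumes "m \<in> carrier M" "s \<in> D" "t \<in> D"
  shows "fraction R D M (t \<odot>\<^bsub>M\<^esub> m) (t \<otimes> s) = fraction R D M m s"
    "fraction R D M (t \<odot>\<^bsub>M\<^esub> m) (s \<otimes> t) = fraction R D M m s"
proof -
  note R = assms(2,3)[THEN D_closed]
  show "fraction R D M (t \<odot>\<^bsub>M\<^esub> m) (t \<otimes> s) = fraction R D M m s"
  proof (subst fraction_eq_iff)
    have "\<one> \<odot>\<^bsub>M\<^esub> (s \<odot>\<^bsub>M\<^esub> (t \<odot>\<^bsub>M\<^esub> m)) = \<one> \<odot>\<^bsub>M\<^esub> ((t \<otimes> s) \<odot>\<^bsub>M\<^esub> m)"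
      using assms(1) R by (simp add: smult_assoc1 smult_comm)
    then show "\<exists>u\<in>D. u \<odot>\<^bsub>M\<^esub> (s \<odot>\<^bsub>M\<^esub> (t \<odot>\<^bsub>M\<^esub> m)) = u \<odot>\<^bsub>M\<^esub> ((t \<otimes> s) \<odot>\<^bsub>M\<^esub> m)"
      using one_D by (rule bexI)
  qed (use assms R mult_D in simp_all)
  then show "fraction R D M (t \<odot>\<^bsub>M\<^esub> m) (s \<otimes> t) = fraction R D M m s"
    using R by (simp add: R.m_comm)
qed

text \<open>Two fractions over one denominator add through their numerators, so the axioms for sums
  reduce to those of \<open>M\<close>.\<close>

lemma common_denominator2:
  assumes "U \<in> carrier (localization R D M)" "V \<in> carrier (localization R D M)"
  obtains m n s where "m \<in> carrier M" "n \<in> carrier M" "s \<in> D"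
    "U = fraction R D M m s" "V = fraction R D M n s"
proof -
  obtain m s where m: "m \<in> carrier M" "s \<in> D" "U = fraction R D M m s"
    using assms(1) by (rule localizationE)
  obtain n t where n: "n \<in> carrier M" "t \<in> D" "V = fraction R D M n t"
    using assms(2) by (rule localizationE)
  show thesis
  proof (rule that[of "t \<odot>\<^bsub>M\<^esub> m" "s \<odot>\<^bsub>M\<^esub> n" "s \<otimes> t"])
    show "U = fraction R D M (t \<odot>\<^bsub>M\<^esub> m) (s \<otimes> t)" using fraction_expand(2)[OF m(1,2) n(2)] m(3) by simp
    show "V = fraction R D M (s \<odot>\<^bsub>M\<^esub> n) (s \<otimes> t)" using fraction_expand(1)[OF n(1,2) m(2)] n(3) by simp
  qed (use m n D_closed mult_D in simp_all)
qed

lemma fraction_add: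
  assumes "m \<in> carrier M" "n \<in> carrier M" "s \<in> D" "t \<in> D"
  shows "fraction R D M m s \<oplus>\<^bsub>localization R D M\<^esub> fraction R D M n t =
    fraction R D M (t \<odot>\<^bsub>M\<^esub> m \<oplus>\<^bsub>M\<^esub> s \<odot>\<^bsub>M\<^esub> n) (s \<otimes> t)"
proof -
  let ?c = "fraction R D M (t \<odot>\<^bsub>M\<^esub> m \<oplus>\<^bsub>M\<^esub> s \<odot>\<^bsub>M\<^esub> n) (s \<otimes> t)"
  have wd: "fraction R D M (t' \<odot>\<^bsub>M\<^esub> m' \<oplus>\<^bsub>M\<^esub> s' \<odot>\<^bsub>M\<^esub> n') (s' \<otimes> t') = ?c"
    if "(m', s') \<in> fraction R D M m s" "(n', t') \<in> fraction R D M n t" for m' s' n' t'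
  proof -
    note a = in_fraction[OF that(1)] and b = in_fraction[OF that(2)]
    note R = a(3,4)[THEN D_closed] b(3,4)[THEN D_closed]
    obtain u where u: "u \<in> D" "u \<odot>\<^bsub>M\<^esub> (s \<odot>\<^bsub>M\<^esub> m') = u \<odot>\<^bsub>M\<^esub> (s' \<odot>\<^bsub>M\<^esub> m)"
      using a(5) fraction_eq_iff[OF a(2,1,4,3)] by blast
    obtain v where v: "v \<in> D" "v \<odot>\<^bsub>M\<^esub> (t \<odot>\<^bsub>M\<^esub> n') = v \<odot>\<^bsub>M\<^esub> (t' \<odot>\<^bsub>M\<^esub> n)"
      using b(5) fraction_eq_iff[OF b(2,1,4,3)] by blast
    note uv = u(1)[THEN D_closed] v(1)[THEN D_closed]
    \<comment> \<open>The representatives of the two summands are related by \<open>u\<close> and by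
      \<open>v\<close> separately. The product u v serves for both, and the two halves of the
      numerator are compared one by one.\<close>
    have 1: "(u \<otimes> v \<otimes> (s \<otimes> t)) \<odot>\<^bsub>M\<^esub> (t' \<odot>\<^bsub>M\<^esub> m') = (u \<otimes> v \<otimes> (s' \<otimes> t')) \<odot>\<^bsub>M\<^esub> (t \<odot>\<^bsub>M\<^esub> m)"
    proof -
      have "(u \<otimes> v \<otimes> (s \<otimes> t)) \<odot>\<^bsub>M\<^esub> (t' \<odot>\<^bsub>M\<^esub> m') = (v \<otimes> t \<otimes> t') \<odot>\<^bsub>M\<^esub> (u \<odot>\<^bsub>M\<^esub> (s \<odot>\<^bsub>M\<^esub> m'))"
        using R uv a(2) by (simp add: smult_assoc1[symmetric] R.m_ac)
      also have "\<dots> = (u \<otimes> v \<otimes> (s' \<otimes> t')) \<odot>\<^bsub>M\<^esub> (t \<odot>\<^bsub>M\<^esub> m)"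
        unfolding u(2) using R uv a(1) by (simp add: smult_assoc1[symmetric] R.m_ac)
      finally show ?thesis .
    qed
    have 2: "(u \<otimes> v \<otimes> (s \<otimes> t)) \<odot>\<^bsub>M\<^esub> (s' \<odot>\<^bsub>M\<^esub> n') = (u \<otimes> v \<otimes> (s' \<otimes> t')) \<odot>\<^bsub>M\<^esub> (s \<odot>\<^bsub>M\<^esub> n)"
    proof -
      have "(u \<otimes> v \<otimes> (s \<otimes> t)) \<odot>\<^bsub>M\<^esub> (s' \<odot>\<^bsub>M\<^esub> n') = (u \<otimes> s \<otimes> s') \<odot>\<^bsub>M\<^esub> (v \<odot>\<^bsub>M\<^esub> (t \<odot>\<^bsub>M\<^esub> n'))"
        using R uv b(2) by (simp add: smult_assoc1[symmetric] R.m_ac)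
      also have "\<dots> = (u \<otimes> v \<otimes> (s' \<otimes> t')) \<odot>\<^bsub>M\<^esub> (s \<odot>\<^bsub>M\<^esub> n)"
        unfolding v(2) using R uv b(1) by (simp add: smult_assoc1[symmetric] R.m_ac)
      finally show ?thesis .
    qed
    have c: "t' \<odot>\<^bsub>M\<^esub> m' \<in> carrier M" "s' \<odot>\<^bsub>M\<^esub> n' \<in> carrier M" "t \<odot>\<^bsub>M\<^esub> m \<in> carrier M" "s \<odot>\<^bsub>M\<^esub> n \<in> carrier M"
      using R a b by simp_all
    have uvst: "u \<otimes> v \<otimes> (s \<otimes> t) \<in> carrier R" "u \<otimes> v \<otimes> (s' \<otimes> t') \<in> carrier R"
      "u \<otimes> v \<in> carrier R" "s \<otimes> t \<in> carrier R" "s' \<otimes> t' \<in> carrier R"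
      using R uv by simp_all
    have "(u \<otimes> v \<otimes> (s \<otimes> t)) \<odot>\<^bsub>M\<^esub> (t' \<odot>\<^bsub>M\<^esub> m' \<oplus>\<^bsub>M\<^esub> s' \<odot>\<^bsub>M\<^esub> n')
        = (u \<otimes> v \<otimes> (s' \<otimes> t')) \<odot>\<^bsub>M\<^esub> (t \<odot>\<^bsub>M\<^esub> m \<oplus>\<^bsub>M\<^esub> s \<odot>\<^bsub>M\<^esub> n)"
      unfolding smult_r_distr[OF uvst(1) c(1,2)] smult_r_distr[OF uvst(2) c(3,4)] 1 2 ..
    then have eq: "(u \<otimes> v) \<odot>\<^bsub>M\<^esub> ((s \<otimes> t) \<odot>\<^bsub>M\<^esub> (t' \<odot>\<^bsub>M\<^esub> m' \<oplus>\<^bsub>M\<^esub> s' \<odot>\<^bsub>M\<^esub> n'))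
        = (u \<otimes> v) \<odot>\<^bsub>M\<^esub> ((s' \<otimes> t') \<odot>\<^bsub>M\<^esub> (t \<odot>\<^bsub>M\<^esub> m \<oplus>\<^bsub>M\<^esub> s \<odot>\<^bsub>M\<^esub> n))"
      unfolding smult_assoc1[OF uvst(3,4) M.a_closed[OF c(1,2)]] smult_assoc1[OF uvst(3,5) M.a_closed[OF c(3,4)]] .
    show ?thesis
      by (subst fraction_eq_iff[OF M.a_closed[OF c(1,2)] M.a_closed[OF c(3,4)] mult_D[OF a(4) b(4)] mult_D[OF a(3) b(3)]])
        (rule bexI, rule eq, rule mult_D[OF u(1) v(1)])
  qed
  have "fraction R D M m s \<oplus>\<^bsub>localization R D M\<^esub> fraction R D M n t =
    (\<Union>(m', s')\<in>fraction R D M m s. \<Union>(n', t')\<in>fraction R D M n t.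
      fraction R D M (t' \<odot>\<^bsub>M\<^esub> m' \<oplus>\<^bsub>M\<^esub> s' \<odot>\<^bsub>M\<^esub> n') (s' \<otimes> t'))"
    unfolding localization_def by simp
  also have "\<dots> = ?c"
  proof (rule UN_constant[OF fraction_self[OF assms(1,3)]], clarify)
    fix m' s' assume "(m', s') \<in> fraction R D M m s"
    then show "(\<Union>(n', t')\<in>fraction R D M n t.
      fraction R D M (t' \<odot>\<^bsub>M\<^esub> m' \<oplus>\<^bsub>M\<^esub> s' \<odot>\<^bsub>M\<^esub> n') (s' \<otimes> t')) = ?c"
      by (intro UN_constant[OF fraction_self[OF assms(2,4)]], clarify) (rule wd)
  qed
  finally show ?thesis .
qed

lemma fraction_add_common:
  assumes "m \<in> carrier M" "n \<in> carrier M" "s \<in> D"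
  shows "fraction R D M m s \<oplus>\<^bsub>localization R D M\<^esub> fraction R D M n s = fraction R D M (m \<oplus>\<^bsub>M\<^esub> n) s"
  unfolding fraction_add[OF assms(1,2,3,3)]
  using fraction_expand(2)[of "m \<oplus>\<^bsub>M\<^esub> n" s s] assms D_closed by (simp add: smult_r_distr)

lemma fraction_smult:
  assumes "r \<in> carrier R" "m \<in> carrier M" "s \<in> D"
  shows "r \<odot>\<^bsub>localization R D M\<^esub> fraction R D M m s = fraction R D M (r \<odot>\<^bsub>M\<^esub> m) s"
proof -
  have wd: "fraction R D M (r \<odot>\<^bsub>M\<^esub> m') s' = fraction R D M (r \<odot>\<^bsub>M\<^esub> m) s"
    if "(m', s') \<in> fraction R D M m s" for m' s'
  proof -
    note a = in_fraction[OF that]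
    obtain u where u: "u \<in> D" "u \<odot>\<^bsub>M\<^esub> (s \<odot>\<^bsub>M\<^esub> m') = u \<odot>\<^bsub>M\<^esub> (s' \<odot>\<^bsub>M\<^esub> m)"
      using a(5) fraction_eq_iff[OF a(2,1,4,3)] by blast
    note R = u(1)[THEN D_closed] a(3,4)[THEN D_closed] assms(1)
    have "u \<odot>\<^bsub>M\<^esub> (s \<odot>\<^bsub>M\<^esub> (r \<odot>\<^bsub>M\<^esub> m')) = r \<odot>\<^bsub>M\<^esub> (u \<odot>\<^bsub>M\<^esub> (s \<odot>\<^bsub>M\<^esub> m'))"
      using R a(2) by (simp add: smult_assoc1[symmetric] R.m_ac)
    also have "\<dots> = u \<odot>\<^bsub>M\<^esub> (s' \<odot>\<^bsub>M\<^esub> (r \<odot>\<^bsub>M\<^esub> m))"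
      unfolding u(2) using R a(1) by (simp add: smult_assoc1[symmetric] R.m_ac)
    finally show ?thesis
      by (subst fraction_eq_iff) (use u(1) a R in \<open>simp_all add: bexI\<close>)
  qed
  have "r \<odot>\<^bsub>localization R D M\<^esub> fraction R D M m s =
      (\<Union>(m', s')\<in>fraction R D M m s. fraction R D M (r \<odot>\<^bsub>M\<^esub> m') s')"
    unfolding localization_def by simp
  also have "\<dots> = fraction R D M (r \<odot>\<^bsub>M\<^esub> m) s"
    by (rule UN_constant[OF fraction_self[OF assms(2,3)]], clarify) (rule wd)
  finally show ?thesis .
qed

lemma fraction_zero:
  assumes "s \<in> D"
  shows "fraction R D M \<zero>\<^bsub>M\<^esub> s = \<zero>\<^bsub>localization R D M\<^esub>"
proof -
  have "fraction R D M \<zero>\<^bsub>M\<^esub> s = fraction R D M \<zero>\<^bsub>M\<^esub> \<one>"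
  proof (subst fraction_eq_iff)
    show "\<exists>u\<in>D. u \<odot>\<^bsub>M\<^esub> (\<one> \<odot>\<^bsub>M\<^esub> \<zero>\<^bsub>M\<^esub>) = u \<odot>\<^bsub>M\<^esub> (s \<odot>\<^bsub>M\<^esub> \<zero>\<^bsub>M\<^esub>)"
      by (rule bexI[OF _ one_D]) (use assms D_closed in simp)
  qed (use assms one_D in simp_all)
  then show ?thesis unfolding localization_def by simp
qed

lemma fraction_eq_zero_iff:
  assumes "m \<in> carrier M" "s \<in> D"
  shows "fraction R D M m s = \<zero>\<^bsub>localization R D M\<^esub> \<longleftrightarrow> (\<exists>u\<in>D. u \<odot>\<^bsub>M\<^esub> m = \<zero>\<^bsub>M\<^esub>)"
proof -
  have "fraction R D M m s = \<zero>\<^bsub>localization R D M\<^esub> \<longleftrightarrow> fraction R D M m s = fraction R D M \<zero>\<^bsub>M\<^esub> \<one>"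
    using fraction_zero[OF one_D] by simp
  also have "\<dots> \<longleftrightarrow> (\<exists>u\<in>D. u \<odot>\<^bsub>M\<^esub> (\<one> \<odot>\<^bsub>M\<^esub> m) = u \<odot>\<^bsub>M\<^esub> (s \<odot>\<^bsub>M\<^esub> \<zero>\<^bsub>M\<^esub>))"
    by (rule fraction_eq_iff) (use assms one_D in simp_all)
  also have "\<dots> \<longleftrightarrow> (\<exists>u\<in>D. u \<odot>\<^bsub>M\<^esub> m = \<zero>\<^bsub>M\<^esub>)"
    using assms D_closed by (intro bex_cong) simp_all
  finally show ?thesis .
qed

lemma module_localization: "module R (localization R D M)"
proof (rule moduleI[OF R.is_cring])
  let ?L = "localization R D M"
  have zero: "\<zero>\<^bsub>?L\<^esub> \<in> carrier ?L"
    using fraction_closed[OF M.zero_closed one_D] fraction_zero[OF one_D] by simp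
  show "abelian_group ?L"
  proof (rule abelian_groupI)
    fix U V assume UV: "U \<in> carrier ?L" "V \<in> carrier ?L"
    obtain m n s where mn: "m \<in> carrier M" "n \<in> carrier M" "s \<in> D"
      "U = fraction R D M m s" "V = fraction R D M n s"
      using UV by (rule common_denominator2)
    show "U \<oplus>\<^bsub>?L\<^esub> V \<in> carrier ?L"
      unfolding mn(4,5) fraction_add_common[OF mn(1-3)] using mn(1-3) by (simp add: fraction_closed)
    show "U \<oplus>\<^bsub>?L\<^esub> V = V \<oplus>\<^bsub>?L\<^esub> U"
      unfolding mn(4,5) fraction_add_common[OF mn(1-3)] fraction_add_common[OF mn(2,1,3)]
      using mn(1,2) by (simp add: M.a_comm)
    fix W assume "W \<in> carrier ?L"
    then obtain q t where q: "q \<in> carrier M" "t \<in> D" "W = fraction R D M q t" by (rule localizationE)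
    note R = mn(3)[THEN D_closed] q(2)[THEN D_closed]
    define w where "w = s \<otimes> t"
    have w: "w \<in> D" unfolding w_def by (rule mult_D[OF mn(3) q(2)])
    have U: "U = fraction R D M (t \<odot>\<^bsub>M\<^esub> m) w" unfolding w_def using fraction_expand(2)[OF mn(1,3) q(2)] mn(4) by simp
    have V: "V = fraction R D M (t \<odot>\<^bsub>M\<^esub> n) w" unfolding w_def using fraction_expand(2)[OF mn(2,3) q(2)] mn(5) by simp
    have W: "W = fraction R D M (s \<odot>\<^bsub>M\<^esub> q) w" unfolding w_def using fraction_expand(1)[OF q(1,2) mn(3)] q(3) by simp
    show "U \<oplus>\<^bsub>?L\<^esub> V \<oplus>\<^bsub>?L\<^esub> W = U \<oplus>\<^bsub>?L\<^esub> (V \<oplus>\<^bsub>?L\<^esub> W)"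
      unfolding U V W using mn(1,2) q(1) R w by (simp add: fraction_add_common M.a_assoc)
  next
    show "\<zero>\<^bsub>?L\<^esub> \<in> carrier ?L" by (rule zero)
  next
    fix U assume "U \<in> carrier ?L"
    then obtain m s where m: "m \<in> carrier M" "s \<in> D" "U = fraction R D M m s" by (rule localizationE)
    show "\<zero>\<^bsub>?L\<^esub> \<oplus>\<^bsub>?L\<^esub> U = U"
      unfolding m(3) fraction_zero[OF m(2), symmetric] using m(1,2) by (simp add: fraction_add_common)
    have "fraction R D M (\<ominus>\<^bsub>M\<^esub> m) s \<oplus>\<^bsub>?L\<^esub> U = \<zero>\<^bsub>?L\<^esub>"
      unfolding m(3) fraction_zero[OF m(2), symmetric] using m(1,2) by (simp add: fraction_add_common M.l_neg)
    then show "\<exists>V\<in>carrier ?L. V \<oplus>\<^bsub>?L\<^esub> U = \<zero>\<^bsub>?L\<^esub>"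
      using fraction_closed[of "\<ominus>\<^bsub>M\<^esub> m" s] m by blast
  qed
  fix a b U V assume a: "a \<in> carrier R" and U: "U \<in> carrier ?L"
  obtain m s where m: "m \<in> carrier M" "s \<in> D" "U = fraction R D M m s" using U by (rule localizationE)
  show "a \<odot>\<^bsub>?L\<^esub> U \<in> carrier ?L"
    unfolding m(3) using a m by (simp add: fraction_smult fraction_closed)
  { assume b: "b \<in> carrier R"
    show "(a \<oplus> b) \<odot>\<^bsub>?L\<^esub> U = a \<odot>\<^bsub>?L\<^esub> U \<oplus>\<^bsub>?L\<^esub> b \<odot>\<^bsub>?L\<^esub> U"
      unfolding m(3) using a b m by (simp add: fraction_smult fraction_add_common smult_l_distr)
    show "(a \<otimes> b) \<odot>\<^bsub>?L\<^esub> U = a \<odot>\<^bsub>?L\<^esub> (b \<odot>\<^bsub>?L\<^esub> U)"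
      unfolding m(3) using a b m by (simp add: fraction_smult smult_assoc1) }
  { assume V: "V \<in> carrier ?L"
    obtain m n s where mn: "m \<in> carrier M" "n \<in> carrier M" "s \<in> D"
      "U = fraction R D M m s" "V = fraction R D M n s"
      using U V by (rule common_denominator2)
    show "a \<odot>\<^bsub>?L\<^esub> (U \<oplus>\<^bsub>?L\<^esub> V) = a \<odot>\<^bsub>?L\<^esub> U \<oplus>\<^bsub>?L\<^esub> a \<odot>\<^bsub>?L\<^esub> V"
      unfolding mn(4,5) using a mn(1-3) by (simp add: fraction_smult fraction_add_common smult_r_distr) }
next
  fix U assume "U \<in> carrier (localization R D M)"
  then obtain m s where m: "m \<in> carrier M" "s \<in> D" "U = fraction R D M m s" by (rule localizationE)
  show "\<one> \<odot>\<^bsub>localization R D M\<^esub> U = U" unfolding m(3) using m by (simp add: fraction_smult)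
qed

end

text \<open>Separate maps \<open>h\<close> on numerators and \<open>\<sigma>\<close> on denominators
  allow semilinear maps between modules over different rings. Restriction (both identities),
  Frobenius (both p-th powers) and reduction modulo an ideal are instances, so well-definedness is
  checked once.\<close>

definition frac_map ::
    "('a, 'c) ring_scheme \<Rightarrow> 'a set \<Rightarrow> ('a, 'n, 'd) module_scheme \<Rightarrow> ('m \<Rightarrow> 'n) \<Rightarrow> ('b \<Rightarrow> 'a) \<Rightarrow>
     ('m \<times> 'b) set \<Rightarrow> ('n \<times> 'a) set" where
  "frac_map R D M h \<sigma> U = (\<Union>(m, s)\<in>U. fraction R D M (h m) (\<sigma> s))"

locale frac_hom = A: fractions R M D + B: fractions R' M' D'
  for R :: "('b, 'c) ring_scheme" and M :: "('b, 'm, 'd) module_scheme" and D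
    and R' :: "('a, 'c') ring_scheme" and M' :: "('a, 'n, 'd') module_scheme" and D' +
  fixes h :: "'m \<Rightarrow> 'n" and \<sigma> :: "'b \<Rightarrow> 'a"
  assumes h_closed: "m \<in> carrier M \<Longrightarrow> h m \<in> carrier M'"
    and h_add: "\<lbrakk>m \<in> carrier M; n \<in> carrier M\<rbrakk> \<Longrightarrow> h (m \<oplus>\<^bsub>M\<^esub> n) = h m \<oplus>\<^bsub>M'\<^esub> h n"
    and h_smult: "\<lbrakk>r \<in> carrier R; m \<in> carrier M\<rbrakk> \<Longrightarrow> h (r \<odot>\<^bsub>M\<^esub> m) = \<sigma> r \<odot>\<^bsub>M'\<^esub> h m"
    and \<sigma>_closed: "r \<in> carrier R \<Longrightarrow> \<sigma> r \<in> carrier R'"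
    and \<sigma>_D: "s \<in> D \<Longrightarrow> \<sigma> s \<in> D'"
begin

lemma h_zero: "h \<zero>\<^bsub>M\<^esub> = \<zero>\<^bsub>M'\<^esub>"
proof -
  have "h \<zero>\<^bsub>M\<^esub> \<oplus>\<^bsub>M'\<^esub> h \<zero>\<^bsub>M\<^esub> = h \<zero>\<^bsub>M\<^esub>"
    using h_add[of "\<zero>\<^bsub>M\<^esub>" "\<zero>\<^bsub>M\<^esub>"] by simp
  then show ?thesis
    using h_closed[of "\<zero>\<^bsub>M\<^esub>"] by (metis B.M.add.r_cancel_one' A.M.zero_closed)
qed

lemma frac_map_fraction:
  assumes "m \<in> carrier M" "s \<in> D"
  shows "frac_map R' D' M' h \<sigma> (fraction R D M m s) = fraction R' D' M' (h m) (\<sigma> s)"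
  unfolding frac_map_def
proof (rule UN_constant[OF A.fraction_self[OF assms]], clarify)
  fix m' s' assume "(m', s') \<in> fraction R D M m s"
  note a = A.in_fraction[OF this]
  obtain u where u: "u \<in> D" "u \<odot>\<^bsub>M\<^esub> (s \<odot>\<^bsub>M\<^esub> m') = u \<odot>\<^bsub>M\<^esub> (s' \<odot>\<^bsub>M\<^esub> m)"
    using a(5) A.fraction_eq_iff[OF a(2,1,4,3)] by blast
  note R = u(1)[THEN A.D_closed] a(3,4)[THEN A.D_closed]
  have "h (u \<odot>\<^bsub>M\<^esub> (s \<odot>\<^bsub>M\<^esub> m')) = h (u \<odot>\<^bsub>M\<^esub> (s' \<odot>\<^bsub>M\<^esub> m))" using u(2) by simp
  then have "\<sigma> u \<odot>\<^bsub>M'\<^esub> (\<sigma> s \<odot>\<^bsub>M'\<^esub> h m') = \<sigma> u \<odot>\<^bsub>M'\<^esub> (\<sigma> s' \<odot>\<^bsub>M'\<^esub> h m)"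
    using R a(1,2) by (simp add: h_smult)
  then have "\<exists>u\<in>D'. u \<odot>\<^bsub>M'\<^esub> (\<sigma> s \<odot>\<^bsub>M'\<^esub> h m') = u \<odot>\<^bsub>M'\<^esub> (\<sigma> s' \<odot>\<^bsub>M'\<^esub> h m)"
    using \<sigma>_D[OF u(1)] by blast
  then show "fraction R' D' M' (h m') (\<sigma> s') = fraction R' D' M' (h m) (\<sigma> s)"
    by (subst B.fraction_eq_iff) (use a in \<open>simp_all add: h_closed \<sigma>_D\<close>)
qed

lemma frac_map_closed:
  assumes "U \<in> carrier (localization R D M)"
  shows "frac_map R' D' M' h \<sigma> U \<in> carrier (localization R' D' M')"
proof -
  obtain m s where m: "m \<in> carrier M" "s \<in> D" "U = fraction R D M m s"
    using assms by (rule A.localizationE)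
  show ?thesis unfolding m(3) frac_map_fraction[OF m(1,2)]
    by (rule B.fraction_closed[OF h_closed[OF m(1)] \<sigma>_D[OF m(2)]])
qed

lemma frac_map_add:
  assumes "U \<in> carrier (localization R D M)" "V \<in> carrier (localization R D M)"
  shows "frac_map R' D' M' h \<sigma> (U \<oplus>\<^bsub>localization R D M\<^esub> V) =
    frac_map R' D' M' h \<sigma> U \<oplus>\<^bsub>localization R' D' M'\<^esub> frac_map R' D' M' h \<sigma> V"
proof -
  obtain m n s where m: "m \<in> carrier M" "n \<in> carrier M" "s \<in> D"
    "U = fraction R D M m s" "V = fraction R D M n s"
    using assms by (rule A.common_denominator2)
  show ?thesis unfolding m(4,5)
    using m(1-3) by (simp add: A.fraction_add_common B.fraction_add_common frac_map_fraction h_closed \<sigma>_D h_add)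
qed

lemma frac_map_smult:
  assumes "r \<in> carrier R" "U \<in> carrier (localization R D M)"
  shows "frac_map R' D' M' h \<sigma> (r \<odot>\<^bsub>localization R D M\<^esub> U) =
    \<sigma> r \<odot>\<^bsub>localization R' D' M'\<^esub> frac_map R' D' M' h \<sigma> U"
proof -
  obtain m s where m: "m \<in> carrier M" "s \<in> D" "U = fraction R D M m s"
    using assms(2) by (rule A.localizationE)
  show ?thesis unfolding m(3)
    using m(1,2) assms(1)
    by (simp add: A.fraction_smult B.fraction_smult frac_map_fraction h_closed \<sigma>_D \<sigma>_closed h_smult)
qed

lemma frac_map_zero:
  "frac_map R' D' M' h \<sigma> \<zero>\<^bsub>localization R D M\<^esub> = \<zero>\<^bsub>localization R' D' M'\<^esub>"
  unfolding A.fraction_zero[OF A.one_D, symmetric]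
  using frac_map_fraction[OF A.M.zero_closed A.one_D] h_zero B.fraction_zero[OF \<sigma>_D[OF A.one_D]] by simp

lemma frac_map_surj:
  assumes "h ` carrier M = carrier M'" "\<sigma> ` D = D'" "V \<in> carrier (localization R' D' M')"
  obtains U where "U \<in> carrier (localization R D M)" "V = frac_map R' D' M' h \<sigma> U"
proof -
  obtain m' s' where m': "m' \<in> carrier M'" "s' \<in> D'" "V = fraction R' D' M' m' s'"
    using assms(3) by (rule B.localizationE)
  have "m' \<in> h ` carrier M" "s' \<in> \<sigma> ` D" using m' assms(1,2) by simp_all
  then obtain m s where m: "m \<in> carrier M" "m' = h m" "s \<in> D" "s' = \<sigma> s" by blast
  show thesis
    by (rule that[OF A.fraction_closed[OF m(1,3)]])
      (simp add: m'(3) frac_map_fraction[OF m(1,3)] m)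
qed

end

section \<open>The Cech complex of a module is a complex\<close>

section \<open>The Cech complex as a cochain complex\<close>

text \<open>The cancellation behind d d = 0, freed from index sets. The pairs (j, k) and (k, j) are
  cancelled by induction on \<open>T\<close>, since one cannot argue that the sum equals its
  negative and divide by 2.\<close>

lemma (in abelian_group) antisymmetric_double_sum:
  assumes "finite T"
    and "\<And>j k. \<lbrakk>j \<in> T; k \<in> T\<rbrakk> \<Longrightarrow> g j k \<in> carrier G"
    and "\<And>j k. \<lbrakk>j \<in> T; k \<in> T; j \<noteq> k\<rbrakk> \<Longrightarrow> g j k \<oplus> g k j = \<zero>"
  shows "(\<Oplus>j\<in>T. \<Oplus>k\<in>T - {j}. g j k) = \<zero>"
  using assms
proof (induction T)
  case empty
  show ?case by simp
next
  case (insert a T)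
  have g: "g j k \<in> carrier G" if "j \<in> insert a T" "k \<in> insert a T" for j k
    by (rule insert.prems(1)[OF that])
  have IH: "(\<Oplus>j\<in>T. \<Oplus>k\<in>T - {j}. g j k) = \<zero>"
    by (rule insert.IH) (use insert.prems in blast)+
  have s: "(\<Oplus>k\<in>T - {j}. g j k) \<in> carrier G" if "j \<in> T" for j
    by (rule finsum_closed) (use g that in auto)
  have 1: "(\<Oplus>k\<in>insert a T - {j}. g j k) = g j a \<oplus> (\<Oplus>k\<in>T - {j}. g j k)" if j: "j \<in> T" for j
  proof -
    have "insert a T - {j} = insert a (T - {j})" using j insert.hyps by blast
    then show ?thesis
      using finsum_insert[of "T - {j}" a "g j"] insert.hyps g j by auto
  qed
  have 2: "insert a T - {a} = T" using insert.hyps by blast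
  have "(\<Oplus>j\<in>insert a T. \<Oplus>k\<in>insert a T - {j}. g j k) =
      (\<Oplus>k\<in>T. g a k) \<oplus> (\<Oplus>j\<in>T. \<Oplus>k\<in>insert a T - {j}. g j k)"
    by (subst finsum_insert) (use insert.hyps g 2 in \<open>auto intro!: finsum_closed\<close>)
  also have "(\<Oplus>j\<in>T. \<Oplus>k\<in>insert a T - {j}. g j k) = (\<Oplus>j\<in>T. g j a \<oplus> (\<Oplus>k\<in>T - {j}. g j k))"
    by (rule finsum_cong') (use 1 g s in auto)
  also have "\<dots> = (\<Oplus>j\<in>T. g j a) \<oplus> (\<Oplus>j\<in>T. \<Oplus>k\<in>T - {j}. g j k)"
    by (rule finsum_addf) (use g s in auto)
  also have "\<dots> = (\<Oplus>j\<in>T. g j a)"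
    unfolding IH by (rule r_zero) (use g in \<open>auto intro!: finsum_closed\<close>)
  also have "(\<Oplus>k\<in>T. g a k) \<oplus> (\<Oplus>j\<in>T. g j a) = (\<Oplus>k\<in>T. g a k \<oplus> g k a)"
    by (rule finsum_addf[symmetric]) (use g in auto)
  also have "\<dots> = \<zero>"
  proof (rule add.finprod_one_eqI)
    fix k assume "k \<in> T"
    then show "g a k \<oplus> g k a = \<zero>" using insert.prems(2)[of a k] insert.hyps by auto
  qed
  finally show ?case .
qed

locale cech = module R M for R :: "('a, 'c) ring_scheme" (structure)
    and M :: "('a, 'm, 'd) module_scheme" +
  fixes fs :: "'a list"
  assumes fs_subset: "set fs \<subseteq> carrier R"
begin

abbreviation "D S \<equiv> denominators R fs S"
abbreviation "L S \<equiv> cech_loc R fs M S"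
abbreviation "C i \<equiv> cech_cochains R fs M i"
abbreviation "d i \<equiv> cech_diff R fs M i"
abbreviation "res T \<equiv> cech_restrict R fs M T"

lemma nth_fs: "\<lbrakk>S \<subseteq> {..<length fs}; s \<in> S\<rbrakk> \<Longrightarrow> fs ! s \<in> carrier R"
  using fs_subset by (auto simp: subset_iff)

lemma denominators_closed:
  assumes S: "S \<subseteq> {..<length fs}" and "a \<in> D S" shows "a \<in> carrier R"
proof -
  obtain e where "a = finprod R (\<lambda>s. (fs ! s) [^] (e s :: nat)) S"
    using assms(2) unfolding denominators_def by blast
  then show ?thesis using nth_fs[OF S] by (auto intro!: R.finprod_closed)
qed

lemma denominators_one: "\<one> \<in> D S"
  unfolding denominators_def
  by (rule CollectI, rule exI[of _ "\<lambda>_. 0"]) (simp add: R.finprod_one_eqI)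

lemma denominators_mult:
  assumes S: "S \<subseteq> {..<length fs}" and a: "a \<in> D S" and b: "b \<in> D S"
  shows "a \<otimes> b \<in> D S"
proof -
  obtain e where e: "a = finprod R (\<lambda>s. (fs ! s) [^] (e s :: nat)) S"
    using a unfolding denominators_def by blast
  obtain e' where e': "b = finprod R (\<lambda>s. (fs ! s) [^] (e' s :: nat)) S"
    using b unfolding denominators_def by blast
  have "finprod R (\<lambda>s. (fs ! s) [^] (e s + e' s)) S =
      finprod R (\<lambda>s. (fs ! s) [^] e s \<otimes> (fs ! s) [^] e' s) S"
    by (rule R.finprod_cong') (use nth_fs[OF S] in \<open>auto simp: R.nat_pow_mult\<close>)
  also have "\<dots> = a \<otimes> b"
    unfolding e e' by (rule R.finprod_multf) (use nth_fs[OF S] in auto)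
  finally have eq: "a \<otimes> b = finprod R (\<lambda>s. (fs ! s) [^] (e s + e' s)) S" ..
  show ?thesis unfolding denominators_def
    by (rule CollectI, rule exI[of _ "\<lambda>s. e s + e' s"]) (simp add: eq)
qed

text \<open>Exponents on S are extended by 0 to T. This is why a fraction m/s over S can be read
  unchanged as a fraction over T.\<close>

lemma denominators_mono:
  assumes T: "T \<subseteq> {..<length fs}" and ST: "S \<subseteq> T"
  shows "D S \<subseteq> D T"
proof
  fix a assume "a \<in> D S"
  then obtain e where e: "a = finprod R (\<lambda>s. (fs ! s) [^] (e s :: nat)) S"
    unfolding denominators_def by blast
  have "finite T" by (rule finite_subset[OF T]) simp
  then have "finprod R (\<lambda>s. (fs ! s) [^] (e s)) S
      = finprod R (\<lambda>s. (fs ! s) [^] (if s \<in> S then e s else 0)) T"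
    by (rule R.finprod_mono_neutral_cong_left[OF _ ST]) (use nth_fs[OF T] in auto)
  then show "a \<in> D T"
    unfolding denominators_def e by (intro CollectI exI[of _ "\<lambda>s. if s \<in> S then e s else 0"]) simp
qed

lemma nth_pow_denominator:
  assumes S: "S \<subseteq> {..<length fs}" and k: "k \<in> S"
  shows "(fs ! k) [^] (n::nat) \<in> D S"
proof -
  have "finite S" by (rule finite_subset[OF S]) simp
  then have "finprod R (\<lambda>s. (fs ! s) [^] (if s = k then n else 0)) {k}
      = finprod R (\<lambda>s. (fs ! s) [^] (if s = k then n else 0)) S"
    by (rule R.finprod_mono_neutral_cong_left) (use nth_fs[OF S] k in auto)
  moreover have "finprod R (\<lambda>s. (fs ! s) [^] (if s = k then n else 0)) {k} = (fs ! k) [^] n"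
    using nth_fs[OF S k] R.finprod_insert[of "{}" k "\<lambda>s. (fs ! s) [^] (if s = k then n else 0)"] by simp
  ultimately show ?thesis
    unfolding denominators_def by (intro CollectI exI[of _ "\<lambda>s. if s = k then n else 0"]) simp
qed

text \<open>Separating the power of f_k from the other factors is how statements over an index set
  with k descend to the one without k.\<close>

lemma denominator_split:
  assumes S: "S \<subseteq> {..<length fs}" and k: "k \<in> S" and a: "a \<in> D S"
  obtains n :: nat and b where "b \<in> D (S - {k})" "a = (fs ! k) [^] n \<otimes> b"
proof -
  obtain e where e: "a = finprod R (\<lambda>s. (fs ! s) [^] (e s :: nat)) S"
    using a unfolding denominators_def by blast
  have "finite S" by (rule finite_subset[OF S]) simp
  moreover have "insert k (S - {k}) = S" using k by blast
  ultimately have "a = (fs ! k) [^] e k \<otimes> finprod R (\<lambda>s. (fs ! s) [^] (e s)) (S - {k})"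
    unfolding e using R.finprod_insert[of "S - {k}" k "\<lambda>s. (fs ! s) [^] (e s)"] nth_fs[OF S] k by auto
  then show thesis by (rule that[rotated]) (auto simp: denominators_def)
qed

lemma fractions: "S \<subseteq> {..<length fs} \<Longrightarrow> fractions R M (D S)"
  by (intro fractions.intro module_axioms fractions_axioms.intro)
    (simp_all add: denominators_closed denominators_one denominators_mult)

lemma module_L: "S \<subseteq> {..<length fs} \<Longrightarrow> module R (L S)"
  by (rule fractions.module_localization[OF fractions])

lemma restrict_frac_map: "res T = frac_map R (D T) M (\<lambda>m. m) (\<lambda>s. s)"
  unfolding cech_restrict_def frac_map_def by simp

lemma frac_hom_restrict:
  assumes "T \<subseteq> {..<length fs}" "S \<subseteq> T"
  shows "frac_hom R M (D S) R M (D T) (\<lambda>m. m) (\<lambda>s. s)"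
proof (intro frac_hom.intro frac_hom_axioms.intro)
  show "fractions R M (D S)" "fractions R M (D T)" using fractions assms by auto
qed (use denominators_mono[OF assms] in auto)

lemmas restrict_fraction = frac_hom.frac_map_fraction[OF frac_hom_restrict, folded restrict_frac_map]
  and restrict_closed = frac_hom.frac_map_closed[OF frac_hom_restrict, folded restrict_frac_map]
  and restrict_add = frac_hom.frac_map_add[OF frac_hom_restrict, folded restrict_frac_map]
  and restrict_smult = frac_hom.frac_map_smult[OF frac_hom_restrict, folded restrict_frac_map]
  and restrict_zero = frac_hom.frac_map_zero[OF frac_hom_restrict, folded restrict_frac_map]

lemma restrict_restrict:
  assumes "U \<subseteq> {..<length fs}" "T \<subseteq> U" "S \<subseteq> T" "a \<in> carrier (L S)"
  shows "res U (res T a) = res U a"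
proof -
  have T: "T \<subseteq> {..<length fs}" and SU: "S \<subseteq> U" and S: "S \<subseteq> {..<length fs}" using assms by auto
  obtain m s where m: "m \<in> carrier M" "s \<in> D S" "a = fraction R (D S) M m s"
    using fractions.localizationE[OF fractions[OF S] assms(4)] by blast
  have sT: "s \<in> D T" using denominators_mono[OF T assms(3)] m(2) by blast
  show ?thesis
    unfolding m(3) restrict_fraction[OF T assms(3) m(1,2)] restrict_fraction[OF assms(1) SU m(1,2)]
    by (rule restrict_fraction[OF assms(1,2) m(1) sT])
qed

lemma restrict_finsum:
  assumes T: "T \<subseteq> {..<length fs}" "S \<subseteq> T" and "finite A" "\<And>j. j \<in> A \<Longrightarrow> f j \<in> carrier (L S)"
  shows "res T (\<Oplus>\<^bsub>L S\<^esub>j\<in>A. f j) = (\<Oplus>\<^bsub>L T\<^esub>j\<in>A. res T (f j))"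
proof -
  interpret S: module R "L S" by (rule module_L) (use assms in auto)
  interpret T: module R "L T" by (rule module_L[OF T(1)])
  show ?thesis
    using assms(3,4)
  proof (induction A)
    case empty
    show ?case using restrict_zero[OF T] by simp
  next
    case (insert a A)
    have f: "f \<in> A \<rightarrow> carrier (L S)" "f a \<in> carrier (L S)" using insert.prems by auto
    have "(\<lambda>j. res T (f j)) \<in> A \<rightarrow> carrier (L T)" "res T (f a) \<in> carrier (L T)"
      using insert.prems restrict_closed[OF T] by auto
    then show ?case
      using insert restrict_add[OF T f(2) S.finsum_closed[OF f(1)]] f
      by (simp add: S.finsum_insert T.finsum_insert)
  qed
qed

lemma index_subset: "S \<in> cech_index fs i \<Longrightarrow> S \<subseteq> {..<length fs}"
  unfolding cech_index_def by simp

lemma index_finite: "S \<in> cech_index fs i \<Longrightarrow> finite S"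
  using finite_subset[OF index_subset] by blast

lemma index_remove: "\<lbrakk>T \<in> cech_index fs (Suc i); j \<in> T\<rbrakk> \<Longrightarrow> T - {j} \<in> cech_index fs i"
  using index_finite[of T "Suc i"] unfolding cech_index_def by auto

lemma cochain_iff: "c \<in> carrier (C i) \<longleftrightarrow> c \<in> (\<Pi>\<^sub>E S\<in>cech_index fs i. carrier (L S))"
  unfolding cech_cochains_def by simp

lemma cochain_apply: "\<lbrakk>c \<in> carrier (C i); S \<in> cech_index fs i\<rbrakk> \<Longrightarrow> c S \<in> carrier (L S)"
  unfolding cochain_iff by (rule PiE_mem)

lemma cochainI: "(\<And>S. S \<in> cech_index fs i \<Longrightarrow> f S \<in> carrier (L S)) \<Longrightarrow> restrict f (cech_index fs i) \<in> carrier (C i)"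
  unfolding cochain_iff by (rule restrict_PiE_iff[THEN iffD2]) blast

lemma cochain_ext:
  "\<lbrakk>c \<in> carrier (C i); c' \<in> carrier (C i); \<And>S. S \<in> cech_index fs i \<Longrightarrow> c S = c' S\<rbrakk> \<Longrightarrow> c = c'"
  unfolding cochain_iff by (rule PiE_ext)

lemma add_cochain: "S \<in> cech_index fs i \<Longrightarrow> (c \<oplus>\<^bsub>C i\<^esub> c') S = c S \<oplus>\<^bsub>L S\<^esub> c' S"
  and zero_cochain: "S \<in> cech_index fs i \<Longrightarrow> \<zero>\<^bsub>C i\<^esub> S = \<zero>\<^bsub>L S\<^esub>"
  and smult_cochain: "S \<in> cech_index fs i \<Longrightarrow> (r \<odot>\<^bsub>C i\<^esub> c) S = r \<odot>\<^bsub>L S\<^esub> c S"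
  unfolding cech_cochains_def by simp_all

lemma module_cochains: "module R (C i)"
proof (rule moduleI[OF R.is_cring])
  have L: "module R (L S)" "abelian_group (L S)" if "S \<in> cech_index fs i" for S
    using module_L[OF index_subset[OF that]] module.axioms(2) by blast+
  have eqs: "c \<oplus>\<^bsub>C i\<^esub> c' = (\<lambda>S\<in>cech_index fs i. c S \<oplus>\<^bsub>L S\<^esub> c' S)"
    "r \<odot>\<^bsub>C i\<^esub> c = (\<lambda>S\<in>cech_index fs i. r \<odot>\<^bsub>L S\<^esub> c S)"
    "\<zero>\<^bsub>C i\<^esub> = (\<lambda>S\<in>cech_index fs i. \<zero>\<^bsub>L S\<^esub>)" for c c' r
    by (simp_all add: cech_cochains_def)
  have add: "c \<oplus>\<^bsub>C i\<^esub> c' \<in> carrier (C i)" if c: "c \<in> carrier (C i)" "c' \<in> carrier (C i)" for c c'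
    unfolding eqs
  proof (rule cochainI)
    fix S assume S: "S \<in> cech_index fs i"
    interpret LS: module R "L S" by (rule L(1)[OF S])
    show "c S \<oplus>\<^bsub>L S\<^esub> c' S \<in> carrier (L S)"
      using cochain_apply[OF c(1) S] cochain_apply[OF c(2) S] by simp
  qed
  have smult: "r \<odot>\<^bsub>C i\<^esub> c \<in> carrier (C i)" if "r \<in> carrier R" "c \<in> carrier (C i)" for r c
    unfolding eqs
    by (rule cochainI) (rule module.smult_closed[OF L(1) that(1) cochain_apply[OF that(2)]])
  have zero: "\<zero>\<^bsub>C i\<^esub> \<in> carrier (C i)"
    unfolding eqs
    by (rule cochainI) (rule abelian_monoid.zero_closed[OF abelian_group.axioms(1)[OF L(2)]])
  note comp = add_cochain zero_cochain smult_cochain cochain_apply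
  show "abelian_group (C i)"
  proof (rule abelian_groupI)
    fix c c' c'' assume c: "c \<in> carrier (C i)" "c' \<in> carrier (C i)" "c'' \<in> carrier (C i)"
    show "c \<oplus>\<^bsub>C i\<^esub> c' \<oplus>\<^bsub>C i\<^esub> c'' = c \<oplus>\<^bsub>C i\<^esub> (c' \<oplus>\<^bsub>C i\<^esub> c'')"
    proof (rule cochain_ext)
      fix S assume S: "S \<in> cech_index fs i"
      interpret LS: module R "L S" by (rule L(1)[OF S])
      show "(c \<oplus>\<^bsub>C i\<^esub> c' \<oplus>\<^bsub>C i\<^esub> c'') S = (c \<oplus>\<^bsub>C i\<^esub> (c' \<oplus>\<^bsub>C i\<^esub> c'')) S"
        using c S by (simp add: comp LS.a_assoc)
    qed (use add c in simp_all)
  next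
    fix c c' assume c: "c \<in> carrier (C i)" "c' \<in> carrier (C i)"
    show "c \<oplus>\<^bsub>C i\<^esub> c' = c' \<oplus>\<^bsub>C i\<^esub> c"
    proof (rule cochain_ext)
      fix S assume S: "S \<in> cech_index fs i"
      interpret LS: module R "L S" by (rule L(1)[OF S])
      show "(c \<oplus>\<^bsub>C i\<^esub> c') S = (c' \<oplus>\<^bsub>C i\<^esub> c) S"
        using c S by (simp add: comp LS.a_comm)
    qed (use add c in simp_all)
  next
    fix c assume c: "c \<in> carrier (C i)"
    show "\<zero>\<^bsub>C i\<^esub> \<oplus>\<^bsub>C i\<^esub> c = c"
    proof (rule cochain_ext)
      fix S assume S: "S \<in> cech_index fs i"
      interpret LS: module R "L S" by (rule L(1)[OF S])
      show "(\<zero>\<^bsub>C i\<^esub> \<oplus>\<^bsub>C i\<^esub> c) S = c S"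
        using c S by (simp add: comp)
    qed (use add zero c in simp_all)
    have m: "(\<ominus> \<one>) \<odot>\<^bsub>C i\<^esub> c \<in> carrier (C i)" by (rule smult) (use c in simp_all)
    have "(\<ominus> \<one>) \<odot>\<^bsub>C i\<^esub> c \<oplus>\<^bsub>C i\<^esub> c = \<zero>\<^bsub>C i\<^esub>"
    proof (rule cochain_ext)
      fix S assume S: "S \<in> cech_index fs i"
      interpret LS: module R "L S" by (rule L(1)[OF S])
      show "((\<ominus> \<one>) \<odot>\<^bsub>C i\<^esub> c \<oplus>\<^bsub>C i\<^esub> c) S = \<zero>\<^bsub>C i\<^esub> S"
        using c S by (simp add: comp LS.smult_l_minus LS.l_neg)
    qed (use add zero c m in simp_all)
    then show "\<exists>y\<in>carrier (C i). y \<oplus>\<^bsub>C i\<^esub> c = \<zero>\<^bsub>C i\<^esub>" using m by blast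
  qed (use add zero in simp_all)
  show "r \<odot>\<^bsub>C i\<^esub> c \<in> carrier (C i)" if "r \<in> carrier R" "c \<in> carrier (C i)" for r c
    by (rule smult[OF that])
  show "(r \<oplus> s) \<odot>\<^bsub>C i\<^esub> c = r \<odot>\<^bsub>C i\<^esub> c \<oplus>\<^bsub>C i\<^esub> s \<odot>\<^bsub>C i\<^esub> c"
    if "r \<in> carrier R" "s \<in> carrier R" "c \<in> carrier (C i)" for r s c
  proof (rule cochain_ext)
    fix S assume S: "S \<in> cech_index fs i"
    interpret LS: module R "L S" by (rule L(1)[OF S])
    show "((r \<oplus> s) \<odot>\<^bsub>C i\<^esub> c) S = (r \<odot>\<^bsub>C i\<^esub> c \<oplus>\<^bsub>C i\<^esub> s \<odot>\<^bsub>C i\<^esub> c) S"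
      using that S by (simp add: comp LS.smult_l_distr)
  qed (use that add smult in simp_all)
  show "r \<odot>\<^bsub>C i\<^esub> (c \<oplus>\<^bsub>C i\<^esub> c') = r \<odot>\<^bsub>C i\<^esub> c \<oplus>\<^bsub>C i\<^esub> r \<odot>\<^bsub>C i\<^esub> c'"
    if "r \<in> carrier R" "c \<in> carrier (C i)" "c' \<in> carrier (C i)" for r c c'
  proof (rule cochain_ext)
    fix S assume S: "S \<in> cech_index fs i"
    interpret LS: module R "L S" by (rule L(1)[OF S])
    show "(r \<odot>\<^bsub>C i\<^esub> (c \<oplus>\<^bsub>C i\<^esub> c')) S = (r \<odot>\<^bsub>C i\<^esub> c \<oplus>\<^bsub>C i\<^esub> r \<odot>\<^bsub>C i\<^esub> c') S"
      using that S by (simp add: comp LS.smult_r_distr)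
  qed (use that add smult in simp_all)
  show "(r \<otimes> s) \<odot>\<^bsub>C i\<^esub> c = r \<odot>\<^bsub>C i\<^esub> (s \<odot>\<^bsub>C i\<^esub> c)"
    if "r \<in> carrier R" "s \<in> carrier R" "c \<in> carrier (C i)" for r s c
  proof (rule cochain_ext)
    fix S assume S: "S \<in> cech_index fs i"
    interpret LS: module R "L S" by (rule L(1)[OF S])
    show "((r \<otimes> s) \<odot>\<^bsub>C i\<^esub> c) S = (r \<odot>\<^bsub>C i\<^esub> (s \<odot>\<^bsub>C i\<^esub> c)) S"
      using that S by (simp add: comp LS.smult_assoc1)
  qed (use that smult in simp_all)
  show "\<one> \<odot>\<^bsub>C i\<^esub> c = c" if "c \<in> carrier (C i)" for c
  proof (rule cochain_ext)
    fix S assume S: "S \<in> cech_index fs i"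
    interpret LS: module R "L S" by (rule L(1)[OF S])
    show "(\<one> \<odot>\<^bsub>C i\<^esub> c) S = c S"
      using that S by (simp add: comp)
  qed (use that smult in simp_all)
qed

text \<open>The sign in the Cech differential, as a scalar of R. In place of the case distinction in
  \<open>cech_diff\<close> it lets linearity lemmas treat all terms alike.\<close>

definition sign :: "nat set \<Rightarrow> nat \<Rightarrow> 'a" where
  "sign T j = (if even (card {s \<in> T. s < j}) then \<one> else \<ominus> \<one>)"

lemma sign_closed [simp]: "sign T j \<in> carrier R"
  unfolding sign_def by simp

lemma sign_square [simp]: "sign T j \<otimes> sign T j = \<one>"
  unfolding sign_def by (simp add: R.l_minus)

text \<open>Of two indices, removing the smaller one lowers the position of the larger by one,
  whereas removing the larger leaves the position of the smaller unchanged. So exactly one of the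
  four signs is altered.\<close>

lemma sign_swap:
  assumes T: "finite T" and jk: "j \<in> T" "k \<in> T" "j \<noteq> k"
  shows "sign T j \<otimes> sign (T - {j}) k = \<ominus> (sign T k \<otimes> sign (T - {k}) j)"
proof -
  have *: "sign T j \<otimes> sign (T - {j}) k = \<ominus> (sign T k \<otimes> sign (T - {k}) j)"
    if "j \<in> T" "k \<in> T" "j < k" for j k
  proof -
    have "{s \<in> T. s < k} = insert j {s \<in> T - {j}. s < k}" using that by auto
    moreover have "finite {s \<in> T - {j}. s < k}" using T by simp
    ultimately have "card {s \<in> T. s < k} = Suc (card {s \<in> T - {j}. s < k})" by simp
    moreover have "{s \<in> T - {k}. s < j} = {s \<in> T. s < j}" using that by auto
    ultimately show ?thesis unfolding sign_def by (simp add: R.l_minus R.r_minus)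
  qed
  show ?thesis
  proof (cases "j < k")
    case True
    then show ?thesis using * jk by blast
  next
    case False
    then have "k < j" using jk(3) by simp
    then show ?thesis using *[OF jk(2,1)] by simp
  qed
qed

lemma diff_apply:
  assumes c: "c \<in> carrier (C i)" and T: "T \<in> cech_index fs (Suc i)"
  shows "d i c T = (\<Oplus>\<^bsub>L T\<^esub>j\<in>T. sign T j \<odot>\<^bsub>L T\<^esub> res T (c (T - {j})))"
proof -
  interpret LT: module R "L T" by (rule module_L[OF index_subset[OF T]])
  have r: "res T (c (T - {j})) \<in> carrier (L T)" if "j \<in> T" for j
    by (rule restrict_closed[OF index_subset[OF T] _ cochain_apply[OF c index_remove[OF T that]]]) blast
  show ?thesis
    unfolding cech_diff_def restrict_apply'[OF T]
    by (rule LT.finsum_cong') (auto simp: sign_def LT.smult_l_minus r Let_def)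
qed

lemma diff_term_closed:
  assumes "c \<in> carrier (C i)" "T \<in> cech_index fs (Suc i)" "j \<in> T"
  shows "res T (c (T - {j})) \<in> carrier (L T)"
  by (rule restrict_closed[OF index_subset[OF assms(2)] _ cochain_apply[OF assms(1) index_remove[OF assms(2,3)]]]) blast

lemma diff_closed:
  assumes c: "c \<in> carrier (C i)" shows "d i c \<in> carrier (C (Suc i))"
proof -
  have "d i c = (\<lambda>T\<in>cech_index fs (Suc i). d i c T)"
    unfolding cech_diff_def by (simp add: restrict_def fun_eq_iff)
  moreover have "d i c T \<in> carrier (L T)" if T: "T \<in> cech_index fs (Suc i)" for T
  proof -
    interpret LT: module R "L T" by (rule module_L[OF index_subset[OF T]])
    show ?thesis unfolding diff_apply[OF c T]
    proof (rule LT.finsum_closed, rule Pi_I)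
      fix j assume j: "j \<in> T"
      show "sign T j \<odot>\<^bsub>L T\<^esub> res T (c (T - {j})) \<in> carrier (L T)"
        using diff_term_closed[OF c T j] by simp
    qed
  qed
  ultimately show ?thesis using cochainI[of "Suc i" "d i c"] by simp
qed

lemma diff_add:
  assumes c: "c \<in> carrier (C i)" "c' \<in> carrier (C i)"
  shows "d i (c \<oplus>\<^bsub>C i\<^esub> c') = d i c \<oplus>\<^bsub>C (Suc i)\<^esub> d i c'"
proof -
  interpret Ci: module R "C i" by (rule module_cochains)
  interpret CS: module R "C (Suc i)" by (rule module_cochains)
  have s: "c \<oplus>\<^bsub>C i\<^esub> c' \<in> carrier (C i)" using c by simp
  show ?thesis
  proof (rule cochain_ext)
    show "d i (c \<oplus>\<^bsub>C i\<^esub> c') \<in> carrier (C (Suc i))" by (rule diff_closed[OF s])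
    show "d i c \<oplus>\<^bsub>C (Suc i)\<^esub> d i c' \<in> carrier (C (Suc i))"
      using diff_closed[OF c(1)] diff_closed[OF c(2)] by simp
    fix T assume T: "T \<in> cech_index fs (Suc i)"
    interpret LT: module R "L T" by (rule module_L[OF index_subset[OF T]])
    have t: "(\<lambda>j. sign T j \<odot>\<^bsub>L T\<^esub> res T (c (T - {j}))) \<in> T \<rightarrow> carrier (L T)"
      "(\<lambda>j. sign T j \<odot>\<^bsub>L T\<^esub> res T (c' (T - {j}))) \<in> T \<rightarrow> carrier (L T)"
      using diff_term_closed[OF c(1) T] diff_term_closed[OF c(2) T] by simp_all
    have "d i (c \<oplus>\<^bsub>C i\<^esub> c') T = (\<Oplus>\<^bsub>L T\<^esub>j\<in>T. sign T j \<odot>\<^bsub>L T\<^esub> res T (c (T - {j}))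
        \<oplus>\<^bsub>L T\<^esub> sign T j \<odot>\<^bsub>L T\<^esub> res T (c' (T - {j})))"
      unfolding diff_apply[OF s T]
    proof (rule LT.finsum_cong')
      fix j assume j: "j \<in> T"
      have "res T ((c \<oplus>\<^bsub>C i\<^esub> c') (T - {j})) = res T (c (T - {j})) \<oplus>\<^bsub>L T\<^esub> res T (c' (T - {j}))"
        unfolding add_cochain[OF index_remove[OF T j]]
        by (rule restrict_add[OF index_subset[OF T]])
          (use cochain_apply[OF c(1) index_remove[OF T j]] cochain_apply[OF c(2) index_remove[OF T j]] in auto)
      then show "sign T j \<odot>\<^bsub>L T\<^esub> res T ((c \<oplus>\<^bsub>C i\<^esub> c') (T - {j})) =
          sign T j \<odot>\<^bsub>L T\<^esub> res T (c (T - {j})) \<oplus>\<^bsub>L T\<^esub> sign T j \<odot>\<^bsub>L T\<^esub> res T (c' (T - {j}))"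
        using diff_term_closed[OF c(1) T j] diff_term_closed[OF c(2) T j] by (simp add: LT.smult_r_distr)
    qed (use diff_term_closed[OF c(1) T] diff_term_closed[OF c(2) T] in simp_all)
    also have "\<dots> = d i c T \<oplus>\<^bsub>L T\<^esub> d i c' T"
      unfolding diff_apply[OF c(1) T] diff_apply[OF c(2) T] by (rule LT.finsum_addf[OF t])
    finally show "d i (c \<oplus>\<^bsub>C i\<^esub> c') T = (d i c \<oplus>\<^bsub>C (Suc i)\<^esub> d i c') T"
      unfolding add_cochain[OF T] .
  qed
qed

lemma diff_smult:
  assumes r: "r \<in> carrier R" and c: "c \<in> carrier (C i)"
  shows "d i (r \<odot>\<^bsub>C i\<^esub> c) = r \<odot>\<^bsub>C (Suc i)\<^esub> d i c"
proof -
  interpret Ci: module R "C i" by (rule module_cochains)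
  interpret CS: module R "C (Suc i)" by (rule module_cochains)
  have s: "r \<odot>\<^bsub>C i\<^esub> c \<in> carrier (C i)" using r c by simp
  show ?thesis
  proof (rule cochain_ext)
    show "d i (r \<odot>\<^bsub>C i\<^esub> c) \<in> carrier (C (Suc i))" by (rule diff_closed[OF s])
    show "r \<odot>\<^bsub>C (Suc i)\<^esub> d i c \<in> carrier (C (Suc i))" using diff_closed[OF c] r by simp
    fix T assume T: "T \<in> cech_index fs (Suc i)"
    interpret LT: module R "L T" by (rule module_L[OF index_subset[OF T]])
    have t: "(\<lambda>j. sign T j \<odot>\<^bsub>L T\<^esub> res T (c (T - {j}))) \<in> T \<rightarrow> carrier (L T)"
      using diff_term_closed[OF c(1) T] by simp
    have "d i (r \<odot>\<^bsub>C i\<^esub> c) T = (\<Oplus>\<^bsub>L T\<^esub>j\<in>T. r \<odot>\<^bsub>L T\<^esub> (sign T j \<odot>\<^bsub>L T\<^esub> res T (c (T - {j}))))"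
      unfolding diff_apply[OF s T]
    proof (rule LT.finsum_cong')
      fix j assume j: "j \<in> T"
      have "res T ((r \<odot>\<^bsub>C i\<^esub> c) (T - {j})) = r \<odot>\<^bsub>L T\<^esub> res T (c (T - {j}))"
        unfolding smult_cochain[OF index_remove[OF T j]]
        by (rule restrict_smult[OF index_subset[OF T] _ r cochain_apply[OF c index_remove[OF T j]]]) blast
      then show "sign T j \<odot>\<^bsub>L T\<^esub> res T ((r \<odot>\<^bsub>C i\<^esub> c) (T - {j})) =
          r \<odot>\<^bsub>L T\<^esub> (sign T j \<odot>\<^bsub>L T\<^esub> res T (c (T - {j})))"
        using diff_term_closed[OF c T j] r by (simp add: LT.smult_comm)
    qed (use diff_term_closed[OF c T] r in simp_all)
    also have "\<dots> = r \<odot>\<^bsub>L T\<^esub> d i c T"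
      unfolding diff_apply[OF c T] by (rule LT.finsum_smult_ldistr[symmetric, OF index_finite[OF T] r t])
    finally show "d i (r \<odot>\<^bsub>C i\<^esub> c) T = (r \<odot>\<^bsub>C (Suc i)\<^esub> d i c) T"
      unfolding smult_cochain[OF T] .
  qed
qed

lemma restrict_diff:
  assumes c: "c \<in> carrier (C i)" and S: "S \<in> cech_index fs (Suc i)"
    and T: "T \<subseteq> {..<length fs}" "S \<subseteq> T"
  shows "res T (d i c S) = (\<Oplus>\<^bsub>L T\<^esub>k\<in>S. sign S k \<odot>\<^bsub>L T\<^esub> res T (c (S - {k})))"
proof -
  interpret LS: module R "L S" by (rule module_L[OF index_subset[OF S]])
  interpret LT: module R "L T" by (rule module_L[OF T(1)])
  have rr: "res T (res S (c (S - {k}))) = res T (c (S - {k}))" if "k \<in> S" for k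
    by (rule restrict_restrict[OF T _ cochain_apply[OF c index_remove[OF S that]]]) blast
  have rc: "res T (c (S - {k})) \<in> carrier (L T)" if "k \<in> S" for k
    by (rule restrict_closed[OF T(1) _ cochain_apply[OF c index_remove[OF S that]]]) (use T in blast)
  have "res T (d i c S) = (\<Oplus>\<^bsub>L T\<^esub>k\<in>S. res T (sign S k \<odot>\<^bsub>L S\<^esub> res S (c (S - {k}))))"
    unfolding diff_apply[OF c S]
    by (rule restrict_finsum[OF T index_finite[OF S]]) (use diff_term_closed[OF c S] in simp)
  also have "\<dots> = (\<Oplus>\<^bsub>L T\<^esub>k\<in>S. sign S k \<odot>\<^bsub>L T\<^esub> res T (c (S - {k})))"
  proof (rule LT.finsum_cong')
    fix k assume k: "k \<in> S"
    show "res T (sign S k \<odot>\<^bsub>L S\<^esub> res S (c (S - {k}))) = sign S k \<odot>\<^bsub>L T\<^esub> res T (c (S - {k}))"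
      using restrict_smult[OF T sign_closed diff_term_closed[OF c S k]] rr[OF k] by simp
  qed (use rc in simp_all)
  finally show ?thesis .
qed

lemma diff_diff:
  assumes c: "c \<in> carrier (C i)"
  shows "d (Suc i) (d i c) = \<zero>\<^bsub>C (Suc (Suc i))\<^esub>"
proof -
  interpret CS: module R "C (Suc (Suc i))" by (rule module_cochains)
  show ?thesis
  proof (rule cochain_ext)
    show "d (Suc i) (d i c) \<in> carrier (C (Suc (Suc i)))" by (rule diff_closed[OF diff_closed[OF c]])
    show "\<zero>\<^bsub>C (Suc (Suc i))\<^esub> \<in> carrier (C (Suc (Suc i)))" by simp
    fix T assume T: "T \<in> cech_index fs (Suc (Suc i))"
    interpret LT: module R "L T" by (rule module_L[OF index_subset[OF T]])
    define g where "g j k = (sign T j \<otimes> sign (T - {j}) k) \<odot>\<^bsub>L T\<^esub> res T (c (T - {j} - {k}))" for j k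
    \<comment> \<open>On the diagonal, T - {j} - {j} has one element too many to be an index of
      \<open>c\<close>, so \<open>g j j\<close> involves a meaningless value. \<open>G\<close> puts
      zero there, which is closed and does not enter the double sum.\<close>
    define G where "G j k = (if j = k then \<zero>\<^bsub>L T\<^esub> else g j k)" for j k
    have rc: "res T (c (T - {j} - {k})) \<in> carrier (L T)" if "j \<in> T" "k \<in> T" "j \<noteq> k" for j k
      by (rule restrict_closed[OF index_subset[OF T] _
            cochain_apply[OF c index_remove[OF index_remove[OF T that(1)]]]]) (use that in auto)
    have G: "G j k \<in> carrier (L T)" if "j \<in> T" "k \<in> T" for j k
      unfolding G_def g_def using rc that by simp
    have "d (Suc i) (d i c) T = (\<Oplus>\<^bsub>L T\<^esub>j\<in>T. \<Oplus>\<^bsub>L T\<^esub>k\<in>T - {j}. G j k)"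
      unfolding diff_apply[OF diff_closed[OF c] T]
    proof (rule LT.finsum_cong')
      show "(\<lambda>j. \<Oplus>\<^bsub>L T\<^esub>k\<in>T - {j}. G j k) \<in> T \<rightarrow> carrier (L T)"
        using G by (auto intro!: LT.finsum_closed)
      fix j assume j: "j \<in> T"
      note Tj = index_remove[OF T j]
      have rc': "(\<lambda>k. sign (T - {j}) k \<odot>\<^bsub>L T\<^esub> res T (c (T - {j} - {k}))) \<in> T - {j} \<rightarrow> carrier (L T)"
        using rc[OF j] by auto
      have "sign T j \<odot>\<^bsub>L T\<^esub> res T (d i c (T - {j})) =
          sign T j \<odot>\<^bsub>L T\<^esub> (\<Oplus>\<^bsub>L T\<^esub>k\<in>T - {j}. sign (T - {j}) k \<odot>\<^bsub>L T\<^esub> res T (c (T - {j} - {k})))"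
        using restrict_diff[OF c Tj index_subset[OF T]] by auto
      also have "\<dots> = (\<Oplus>\<^bsub>L T\<^esub>k\<in>T - {j}. sign T j \<odot>\<^bsub>L T\<^esub> (sign (T - {j}) k \<odot>\<^bsub>L T\<^esub> res T (c (T - {j} - {k}))))"
        by (rule LT.finsum_smult_ldistr[OF index_finite[OF Tj] sign_closed rc'])
      also have "\<dots> = (\<Oplus>\<^bsub>L T\<^esub>k\<in>T - {j}. G j k)"
      proof (rule LT.finsum_cong')
        fix k assume k: "k \<in> T - {j}"
        show "sign T j \<odot>\<^bsub>L T\<^esub> (sign (T - {j}) k \<odot>\<^bsub>L T\<^esub> res T (c (T - {j} - {k}))) = G j k"
          unfolding G_def g_def using rc[OF j, of k] k by (auto simp: LT.smult_assoc1)
      qed (use G j in auto)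
      finally show "sign T j \<odot>\<^bsub>L T\<^esub> res T (d i c (T - {j})) = (\<Oplus>\<^bsub>L T\<^esub>k\<in>T - {j}. G j k)" .
    qed simp
    also have "\<dots> = \<zero>\<^bsub>L T\<^esub>"
    proof (rule LT.antisymmetric_double_sum[OF index_finite[OF T] G])
      fix j k assume jk: "j \<in> T" "k \<in> T" "j \<noteq> k"
      have "T - {j} - {k} = T - {k} - {j}" by blast
      then have "G j k = \<ominus>\<^bsub>L T\<^esub> G k j"
        unfolding G_def g_def sign_swap[OF index_finite[OF T] jk]
        using rc[OF jk] jk by (simp add: LT.smult_l_minus)
      then show "G j k \<oplus>\<^bsub>L T\<^esub> G k j = \<zero>\<^bsub>L T\<^esub>" using G[OF jk(2,1)] by (simp add: LT.l_neg)
    qed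
    finally show "d (Suc i) (d i c) T = \<zero>\<^bsub>C (Suc (Suc i))\<^esub> T"
      unfolding zero_cochain[OF T] .
  qed
qed

sublocale cochain_complex R "cech_cochains R fs M" "cech_diff R fs M"
  by (intro cochain_complex.intro cochain_complex_axioms.intro R.is_cring module_cochains
      diff_closed diff_add diff_smult diff_diff)

lemma coboundaries_eq: "coboundaries i = cech_coboundaries R fs M i"
  by (cases i) simp_all

end

section \<open>Extended ideals in the Cech complex of the ring and the homotopy after inverting
  f_k\<close>

section \<open>The Cech complex of the ring\<close>

text \<open>Clearing denominators yields one exponent for each index set; as there are finitely
  many, the maximum works for all.\<close>

lemma uniform_exponent:
  assumes "finite A" "\<And>T. T \<in> A \<Longrightarrow> \<exists>n::nat. P n T"
    and mono: "\<And>T m n. \<lbrakk>T \<in> A; P m T; m \<le> n\<rbrakk> \<Longrightarrow> P n T"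
  shows "\<exists>n. \<forall>T\<in>A. P n T"
proof -
  obtain f where f: "\<And>T. T \<in> A \<Longrightarrow> P (f T) T" using assms(2) by metis
  have "f T \<le> Max (insert 0 (f ` A))" if "T \<in> A" for T
    using assms(1) that by (intro Max_ge) auto
  then show ?thesis using mono f by metis
qed

locale ring_cech = cech R "ring_as_module R" fs
  for R :: "('a, 'c) ring_scheme" (structure) and fs
begin

text \<open>The ideal generated by I in the localization at S. It is the kernel of the map to the
  localization of R/I.\<close>

definition extension :: "'a set \<Rightarrow> nat set \<Rightarrow> ('a \<times> 'a) set set" where
  "extension I S = {fraction R (D S) (ring_as_module R) a s | a s. a \<in> I \<and> s \<in> D S}"

text \<open>Membership does not force the given numerator into I, since another representative may
  be the one with numerator in I. Comparing the two costs a factor from \<open>D S\<close>.\<close>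

lemma fraction_extension_iff:
  assumes S: "S \<subseteq> {..<length fs}" and I: "ideal I R" and m: "m \<in> carrier R" "s \<in> D S"
  shows "fraction R (D S) (ring_as_module R) m s \<in> extension I S \<longleftrightarrow> (\<exists>u\<in>D S. u \<otimes> m \<in> I)"
proof
  interpret F: fractions R "ring_as_module R" "D S" by (rule fractions[OF S])
  interpret I: ideal I R by (rule I)
  note Dc = denominators_closed[OF S]
  {
    assume "fraction R (D S) (ring_as_module R) m s \<in> extension I S"
    then obtain a t where a: "a \<in> I" "t \<in> D S"
      "fraction R (D S) (ring_as_module R) m s = fraction R (D S) (ring_as_module R) a t"
      unfolding extension_def by blast
    have aR: "a \<in> carrier R" using a(1) I.a_subset by blast
    obtain u where u: "u \<in> D S" "u \<otimes> (t \<otimes> m) = u \<otimes> (s \<otimes> a)"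
      using a(3) F.fraction_eq_iff[of m a s t] m aR a(2) by auto
    have "u \<otimes> t \<otimes> m = u \<otimes> s \<otimes> a"
      using u(2) Dc[OF u(1)] Dc[OF a(2)] Dc[OF m(2)] m(1) aR by (simp add: R.m_assoc)
    moreover have "u \<otimes> s \<otimes> a \<in> I"
      by (rule I.I_l_closed[OF a(1)]) (simp add: Dc u(1) m(2))
    ultimately show "\<exists>u\<in>D S. u \<otimes> m \<in> I" using F.mult_D[OF u(1) a(2)] by (metis (no_types))
  next
    assume "\<exists>u\<in>D S. u \<otimes> m \<in> I"
    then obtain u where u: "u \<in> D S" "u \<otimes> m \<in> I" by blast
    have "fraction R (D S) (ring_as_module R) m s = fraction R (D S) (ring_as_module R) (u \<otimes> m) (u \<otimes> s)"
      using F.fraction_expand(1)[of m s u] m u(1) by simp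
    then show "fraction R (D S) (ring_as_module R) m s \<in> extension I S"
      unfolding extension_def using u(2) F.mult_D[OF u(1) m(2)] by blast
  }
qed

lemma LE:
  assumes S: "S \<subseteq> {..<length fs}" and U: "U \<in> carrier (L S)"
  obtains m s where "m \<in> carrier R" "s \<in> D S" "U = fraction R (D S) (ring_as_module R) m s"
  using fractions.localizationE[OF fractions[OF S] U] by auto

lemma L_smult:
  assumes S: "S \<subseteq> {..<length fs}" and "r \<in> carrier R" "m \<in> carrier R" "s \<in> D S"
  shows "r \<odot>\<^bsub>L S\<^esub> fraction R (D S) (ring_as_module R) m s = fraction R (D S) (ring_as_module R) (r \<otimes> m) s"
  using fractions.fraction_smult[OF fractions[OF S]] assms by simp

lemma submodule_extension:
  assumes S: "S \<subseteq> {..<length fs}" and I: "ideal I R"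
  shows "submodule (extension I S) R (L S)"
proof -
  interpret F: fractions R "ring_as_module R" "D S" by (rule fractions[OF S])
  interpret LS: module R "L S" by (rule module_L[OF S])
  interpret I: ideal I R by (rule I)
  note sub = subsetD[OF I.a_subset]
  note Dc = denominators_closed[OF S]
  have smult: "r \<odot>\<^bsub>L S\<^esub> U \<in> extension I S" if r: "r \<in> carrier R" and U: "U \<in> extension I S" for r U
  proof -
    obtain a s where a: "a \<in> I" "s \<in> D S" "U = fraction R (D S) (ring_as_module R) a s"
      using U unfolding extension_def by blast
    show ?thesis
      unfolding a(3) L_smult[OF S r sub[OF a(1)] a(2)] extension_def
      using I.I_l_closed[OF a(1) r] a(2) by blast
  qed
  have car: "extension I S \<subseteq> carrier (L S)"
    unfolding extension_def using F.fraction_closed sub by auto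
  show ?thesis
  proof (rule LS.submoduleI)
    show "extension I S \<subseteq> carrier (L S)" by (rule car)
    show "\<zero>\<^bsub>L S\<^esub> \<in> extension I S"
      using F.fraction_zero[OF F.one_D, symmetric] I.zero_closed F.one_D
      unfolding extension_def by (intro CollectI exI[of _ "\<zero>"] exI[of _ "\<one>"]) simp
    show "\<ominus>\<^bsub>L S\<^esub> U \<in> extension I S" if "U \<in> extension I S" for U
      using smult[of "\<ominus> \<one>" U] that car LS.smult_l_minus[of \<one> U] by auto
    show "U \<oplus>\<^bsub>L S\<^esub> V \<in> extension I S" if U: "U \<in> extension I S" and V: "V \<in> extension I S" for U V
    proof -
      obtain a s where a: "a \<in> I" "s \<in> D S" "U = fraction R (D S) (ring_as_module R) a s"
        using U unfolding extension_def by blast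
      obtain b t where b: "b \<in> I" "t \<in> D S" "V = fraction R (D S) (ring_as_module R) b t"
        using V unfolding extension_def by blast
      have "U \<oplus>\<^bsub>L S\<^esub> V = fraction R (D S) (ring_as_module R) (t \<otimes> a \<oplus> s \<otimes> b) (s \<otimes> t)"
        unfolding a(3) b(3) using F.fraction_add[of a b s t] sub a b by simp
      moreover have "t \<otimes> a \<oplus> s \<otimes> b \<in> I"
        by (rule I.a_closed) (use I.I_l_closed Dc a b in simp_all)
      ultimately show ?thesis
        unfolding extension_def using F.mult_D[OF a(2) b(2)] by blast
    qed
  qed (rule smult)
qed

lemma extension_restrict:
  assumes T: "T \<subseteq> {..<length fs}" "S \<subseteq> T" and I: "ideal I R" and U: "U \<in> extension I S"
  shows "res T U \<in> extension I T"
proof -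
  interpret I: ideal I R by (rule I)
  obtain a s where a: "a \<in> I" "s \<in> D S" "U = fraction R (D S) (ring_as_module R) a s"
    using U unfolding extension_def by blast
  have aR: "a \<in> carrier (ring_as_module R)" using a(1) I.a_subset by auto
  show ?thesis
    unfolding a(3) restrict_fraction[OF T aR a(2)] extension_def
    using a(1,2) denominators_mono[OF T] by blast
qed

lemma extension_smult:
  assumes S: "S \<subseteq> {..<length fs}" and I: "ideal I R" and r: "r \<in> I" and U: "U \<in> carrier (L S)"
  shows "r \<odot>\<^bsub>L S\<^esub> U \<in> extension I S"
proof -
  interpret I: ideal I R by (rule I)
  obtain m s where m: "m \<in> carrier R" "s \<in> D S" "U = fraction R (D S) (ring_as_module R) m s"
    using LE[OF S U] by blast
  have rR: "r \<in> carrier R" using r I.a_subset by blast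
  show ?thesis
    unfolding m(3) L_smult[OF S rR m(1,2)] extension_def using I.I_r_closed[OF r m(1)] m(2) by blast
qed

text \<open>Localization commutes with the colon by one element: an extra factor u commutes with a,
  so clearing denominators gives the same condition on both sides. This is the form in which
  flatness is used.\<close>

lemma extension_quotient:
  assumes S: "S \<subseteq> {..<length fs}" and I: "ideal I R" and a: "a \<in> carrier R" and U: "U \<in> carrier (L S)"
  shows "a \<odot>\<^bsub>L S\<^esub> U \<in> extension I S \<longleftrightarrow> U \<in> extension (ideal_quotient I a) S"
proof -
  obtain m s where m: "m \<in> carrier R" "s \<in> D S" "U = fraction R (D S) (ring_as_module R) m s"
    using LE[OF S U] by blast
  have am: "a \<otimes> m \<in> carrier R" using a m(1) by simp
  have "(\<exists>u\<in>D S. u \<otimes> (a \<otimes> m) \<in> I) \<longleftrightarrow> (\<exists>u\<in>D S. u \<otimes> m \<in> ideal_quotient I a)"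
  proof (rule bex_cong[OF refl])
    fix u assume "u \<in> D S"
    then have u: "u \<in> carrier R" by (rule denominators_closed[OF S])
    show "(u \<otimes> (a \<otimes> m) \<in> I) = (u \<otimes> m \<in> ideal_quotient I a)"
      unfolding ideal_quotient_def using u a m(1) R.m_lcomm[of a u m] by simp
  qed
  then show ?thesis
    unfolding m(3) L_smult[OF S a m(1,2)] fraction_extension_iff[OF S I am m(2)]
      fraction_extension_iff[OF S ideal_quotient_ideal(1)[OF I a] m(1,2)] .
qed

lemma extension_adjoin:
  assumes S: "S \<subseteq> {..<length fs}" and I: "ideal I R" and a: "a \<in> carrier R"
    and U: "U \<in> extension (I <+>\<^bsub>R\<^esub> PIdl a) S"
  shows "\<exists>V\<in>extension I S. \<exists>W\<in>carrier (L S). U = V \<oplus>\<^bsub>L S\<^esub> a \<odot>\<^bsub>L S\<^esub> W"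
proof -
  interpret F: fractions R "ring_as_module R" "D S" by (rule fractions[OF S])
  interpret I: ideal I R by (rule I)
  obtain m s where m: "m \<in> I <+>\<^bsub>R\<^esub> PIdl a" "s \<in> D S" "U = fraction R (D S) (ring_as_module R) m s"
    using U unfolding extension_def by blast
  obtain b r where b: "b \<in> I" "r \<in> carrier R" "m = b \<oplus> r \<otimes> a"
    using m(1) unfolding set_add_def' cgenideal_def by blast
  have bR: "b \<in> carrier R" using b(1) I.a_subset by blast
  let ?V = "fraction R (D S) (ring_as_module R) b s"
  let ?W = "fraction R (D S) (ring_as_module R) r s"
  have "U = ?V \<oplus>\<^bsub>L S\<^esub> a \<odot>\<^bsub>L S\<^esub> ?W"
    unfolding m(3) b(3) L_smult[OF S a b(2) m(2)]
    using F.fraction_add_common[of b "a \<otimes> r" s] bR a b(2) m(2) by (simp add: R.m_comm)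
  moreover have "?V \<in> extension I S" unfolding extension_def using b(1) m(2) by blast
  moreover have "?W \<in> carrier (L S)" by (rule F.fraction_closed) (use b(2) m(2) in simp_all)
  ultimately show ?thesis by blast
qed

lemma extension_top:
  assumes S: "S \<subseteq> {..<length fs}" and I: "ideal I R" and k: "k \<in> S" "fs ! k \<in> I"
    and U: "U \<in> carrier (L S)"
  shows "U \<in> extension I S"
proof -
  interpret I: ideal I R by (rule I)
  obtain m s where m: "m \<in> carrier R" "s \<in> D S" "U = fraction R (D S) (ring_as_module R) m s"
    using LE[OF S U] by blast
  have "fs ! k \<in> D S" using nth_pow_denominator[OF S k(1), of 1] nth_fs[OF S k(1)] by simp
  moreover have "fs ! k \<otimes> m \<in> I" by (rule I.I_r_closed[OF k(2) m(1)])
  ultimately show ?thesis unfolding m(3) using fraction_extension_iff[OF S I m(1,2)] by blast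
qed

text \<open>The submodule I C^i, which is the kernel of the reduction to the Cech complex of R/I.
  Through it the cohomology of R/I is handled inside the complex of R.\<close>

definition extended :: "'a set \<Rightarrow> nat \<Rightarrow> (nat set \<Rightarrow> ('a \<times> 'a) set) set" where
  "extended I i = {c \<in> carrier (C i). \<forall>S\<in>cech_index fs i. c S \<in> extension I S}"

lemma submodule_extended:
  assumes I: "ideal I R" shows "submodule (extended I i) R (C i)"
proof -
  have sub: "submodule (extension I S) R (L S)" "module R (L S)" if "S \<in> cech_index fs i" for S
    using submodule_extension[OF index_subset[OF that] I] module_L[OF index_subset[OF that]] .
  have smult: "r \<odot>\<^bsub>C i\<^esub> c \<in> extended I i" if "r \<in> carrier R" "c \<in> extended I i" for r c
    using that module.submoduleE(4)[OF sub(2) sub(1)] unfolding extended_def by (simp add: smult_cochain)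
  show ?thesis
  proof (rule K.submoduleI)
    show "extended I i \<subseteq> carrier (C i)" unfolding extended_def by blast
    show "\<zero>\<^bsub>C i\<^esub> \<in> extended I i"
      unfolding extended_def using module.submodule_zero[OF sub(2) sub(1)] by (simp add: zero_cochain)
    show "\<ominus>\<^bsub>C i\<^esub> c \<in> extended I i" if "c \<in> extended I i" for c
    proof -
      have cc: "c \<in> carrier (C i)" using that unfolding extended_def by blast
      show ?thesis using smult[of "\<ominus> \<one>" c] that K.smult_l_minus[OF R.one_closed cc] cc by simp
    qed
    show "c \<oplus>\<^bsub>C i\<^esub> c' \<in> extended I i" if "c \<in> extended I i" "c' \<in> extended I i" for c c'
      using that module.submoduleE(5)[OF sub(2) sub(1)] unfolding extended_def by (simp add: add_cochain)
  qed (rule smult)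
qed

lemma d_extended:
  assumes I: "ideal I R" and c: "c \<in> extended I i" shows "d i c \<in> extended I (Suc i)"
proof -
  have cc: "c \<in> carrier (C i)" using c unfolding extended_def by blast
  have "d i c T \<in> extension I T" if T: "T \<in> cech_index fs (Suc i)" for T
  proof -
    note Ts = index_subset[OF T]
    interpret LT: module R "L T" by (rule module_L[OF Ts])
    note sub = submodule_extension[OF Ts I]
    show ?thesis unfolding diff_apply[OF cc T]
    proof (rule LT.submodule_finsum[OF sub])
      fix j assume j: "j \<in> T"
      have "c (T - {j}) \<in> extension I (T - {j})"
        using c index_remove[OF T j] unfolding extended_def by blast
      then have "res T (c (T - {j})) \<in> extension I T"
        by (rule extension_restrict[OF Ts _ I, rotated]) blast
      then show "sign T j \<odot>\<^bsub>L T\<^esub> res T (c (T - {j})) \<in> extension I T"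
        by (rule LT.submoduleE(4)[OF sub sign_closed])
    qed
  qed
  then show ?thesis unfolding extended_def using diff_closed[OF cc] by blast
qed

lemma extended_smult:
  assumes "ideal I R" "r \<in> I" "c \<in> carrier (C i)" shows "r \<odot>\<^bsub>C i\<^esub> c \<in> extended I i"
proof -
  interpret I: ideal I R by (rule assms(1))
  have "r \<in> carrier R" using assms(2) I.a_subset by blast
  then show ?thesis
    unfolding extended_def
    using extension_smult[OF index_subset assms(1,2)] cochain_apply[OF assms(3)] assms(3)
    by (simp add: smult_cochain)
qed

lemma extended_quotient:
  assumes I: "ideal I R" and a: "a \<in> carrier R" and c: "c \<in> carrier (C i)"
  shows "a \<odot>\<^bsub>C i\<^esub> c \<in> extended I i \<longleftrightarrow> c \<in> extended (ideal_quotient I a) i"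
proof -
  show ?thesis
    unfolding extended_def
    using extension_quotient[OF index_subset I a] cochain_apply[OF c] a c by (simp add: smult_cochain)
qed

lemma extended_adjoin:
  assumes I: "ideal I R" and a: "a \<in> carrier R" and c: "c \<in> extended (I <+>\<^bsub>R\<^esub> PIdl a) i"
  shows "\<exists>e\<in>extended I i. \<exists>u\<in>carrier (C i). c = e \<oplus>\<^bsub>C i\<^esub> a \<odot>\<^bsub>C i\<^esub> u"
proof -
  have cc: "c \<in> carrier (C i)" using c unfolding extended_def by blast
  have "\<forall>S\<in>cech_index fs i. \<exists>VW. fst VW \<in> extension I S \<and> snd VW \<in> carrier (L S) \<and>
      c S = fst VW \<oplus>\<^bsub>L S\<^esub> a \<odot>\<^bsub>L S\<^esub> snd VW"
  proof
    fix S assume S: "S \<in> cech_index fs i"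
    then have "c S \<in> extension (I <+>\<^bsub>R\<^esub> PIdl a) S" using c unfolding extended_def by blast
    then show "\<exists>VW. fst VW \<in> extension I S \<and> snd VW \<in> carrier (L S) \<and>
      c S = fst VW \<oplus>\<^bsub>L S\<^esub> a \<odot>\<^bsub>L S\<^esub> snd VW"
      using extension_adjoin[OF index_subset[OF S] I a] by fastforce
  qed
  then obtain VW where VW: "\<And>S. S \<in> cech_index fs i \<Longrightarrow> fst (VW S) \<in> extension I S"
    "\<And>S. S \<in> cech_index fs i \<Longrightarrow> snd (VW S) \<in> carrier (L S)"
    "\<And>S. S \<in> cech_index fs i \<Longrightarrow> c S = fst (VW S) \<oplus>\<^bsub>L S\<^esub> a \<odot>\<^bsub>L S\<^esub> snd (VW S)"
    by (metis (no_types, lifting) bchoice)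
  let ?e = "\<lambda>S\<in>cech_index fs i. fst (VW S)" and ?u = "\<lambda>S\<in>cech_index fs i. snd (VW S)"
  have u: "?u \<in> carrier (C i)" by (rule cochainI[OF VW(2)])
  have e: "?e \<in> carrier (C i)"
    by (rule cochainI) (use VW(1) module.submodule_subset[OF module_L submodule_extension] index_subset I in blast)
  then have eE: "?e \<in> extended I i" unfolding extended_def using VW(1) by simp
  have "c = ?e \<oplus>\<^bsub>C i\<^esub> a \<odot>\<^bsub>C i\<^esub> ?u"
  proof (rule cochain_ext[OF cc])
    show "?e \<oplus>\<^bsub>C i\<^esub> a \<odot>\<^bsub>C i\<^esub> ?u \<in> carrier (C i)" using e u a by simp
    show "c S = (?e \<oplus>\<^bsub>C i\<^esub> a \<odot>\<^bsub>C i\<^esub> ?u) S" if "S \<in> cech_index fs i" for S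
      using VW(3)[OF that] that by (simp add: add_cochain smult_cochain)
  qed
  then show ?thesis using eE u by blast
qed

lemma extended_mono:
  assumes "I \<subseteq> J" shows "extended I i \<subseteq> extended J i"
  using assms unfolding extended_def extension_def by blast

text \<open>In positive degree every index set contains some k, and f_k is a unit of that
  localization lying in I, so I generates everything. In degree 0 nothing is inverted.\<close>

lemma extended_top:
  assumes I: "ideal I R" "set fs \<subseteq> I" and c: "c \<in> carrier (C (Suc i))"
  shows "c \<in> extended I (Suc i)"
  unfolding extended_def
proof (intro CollectI conjI ballI c)
  fix S assume S: "S \<in> cech_index fs (Suc i)"
  then have "S \<noteq> {}" unfolding cech_index_def by auto
  then obtain k where k: "k \<in> S" by blast
  then have "fs ! k \<in> I" using index_subset[OF S] I(2) nth_mem[of k fs] by (auto simp: subset_iff)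
  then show "c S \<in> extension I S"
    by (rule extension_top[OF index_subset[OF S] I(1) k _ cochain_apply[OF c S]])
qed

text \<open>A denominator for T and k is f_k^n b with b already a denominator for T. So an element
  that becomes zero modulo I once f_k is inverted is killed modulo I by f_k^n.\<close>

lemma extension_descend:
  assumes T: "T \<subseteq> {..<length fs}" and k: "k < length fs" and I: "ideal I R"
    and U: "U \<in> carrier (L T)" "res (insert k T) U \<in> extension I (insert k T)"
  shows "\<exists>n::nat. ((fs ! k) [^] n) \<odot>\<^bsub>L T\<^esub> U \<in> extension I T"
proof -
  interpret I: ideal I R by (rule I)
  have kT: "insert k T \<subseteq> {..<length fs}" using T k by simp
  have fk: "fs ! k \<in> carrier R" by (rule nth_fs[OF kT]) simp
  obtain m s where m: "m \<in> carrier R" "s \<in> D T" "U = fraction R (D T) (ring_as_module R) m s"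
    using LE[OF T U(1)] by blast
  have s': "s \<in> D (insert k T)" using denominators_mono[OF kT] m(2) by blast
  have "res (insert k T) U = fraction R (D (insert k T)) (ring_as_module R) m s"
    unfolding m(3) by (rule restrict_fraction[OF kT]) (use m in auto)
  then obtain u where u: "u \<in> D (insert k T)" "u \<otimes> m \<in> I"
    using U(2) fraction_extension_iff[OF kT I m(1) s'] by auto
  obtain n b where nb: "b \<in> D (insert k T - {k})" "u = (fs ! k) [^] (n::nat) \<otimes> b"
    using denominator_split[OF kT insertI1 u(1)] by blast
  have bT: "b \<in> D T" using denominators_mono[OF T, of "insert k T - {k}"] nb(1) by blast
  have bR: "b \<in> carrier R" by (rule denominators_closed[OF T bT])
  have "b \<otimes> ((fs ! k) [^] n \<otimes> m) = u \<otimes> m"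
    unfolding nb(2) using bR fk m(1) by (simp add: R.m_ac)
  then have "\<exists>b\<in>D T. b \<otimes> ((fs ! k) [^] n \<otimes> m) \<in> I" using u(2) by (intro bexI[OF _ bT]) simp
  then have "((fs ! k) [^] n) \<odot>\<^bsub>L T\<^esub> U \<in> extension I T"
    unfolding m(3) using L_smult[OF T _ m(1,2)] fraction_extension_iff[OF T I _ m(2)] fk m(1) by simp
  then show ?thesis by blast
qed

text \<open>Multiplying by the power of f_k in the denominator leaves a denominator from T - {k}.
  These preimages \<open>g\<close> are the raw material of the homotopy.\<close>

lemma restrict_lift:
  assumes T: "T \<subseteq> {..<length fs}" and k: "k \<in> T" and U: "U \<in> carrier (L T)"
  shows "\<exists>n::nat. \<exists>g\<in>carrier (L (T - {k})). ((fs ! k) [^] n) \<odot>\<^bsub>L T\<^esub> U = res T g"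
proof -
  interpret F: fractions R "ring_as_module R" "D T" by (rule fractions[OF T])
  have T': "T - {k} \<subseteq> {..<length fs}" using T by blast
  have fk: "fs ! k \<in> carrier R" by (rule nth_fs[OF T k])
  obtain m s where m: "m \<in> carrier R" "s \<in> D T" "U = fraction R (D T) (ring_as_module R) m s"
    using LE[OF T U] by blast
  obtain n b where nb: "b \<in> D (T - {k})" "s = (fs ! k) [^] (n::nat) \<otimes> b"
    using denominator_split[OF T k m(2)] by blast
  have bT: "b \<in> D T" using denominators_mono[OF T, of "T - {k}"] nb(1) by blast
  have fD: "(fs ! k) [^] n \<in> D T" by (rule nth_pow_denominator[OF T k])
  have "((fs ! k) [^] n) \<odot>\<^bsub>L T\<^esub> U = fraction R (D T) (ring_as_module R) ((fs ! k) [^] n \<otimes> m) ((fs ! k) [^] n \<otimes> b)"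
    unfolding m(3) using L_smult[OF T _ m(1,2)] fk nb(2) by simp
  also have "\<dots> = fraction R (D T) (ring_as_module R) m b"
    using F.fraction_expand(1)[of m b "(fs ! k) [^] n"] m(1) bT fD by simp
  also have "\<dots> = res T (fraction R (D (T - {k})) (ring_as_module R) m b)"
    by (rule restrict_fraction[symmetric, OF T]) (use m(1) nb(1) in auto)
  finally have "((fs ! k) [^] n) \<odot>\<^bsub>L T\<^esub> U = res T (fraction R (D (T - {k})) (ring_as_module R) m b)" .
  moreover have "fraction R (D (T - {k})) (ring_as_module R) m b \<in> carrier (L (T - {k}))"
    by (rule fractions.fraction_closed[OF fractions[OF T']]) (use m(1) nb(1) in simp_all)
  ultimately show ?thesis by blast
qed

text \<open>The cochain \<open>e\<close> with \<open>e(S) = \<plusminus>f\<^sub>k\<^sup>n c(S \<union> {k})\<close>, pulled back to the localization at \<open>S\<close>, is the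
  usual contracting homotopy of the Cech complex after inverting \<open>f\<^sub>k\<close>.\<close>

lemma torsion_homotopy:
  assumes I: "ideal I R" and k: "k < length fs" and c: "c \<in> carrier (C i)"
    and dc: "d i c \<in> extended I (Suc i)"
  shows "\<exists>n::nat. \<exists>w\<in>coboundaries i.
    (\<forall>T\<in>cech_index fs i. k \<in> T \<longrightarrow> w T = ((fs ! k) [^] n) \<odot>\<^bsub>L T\<^esub> c T) \<and>
    (\<forall>T\<in>cech_index fs i. k \<notin> T \<longrightarrow>
      res (insert k T) (((fs ! k) [^] n) \<odot>\<^bsub>L T\<^esub> c T \<ominus>\<^bsub>L T\<^esub> w T) \<in> extension I (insert k T))"
proof -
  have fk: "fs ! k \<in> carrier R" using nth_fs[of "{k}" k] k by simp
  have ins: "insert k T \<in> cech_index fs (Suc i)" if "T \<in> cech_index fs i" "k \<notin> T" for T i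
    using that k index_finite[OF that(1)] unfolding cech_index_def by simp
  show ?thesis
  proof (cases i)
    case 0
    have idx: "T = {}" if "T \<in> cech_index fs i" for T
      using index_finite[OF that] that 0 unfolding cech_index_def by simp
    \<comment> \<open>In degree 0 there is no homotopy term: the exponent is 0 and w = 0. The
      component of d c at {k} is, up to sign, the restriction of the single component of
      \<open>c\<close>, so the claim is the cocycle condition itself.\<close>
    have "res (insert k T) (((fs ! k) [^] (0::nat)) \<odot>\<^bsub>L T\<^esub> c T \<ominus>\<^bsub>L T\<^esub> \<zero>\<^bsub>C i\<^esub> T) \<in> extension I (insert k T)"
      if T: "T \<in> cech_index fs i" "k \<notin> T" for T
    proof -
      let ?U = "insert k T"
      note U = ins[OF T] and Us = index_subset[OF ins[OF T]]
      interpret LT: module R "L T" by (rule module_L[OF index_subset[OF T(1)]])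
      interpret LU: module R "L ?U" by (rule module_L[OF Us])
      have cT: "c T \<in> carrier (L T)" by (rule cochain_apply[OF c T(1)])
      have rc: "res ?U (c T) \<in> carrier (L ?U)" by (rule restrict_closed[OF Us _ cT]) blast
      define F where "F j = sign ?U j \<odot>\<^bsub>L ?U\<^esub> res ?U (c (?U - {j}))" for j
      have Uk: "?U - {k} = T" using T(2) by blast
      have Fk: "F k \<in> carrier (L ?U)" unfolding F_def Uk using rc by simp
      have "(\<Oplus>\<^bsub>L ?U\<^esub>j\<in>insert k {}. F j) = F k \<oplus>\<^bsub>L ?U\<^esub> (\<Oplus>\<^bsub>L ?U\<^esub>j\<in>{}. F j)"
        by (rule LU.finsum_insert) (use Fk in simp_all)
      also have "\<dots> = F k" using Fk by simp
      finally have Fs: "(\<Oplus>\<^bsub>L ?U\<^esub>j\<in>insert k {}. F j) = F k" .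
      have "?U = insert k {}" by (rule arg_cong[OF idx[OF T(1)]])
      then have "(\<Oplus>\<^bsub>L ?U\<^esub>j\<in>?U. F j) = (\<Oplus>\<^bsub>L ?U\<^esub>j\<in>insert k {}. F j)"
        by (rule arg_cong[where f="finsum (L ?U) F"])
      from this Fs have "(\<Oplus>\<^bsub>L ?U\<^esub>j\<in>?U. F j) = F k" by (rule trans)
      then have "d i c ?U = sign ?U k \<odot>\<^bsub>L ?U\<^esub> res ?U (c T)"
        unfolding diff_apply[OF c U] F_def Uk .
      moreover have "d i c ?U \<in> extension I ?U" using dc U unfolding extended_def by blast
      ultimately have "sign ?U k \<odot>\<^bsub>L ?U\<^esub> (sign ?U k \<odot>\<^bsub>L ?U\<^esub> res ?U (c T)) \<in> extension I ?U"
        using LU.submoduleE(4)[OF submodule_extension[OF Us I] sign_closed] by simp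
      then have "res ?U (c T) \<in> extension I ?U"
        using rc LU.smult_assoc1[OF sign_closed sign_closed rc, symmetric] by simp
      moreover have "((fs ! k) [^] (0::nat)) \<odot>\<^bsub>L T\<^esub> c T \<ominus>\<^bsub>L T\<^esub> \<zero>\<^bsub>C i\<^esub> T = c T"
        using cT zero_cochain[OF T(1)] by (simp add: LT.minus_eq)
      ultimately show ?thesis by simp
    qed
    moreover have "\<not> k \<in> T" if "T \<in> cech_index fs i" for T using idx[OF that] by simp
    moreover have "\<zero>\<^bsub>C i\<^esub> \<in> coboundaries i" using 0 by simp
    ultimately show ?thesis by blast
  next
    case (Suc i')
    let ?A = "{S \<in> cech_index fs i'. k \<notin> S}"
    have insi: "insert k S \<in> cech_index fs i" if "S \<in> ?A" for S using ins[of S i'] that Suc by simp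
    have "finite {S. S \<subseteq> {..<length fs}}" by simp
    then have "finite ?A" by (rule rev_finite_subset) (auto simp: cech_index_def)
    moreover have "\<exists>n::nat. \<exists>g\<in>carrier (L S). ((fs ! k) [^] n) \<odot>\<^bsub>L (insert k S)\<^esub> c (insert k S) = res (insert k S) g"
      if S: "S \<in> ?A" for S
    proof -
      have "insert k S - {k} = S" using S by simp
      then show ?thesis
        using restrict_lift[OF index_subset[OF insi[OF S]] insertI1 cochain_apply[OF c insi[OF S]]] by simp
    qed
    moreover have "\<exists>g\<in>carrier (L S). ((fs ! k) [^] n) \<odot>\<^bsub>L (insert k S)\<^esub> c (insert k S) = res (insert k S) g"
      if S: "S \<in> ?A" and ex: "\<exists>g\<in>carrier (L S). ((fs ! k) [^] m) \<odot>\<^bsub>L (insert k S)\<^esub> c (insert k S) = res (insert k S) g"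
        and mn: "m \<le> n" for S and m n :: nat
    proof -
      let ?U = "insert k S"
      note Us = index_subset[OF insi[OF S]]
      interpret LU: module R "L ?U" by (rule module_L[OF Us])
      interpret LS: module R "L S" by (rule module_L) (use Us in blast)
      obtain g where g: "g \<in> carrier (L S)" "((fs ! k) [^] m) \<odot>\<^bsub>L ?U\<^esub> c ?U = res ?U g" using ex by blast
      have cU: "c ?U \<in> carrier (L ?U)" by (rule cochain_apply[OF c insi[OF S]])
      have p: "(fs ! k) [^] (n - m) \<in> carrier R" using fk by simp
      have "(fs ! k) [^] n = (fs ! k) [^] (n - m) \<otimes> (fs ! k) [^] m"
        using mn fk by (simp add: R.nat_pow_mult)
      then have "((fs ! k) [^] n) \<odot>\<^bsub>L ?U\<^esub> c ?U = ((fs ! k) [^] (n - m)) \<odot>\<^bsub>L ?U\<^esub> res ?U g"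
        using cU fk g(2) by (simp add: LU.smult_assoc1)
      also have "\<dots> = res ?U (((fs ! k) [^] (n - m)) \<odot>\<^bsub>L S\<^esub> g)"
        by (rule restrict_smult[symmetric, OF Us _ p g(1)]) blast
      finally show ?thesis by (rule bexI) (use p g(1) in simp)
    qed
    ultimately have "\<exists>n::nat. \<forall>S\<in>?A. \<exists>g\<in>carrier (L S).
        ((fs ! k) [^] n) \<odot>\<^bsub>L (insert k S)\<^esub> c (insert k S) = res (insert k S) g"
      by (rule uniform_exponent)
    then obtain n :: nat where "\<forall>S\<in>?A. \<exists>g. g \<in> carrier (L S) \<and>
        ((fs ! k) [^] n) \<odot>\<^bsub>L (insert k S)\<^esub> c (insert k S) = res (insert k S) g"
      unfolding Bex_def by blast
    from bchoice[OF this] obtain g where "\<forall>S\<in>?A. g S \<in> carrier (L S) \<and>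
        ((fs ! k) [^] n) \<odot>\<^bsub>L (insert k S)\<^esub> c (insert k S) = res (insert k S) (g S)" ..
    then have g: "\<And>S. S \<in> ?A \<Longrightarrow> g S \<in> carrier (L S)"
      "\<And>S. S \<in> ?A \<Longrightarrow> ((fs ! k) [^] n) \<odot>\<^bsub>L (insert k S)\<^esub> c (insert k S) = res (insert k S) (g S)"
      by blast+
    define y where "y = (fs ! k) [^] n"
    have y: "y \<in> carrier R" unfolding y_def using fk by simp
    \<comment> \<open>Setting \<open>e\<close> to zero on index sets that contain k leaves a single
      nonzero term in d e at every T containing k. The sign in the other case is chosen so that this
      term becomes f_k^n c(T).\<close>
    define e where "e = (\<lambda>S\<in>cech_index fs i'. if k \<in> S then \<zero>\<^bsub>L S\<^esub> else sign (insert k S) k \<odot>\<^bsub>L S\<^esub> g S)"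
    have e: "e \<in> carrier (C i')"
      unfolding e_def
    proof (rule cochainI)
      fix S assume S: "S \<in> cech_index fs i'"
      interpret LS: module R "L S" by (rule module_L[OF index_subset[OF S]])
      show "(if k \<in> S then \<zero>\<^bsub>L S\<^esub> else sign (insert k S) k \<odot>\<^bsub>L S\<^esub> g S) \<in> carrier (L S)"
        using g(1) S by simp
    qed
    let ?w = "d i' e"
    have w: "?w \<in> coboundaries i" using e Suc by simp
    \<comment> \<open>Every j other than k leaves k in T - {j}, where \<open>e\<close> is zero. The
      remaining term carries the sign of k twice, and the square of a sign is 1.\<close>
    have w_in: "?w T = y \<odot>\<^bsub>L T\<^esub> c T" if T: "T \<in> cech_index fs i" "k \<in> T" for T
    proof -
      note Ts = index_subset[OF T(1)]
      have T': "T \<in> cech_index fs (Suc i')" using T(1) Suc by simp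
      interpret LT: module R "L T" by (rule module_L[OF Ts])
      have Tk: "insert k (T - {k}) = T" using T(2) by blast
      have TA: "T - {k} \<in> ?A" using index_remove[OF T' T(2)] by simp
      have z: "sign T j \<odot>\<^bsub>L T\<^esub> res T (e (T - {j})) = \<zero>\<^bsub>L T\<^esub>" if j: "j \<in> T - {k}" for j
      proof -
        have "T - {j} \<in> cech_index fs i'" by (rule index_remove[OF T']) (use j in blast)
        then have "e (T - {j}) = \<zero>\<^bsub>L (T - {j})\<^esub>" unfolding e_def using j T(2) by simp
        then show ?thesis using restrict_zero[OF Ts, of "T - {j}"] by simp
      qed
      have rk: "res T (g (T - {k})) \<in> carrier (L T)" by (rule restrict_closed[OF Ts _ g(1)[OF TA]]) blast
      have "e (T - {k}) = sign T k \<odot>\<^bsub>L (T - {k})\<^esub> g (T - {k})"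
        unfolding e_def using TA Tk by simp
      then have ek: "res T (e (T - {k})) = sign T k \<odot>\<^bsub>L T\<^esub> res T (g (T - {k}))"
        using restrict_smult[OF Ts _ sign_closed g(1)[OF TA]] by auto
      have "?w T = (\<Oplus>\<^bsub>L T\<^esub>j\<in>insert k (T - {k}). sign T j \<odot>\<^bsub>L T\<^esub> res T (e (T - {j})))"
        unfolding Tk by (rule diff_apply[OF e T'])
      also have "\<dots> = sign T k \<odot>\<^bsub>L T\<^esub> res T (e (T - {k})) \<oplus>\<^bsub>L T\<^esub>
          (\<Oplus>\<^bsub>L T\<^esub>j\<in>T - {k}. sign T j \<odot>\<^bsub>L T\<^esub> res T (e (T - {j})))"
        by (rule LT.finsum_insert) (use index_finite[OF T'] diff_term_closed[OF e T'] T(2) in auto)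
      also have "(\<Oplus>\<^bsub>L T\<^esub>j\<in>T - {k}. sign T j \<odot>\<^bsub>L T\<^esub> res T (e (T - {j}))) = \<zero>\<^bsub>L T\<^esub>"
        by (rule LT.add.finprod_one_eqI) (rule z)
      finally have "?w T = res T (g (T - {k}))"
        using rk ek LT.smult_assoc1[OF sign_closed sign_closed rk, of T k T k, symmetric] by simp
      then show ?thesis using g(2)[OF TA] Tk unfolding y_def by simp
    qed
    \<comment> \<open>For k outside T, the terms of d e at T match, up to sign, the terms of y d c
      at U = T plus k that belong to indices j in T. What is left of y d c at U is the term of index
      k, so y c(T) - w(T) restricts to y d c (U) up to sign, which lies in the extended
      ideal.\<close>
    have w_notin: "res (insert k T) (y \<odot>\<^bsub>L T\<^esub> c T \<ominus>\<^bsub>L T\<^esub> ?w T) \<in> extension I (insert k T)"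
      if T: "T \<in> cech_index fs i" "k \<notin> T" for T
    proof -
      let ?U = "insert k T"
      note U = ins[OF T]
      note Us = index_subset[OF U]
      have T': "T \<in> cech_index fs (Suc i')" using T(1) Suc by simp
      interpret LT: module R "L T" by (rule module_L[OF index_subset[OF T(1)]])
      interpret LU: module R "L ?U" by (rule module_L[OF Us])
      note sub = submodule_extension[OF Us I]
      have finU: "finite ?U" by (rule index_finite[OF U])
      have cT: "c T \<in> carrier (L T)" by (rule cochain_apply[OF c T(1)])
      have wT: "?w T \<in> carrier (L T)" by (rule cochain_apply[OF coboundaries_subset[OF w] T(1)])
      have rcT: "res ?U (c T) \<in> carrier (L ?U)" by (rule restrict_closed[OF Us _ cT]) blast
      have rwT: "res ?U (?w T) \<in> carrier (L ?U)" by (rule restrict_closed[OF Us _ wT]) blast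
      define h where "h j = res ?U (g (T - {j}))" for j
      have TA: "T - {j} \<in> ?A" if "j \<in> T" for j using index_remove[OF T' that] T(2) by simp
      have h: "h j \<in> carrier (L ?U)" if "j \<in> T" for j
        unfolding h_def by (rule restrict_closed[OF Us _ g(1)[OF TA[OF that]]]) blast
      have 1: "y \<odot>\<^bsub>L ?U\<^esub> res ?U (c (?U - {j})) = h j" if j: "j \<in> T" for j
      proof -
        have eq: "?U - {j} = insert k (T - {j})" using j T(2) by blast
        have Uj: "insert k (T - {j}) \<subseteq> ?U" by blast
        note cU = cochain_apply[OF c insi[OF TA[OF j]]]
        have "y \<odot>\<^bsub>L ?U\<^esub> res ?U (c (?U - {j})) = res ?U (y \<odot>\<^bsub>L (insert k (T - {j}))\<^esub> c (insert k (T - {j})))"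
          unfolding eq by (rule restrict_smult[symmetric, OF Us Uj y cU])
        also have "\<dots> = res ?U (res (insert k (T - {j})) (g (T - {j})))"
          using g(2)[OF TA[OF j]] unfolding y_def by simp
        also have "\<dots> = h j"
          unfolding h_def by (rule restrict_restrict[OF Us Uj _ g(1)[OF TA[OF j]]]) blast
        finally show ?thesis .
      qed
      have Uk: "?U - {k} = T" using T(2) by blast
      have "d i c ?U = sign ?U k \<odot>\<^bsub>L ?U\<^esub> res ?U (c (?U - {k})) \<oplus>\<^bsub>L ?U\<^esub>
          (\<Oplus>\<^bsub>L ?U\<^esub>j\<in>T. sign ?U j \<odot>\<^bsub>L ?U\<^esub> res ?U (c (?U - {j})))"
        unfolding diff_apply[OF c U]
        by (rule LU.finsum_insert) (use finU diff_term_closed[OF c U] rcT T(2) in auto)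
      then have "y \<odot>\<^bsub>L ?U\<^esub> d i c ?U = y \<odot>\<^bsub>L ?U\<^esub> (sign ?U k \<odot>\<^bsub>L ?U\<^esub> res ?U (c T)) \<oplus>\<^bsub>L ?U\<^esub>
          y \<odot>\<^bsub>L ?U\<^esub> (\<Oplus>\<^bsub>L ?U\<^esub>j\<in>T. sign ?U j \<odot>\<^bsub>L ?U\<^esub> res ?U (c (?U - {j})))"
        unfolding Uk
        by (simp add: LU.smult_r_distr[OF y] rcT LU.finsum_closed diff_term_closed[OF c U])
      also have "y \<odot>\<^bsub>L ?U\<^esub> (\<Oplus>\<^bsub>L ?U\<^esub>j\<in>T. sign ?U j \<odot>\<^bsub>L ?U\<^esub> res ?U (c (?U - {j})))
          = (\<Oplus>\<^bsub>L ?U\<^esub>j\<in>T. y \<odot>\<^bsub>L ?U\<^esub> (sign ?U j \<odot>\<^bsub>L ?U\<^esub> res ?U (c (?U - {j}))))"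
        by (rule LU.finsum_smult_ldistr) (use finU y diff_term_closed[OF c U] in simp_all)
      also have "\<dots> = (\<Oplus>\<^bsub>L ?U\<^esub>j\<in>T. sign ?U j \<odot>\<^bsub>L ?U\<^esub> h j)"
      proof (rule LU.finsum_cong')
        fix j assume j: "j \<in> T"
        show "y \<odot>\<^bsub>L ?U\<^esub> (sign ?U j \<odot>\<^bsub>L ?U\<^esub> res ?U (c (?U - {j}))) = sign ?U j \<odot>\<^bsub>L ?U\<^esub> h j"
          using 1[OF j] LU.smult_comm[OF y sign_closed diff_term_closed[OF c U, of j]] j by simp
      qed (use h in simp_all)
      finally have ydc: "y \<odot>\<^bsub>L ?U\<^esub> d i c ?U = y \<odot>\<^bsub>L ?U\<^esub> (sign ?U k \<odot>\<^bsub>L ?U\<^esub> res ?U (c T)) \<oplus>\<^bsub>L ?U\<^esub>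
          (\<Oplus>\<^bsub>L ?U\<^esub>j\<in>T. sign ?U j \<odot>\<^bsub>L ?U\<^esub> h j)" .
      have dw: "res ?U (?w T) = (\<Oplus>\<^bsub>L ?U\<^esub>j\<in>T. sign ?U k \<odot>\<^bsub>L ?U\<^esub> (\<ominus>\<^bsub>L ?U\<^esub> (sign ?U j \<odot>\<^bsub>L ?U\<^esub> h j)))"
      proof -
        have "res ?U (?w T) = (\<Oplus>\<^bsub>L ?U\<^esub>j\<in>T. sign T j \<odot>\<^bsub>L ?U\<^esub> res ?U (e (T - {j})))"
          by (rule restrict_diff[OF e T' Us]) blast
        also have "\<dots> = (\<Oplus>\<^bsub>L ?U\<^esub>j\<in>T. sign ?U k \<odot>\<^bsub>L ?U\<^esub> (\<ominus>\<^bsub>L ?U\<^esub> (sign ?U j \<odot>\<^bsub>L ?U\<^esub> h j)))"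
        proof (rule LU.finsum_cong')
          fix j assume j: "j \<in> T"
          have eq: "insert k (T - {j}) = ?U - {j}" using j T(2) by blast
          have jk: "j \<noteq> k" using j T(2) by blast
          have "e (T - {j}) = sign (?U - {j}) k \<odot>\<^bsub>L (T - {j})\<^esub> g (T - {j})"
            unfolding e_def using TA[OF j] T(2) eq by simp
          then have "res ?U (e (T - {j})) = sign (?U - {j}) k \<odot>\<^bsub>L ?U\<^esub> h j"
            unfolding h_def using restrict_smult[OF Us _ sign_closed g(1)[OF TA[OF j]]] by auto
          then have l: "sign T j \<odot>\<^bsub>L ?U\<^esub> res ?U (e (T - {j})) = (sign T j \<otimes> sign (?U - {j}) k) \<odot>\<^bsub>L ?U\<^esub> h j"
            using h[OF j] by (simp add: LU.smult_assoc1)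
          \<comment> \<open>The swap rule in U, with T = U - {k}. Multiplying it by the sign of k in
            U on the left and by the sign of k in U - {j} on the right removes squares and brings it
            into the form in which the terms of d e appear.\<close>
          have "sign ?U k \<otimes> sign T j = \<ominus> (sign ?U j \<otimes> sign (?U - {j}) k)"
            using sign_swap[OF finU, of k j] j jk Uk by simp
          then have "sign ?U k \<otimes> (sign ?U k \<otimes> sign T j) \<otimes> sign (?U - {j}) k
              = sign ?U k \<otimes> (\<ominus> (sign ?U j \<otimes> sign (?U - {j}) k)) \<otimes> sign (?U - {j}) k" by simp
          moreover have "sign ?U k \<otimes> (sign ?U k \<otimes> sign T j) \<otimes> sign (?U - {j}) k = sign T j \<otimes> sign (?U - {j}) k"
            by (simp add: R.m_assoc[symmetric])
          moreover have "sign ?U k \<otimes> (\<ominus> (sign ?U j \<otimes> sign (?U - {j}) k)) \<otimes> sign (?U - {j}) k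
              = \<ominus> (sign ?U k \<otimes> sign ?U j)"
            by (simp add: R.l_minus R.r_minus R.m_assoc)
          ultimately have "sign T j \<otimes> sign (?U - {j}) k = \<ominus> (sign ?U k \<otimes> sign ?U j)" by simp
          then show "sign T j \<odot>\<^bsub>L ?U\<^esub> res ?U (e (T - {j}))
              = sign ?U k \<odot>\<^bsub>L ?U\<^esub> (\<ominus>\<^bsub>L ?U\<^esub> (sign ?U j \<odot>\<^bsub>L ?U\<^esub> h j))"
            unfolding l using h[OF j] by (simp add: LU.smult_l_minus LU.smult_r_minus LU.smult_assoc1)
        qed (use h in simp_all)
        finally show ?thesis .
      qed
      have sm: "(\<Oplus>\<^bsub>L ?U\<^esub>j\<in>T. sign ?U j \<odot>\<^bsub>L ?U\<^esub> h j) \<in> carrier (L ?U)"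
        by (rule LU.finsum_closed) (use h in simp)
      have sk: "sign ?U k \<odot>\<^bsub>L ?U\<^esub> (\<Oplus>\<^bsub>L ?U\<^esub>j\<in>T. sign ?U j \<odot>\<^bsub>L ?U\<^esub> h j)
          = (\<Oplus>\<^bsub>L ?U\<^esub>j\<in>T. sign ?U k \<odot>\<^bsub>L ?U\<^esub> (sign ?U j \<odot>\<^bsub>L ?U\<^esub> h j))"
        by (rule LU.finsum_smult_ldistr) (use finU h in simp_all)
      have cancel: "sign ?U k \<odot>\<^bsub>L ?U\<^esub> (\<Oplus>\<^bsub>L ?U\<^esub>j\<in>T. sign ?U j \<odot>\<^bsub>L ?U\<^esub> h j) \<oplus>\<^bsub>L ?U\<^esub> res ?U (?w T) = \<zero>\<^bsub>L ?U\<^esub>"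
      proof -
        have "sign ?U k \<odot>\<^bsub>L ?U\<^esub> (\<Oplus>\<^bsub>L ?U\<^esub>j\<in>T. sign ?U j \<odot>\<^bsub>L ?U\<^esub> h j) \<oplus>\<^bsub>L ?U\<^esub> res ?U (?w T)
          = (\<Oplus>\<^bsub>L ?U\<^esub>j\<in>T. sign ?U k \<odot>\<^bsub>L ?U\<^esub> (sign ?U j \<odot>\<^bsub>L ?U\<^esub> h j)
              \<oplus>\<^bsub>L ?U\<^esub> sign ?U k \<odot>\<^bsub>L ?U\<^esub> (\<ominus>\<^bsub>L ?U\<^esub> (sign ?U j \<odot>\<^bsub>L ?U\<^esub> h j)))"
          unfolding sk dw by (rule LU.finsum_addf[symmetric]) (use h in simp_all)
        also have "\<dots> = \<zero>\<^bsub>L ?U\<^esub>"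
          by (rule LU.add.finprod_one_eqI) (simp add: h LU.smult_r_minus LU.r_neg)
        finally show ?thesis .
      qed
      have yy: "sign ?U k \<odot>\<^bsub>L ?U\<^esub> (y \<odot>\<^bsub>L ?U\<^esub> (sign ?U k \<odot>\<^bsub>L ?U\<^esub> res ?U (c T))) = y \<odot>\<^bsub>L ?U\<^esub> res ?U (c T)"
      proof -
        have "sign ?U k \<odot>\<^bsub>L ?U\<^esub> (y \<odot>\<^bsub>L ?U\<^esub> (sign ?U k \<odot>\<^bsub>L ?U\<^esub> res ?U (c T)))
            = (sign ?U k \<otimes> y \<otimes> sign ?U k) \<odot>\<^bsub>L ?U\<^esub> res ?U (c T)"
          using y rcT by (simp add: LU.smult_assoc1)
        also have "sign ?U k \<otimes> y \<otimes> sign ?U k = (sign ?U k \<otimes> sign ?U k) \<otimes> y"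
          using y sign_closed[of ?U k] by (simp add: R.m_ac del: sign_square sign_closed)
        also have "\<dots> = y" using y by simp
        finally show ?thesis .
      qed
      have S': "sign ?U k \<odot>\<^bsub>L ?U\<^esub> (\<Oplus>\<^bsub>L ?U\<^esub>j\<in>T. sign ?U j \<odot>\<^bsub>L ?U\<^esub> h j) \<in> carrier (L ?U)" using sm by simp
      have total: "sign ?U k \<odot>\<^bsub>L ?U\<^esub> (y \<odot>\<^bsub>L ?U\<^esub> d i c ?U) = y \<odot>\<^bsub>L ?U\<^esub> res ?U (c T) \<oplus>\<^bsub>L ?U\<^esub>
          sign ?U k \<odot>\<^bsub>L ?U\<^esub> (\<Oplus>\<^bsub>L ?U\<^esub>j\<in>T. sign ?U j \<odot>\<^bsub>L ?U\<^esub> h j)"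
        unfolding ydc yy[symmetric] by (rule LU.smult_r_distr) (use y rcT sm in simp_all)
      let ?z = "y \<odot>\<^bsub>L T\<^esub> c T \<ominus>\<^bsub>L T\<^esub> ?w T"
      have zT: "?z \<in> carrier (L T)" using y cT wT by simp
      have rz: "res ?U ?z \<in> carrier (L ?U)" by (rule restrict_closed[OF Us _ zT]) blast
      have "res ?U ?z \<oplus>\<^bsub>L ?U\<^esub> res ?U (?w T) = res ?U (?z \<oplus>\<^bsub>L T\<^esub> ?w T)"
        by (rule restrict_add[symmetric, OF Us _ zT wT]) blast
      also have "?z \<oplus>\<^bsub>L T\<^esub> ?w T = y \<odot>\<^bsub>L T\<^esub> c T" by (rule LT.diff_add_cancel) (use y cT wT in simp_all)
      also have "res ?U (y \<odot>\<^bsub>L T\<^esub> c T) = y \<odot>\<^bsub>L ?U\<^esub> res ?U (c T)"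
        by (rule restrict_smult[OF Us _ y cT]) blast
      finally have zw: "y \<odot>\<^bsub>L ?U\<^esub> res ?U (c T) = res ?U ?z \<oplus>\<^bsub>L ?U\<^esub> res ?U (?w T)" ..
      have "sign ?U k \<odot>\<^bsub>L ?U\<^esub> (y \<odot>\<^bsub>L ?U\<^esub> d i c ?U) = res ?U ?z \<oplus>\<^bsub>L ?U\<^esub>
          (sign ?U k \<odot>\<^bsub>L ?U\<^esub> (\<Oplus>\<^bsub>L ?U\<^esub>j\<in>T. sign ?U j \<odot>\<^bsub>L ?U\<^esub> h j) \<oplus>\<^bsub>L ?U\<^esub> res ?U (?w T))"
        unfolding total zw using rz rwT S' by (simp add: LU.a_ac)
      then have "res ?U ?z = sign ?U k \<odot>\<^bsub>L ?U\<^esub> (y \<odot>\<^bsub>L ?U\<^esub> d i c ?U)"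
        unfolding cancel using rz by simp
      moreover have "d i c ?U \<in> extension I ?U" using dc U unfolding extended_def by blast
      ultimately show ?thesis
        using LU.submoduleE(4)[OF sub sign_closed LU.submoduleE(4)[OF sub y]] by simp
    qed
    show ?thesis using w w_in w_notin unfolding y_def by blast
  qed
qed

text \<open>The homotopy leaves a remainder f^n c - w that is zero on index sets containing k and
  elsewhere becomes zero modulo I only after inverting f. A further power of f, the same for all
  index sets, moves the remainder into I C. So the cohomology of R/I is f-power torsion.\<close>

lemma extended_torsion:
  assumes I: "ideal I R" and f: "f \<in> set fs" and c: "c \<in> carrier (C i)"
    and dc: "d i c \<in> extended I (Suc i)"
  shows "\<exists>n::nat. (f [^] n) \<odot>\<^bsub>C i\<^esub> c \<in> coboundaries i <+>\<^bsub>C i\<^esub> extended I i"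
proof -
  obtain k where k: "k < length fs" "f = fs ! k" using f by (metis in_set_conv_nth)
  have fR: "f \<in> carrier R" using f fs_subset by blast
  obtain n :: nat and w where w: "w \<in> coboundaries i"
    "\<And>T. \<lbrakk>T \<in> cech_index fs i; k \<in> T\<rbrakk> \<Longrightarrow> w T = (f [^] n) \<odot>\<^bsub>L T\<^esub> c T"
    "\<And>T. \<lbrakk>T \<in> cech_index fs i; k \<notin> T\<rbrakk> \<Longrightarrow>
      res (insert k T) ((f [^] n) \<odot>\<^bsub>L T\<^esub> c T \<ominus>\<^bsub>L T\<^esub> w T) \<in> extension I (insert k T)"
    using torsion_homotopy[OF I k(1) c dc] k(2) by blast
  have fn: "f [^] m \<in> carrier R" for m :: nat using fR by simp
  have wc: "w \<in> carrier (C i)" by (rule coboundaries_subset[OF w(1)])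
  let ?v = "(f [^] n) \<odot>\<^bsub>C i\<^esub> c \<ominus>\<^bsub>C i\<^esub> w"
  have fc: "(f [^] n) \<odot>\<^bsub>C i\<^esub> c \<in> carrier (C i)" using fn c by simp
  have v: "?v \<in> carrier (C i)" using fc wc by simp
  have vT: "?v T = (f [^] n) \<odot>\<^bsub>L T\<^esub> c T \<ominus>\<^bsub>L T\<^esub> w T" if T: "T \<in> cech_index fs i" for T
  proof -
    interpret LT: module R "L T" by (rule module_L[OF index_subset[OF T]])
    have cT: "c T \<in> carrier (L T)" "w T \<in> carrier (L T)" by (rule cochain_apply[OF _ T], rule c wc)+
    have "(?v \<oplus>\<^bsub>C i\<^esub> w) T = (f [^] n) \<odot>\<^bsub>L T\<^esub> c T"
      using K.diff_add_cancel[OF fc wc] smult_cochain[OF T] by simp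
    then have "?v T \<oplus>\<^bsub>L T\<^esub> w T = (f [^] n) \<odot>\<^bsub>L T\<^esub> c T" using add_cochain[OF T] by simp
    then show ?thesis
      using LT.add_diff_cancel(1)[OF cochain_apply[OF v T] cT(2)] by simp
  qed
  have "finite {S. S \<subseteq> {..<length fs}}" by simp
  then have fin: "finite (cech_index fs i)" by (rule rev_finite_subset) (auto simp: cech_index_def)
  have "\<exists>m::nat. \<forall>T\<in>cech_index fs i. (f [^] m) \<odot>\<^bsub>L T\<^esub> ?v T \<in> extension I T"
  proof (rule uniform_exponent[OF fin])
    fix T assume T: "T \<in> cech_index fs i"
    interpret LT: module R "L T" by (rule module_L[OF index_subset[OF T]])
    note sub = submodule_extension[OF index_subset[OF T] I]
    have vc: "?v T \<in> carrier (L T)" by (rule cochain_apply[OF v T])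
    show "\<exists>m::nat. (f [^] m) \<odot>\<^bsub>L T\<^esub> ?v T \<in> extension I T"
    proof (cases "k \<in> T")
      case True
      have cT: "c T \<in> carrier (L T)" by (rule cochain_apply[OF c T])
      then have "?v T = \<zero>\<^bsub>L T\<^esub>"
        unfolding vT[OF T] w(2)[OF T True] using fn by (simp add: LT.minus_eq LT.r_neg)
      then show ?thesis using LT.submodule_zero[OF sub] fn by auto
    next
      case False
      show ?thesis
        using extension_descend[OF index_subset[OF T] k(1) I vc] w(3)[OF T False] vT[OF T] k(2) by simp
    qed
    fix m m' :: nat
    assume m: "(f [^] m) \<odot>\<^bsub>L T\<^esub> ?v T \<in> extension I T" "m \<le> m'"
    have "f [^] m' = f [^] (m' - m) \<otimes> f [^] m" using m(2) fR by (simp add: R.nat_pow_mult)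
    then have "(f [^] m') \<odot>\<^bsub>L T\<^esub> ?v T = (f [^] (m' - m)) \<odot>\<^bsub>L T\<^esub> ((f [^] m) \<odot>\<^bsub>L T\<^esub> ?v T)"
      using LT.smult_assoc1[OF fn fn vc] by simp
    then show "(f [^] m') \<odot>\<^bsub>L T\<^esub> ?v T \<in> extension I T"
      using LT.submoduleE(4)[OF sub fn m(1)] by simp
  qed
  then obtain m :: nat where m: "\<And>T. T \<in> cech_index fs i \<Longrightarrow> (f [^] m) \<odot>\<^bsub>L T\<^esub> ?v T \<in> extension I T" by blast
  have mv: "(f [^] m) \<odot>\<^bsub>C i\<^esub> ?v \<in> extended I i"
    unfolding extended_def using fn v m by (simp add: smult_cochain)
  have mw: "(f [^] m) \<odot>\<^bsub>C i\<^esub> w \<in> coboundaries i"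
    by (rule K.submoduleE(4)[OF submodule_coboundaries fn w(1)])
  have "(f [^] (m + n)) \<odot>\<^bsub>C i\<^esub> c = (f [^] m) \<odot>\<^bsub>C i\<^esub> ((f [^] n) \<odot>\<^bsub>C i\<^esub> c)"
    using K.smult_assoc1[OF fn fn c, of m n] fR by (simp add: R.nat_pow_mult)
  also have "\<dots> = (f [^] m) \<odot>\<^bsub>C i\<^esub> (w \<oplus>\<^bsub>C i\<^esub> ?v)"
    using K.diff_add_cancel[OF fc wc] K.a_comm[OF wc v] by simp
  also have "\<dots> = (f [^] m) \<odot>\<^bsub>C i\<^esub> w \<oplus>\<^bsub>C i\<^esub> (f [^] m) \<odot>\<^bsub>C i\<^esub> ?v"
    by (rule K.smult_r_distr[OF fn wc v])
  finally show ?thesis unfolding K.set_add_iff using mv mw by blast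
qed

sublocale extended_ideals R "cech_cochains R fs (ring_as_module R)" "cech_diff R fs (ring_as_module R)"
  extended "set fs"
proof (intro extended_ideals.intro extended_ideals_axioms.intro cochain_complex_axioms fs_subset)
qed (erule submodule_extended | erule (1) d_extended | erule (2) extended_smult
    | erule (2) extended_quotient | erule (2) extended_adjoin | erule extended_mono
    | erule (2) extended_top | erule (3) extended_torsion)+

lemma extension_zero:
  assumes S: "S \<subseteq> {..<length fs}" and "U \<in> extension {\<zero>} S" shows "U = \<zero>\<^bsub>L S\<^esub>"
proof -
  obtain s where "s \<in> D S" "U = fraction R (D S) (ring_as_module R) \<zero> s"
    using assms(2) unfolding extension_def by blast
  then show ?thesis using fractions.fraction_zero[OF fractions[OF S]] by simp
qed

text \<open>The case I = 0 turns results about R/I into results about R itself, such as the torsion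
  of its cohomology.\<close>

lemma extended_zero: "extended {\<zero>} i = {\<zero>\<^bsub>C i\<^esub>}"
proof
  show "extended {\<zero>} i \<subseteq> {\<zero>\<^bsub>C i\<^esub>}"
  proof
    fix c assume c: "c \<in> extended {\<zero>} i"
    then have cc: "c \<in> carrier (C i)" unfolding extended_def by blast
    have "c = \<zero>\<^bsub>C i\<^esub>"
    proof (rule cochain_ext[OF cc K.zero_closed])
      fix S assume S: "S \<in> cech_index fs i"
      then have "c S \<in> extension {\<zero>} S" using c unfolding extended_def by blast
      then show "c S = \<zero>\<^bsub>C i\<^esub> S"
        unfolding zero_cochain[OF S] by (rule extension_zero[OF index_subset[OF S]])
    qed
    then show "c \<in> {\<zero>\<^bsub>C i\<^esub>}" by simp
  qed
  show "{\<zero>\<^bsub>C i\<^esub>} \<subseteq> extended {\<zero>} i"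
    using K.submodule_zero[OF submodule_extended[OF R.zeroideal]] by simp
qed

text \<open>Joins the two descriptions of reduction modulo x: x C from the lifting argument and (x)
  C from the vanishing theorem. For the less obvious inclusion, (x) is regarded as the zero ideal
  with x adjoined.\<close>

lemma multiples_eq_extended:
  assumes x: "x \<in> carrier R" shows "multiples x i = extended (PIdl x) i"
proof
  show "multiples x i \<subseteq> extended (PIdl x) i"
    unfolding multiples_def
    using extended_smult[OF R.cgenideal_ideal[OF x] R.cgenideal_self[OF x]] by blast
  show "extended (PIdl x) i \<subseteq> multiples x i"
  proof
    fix c assume c: "c \<in> extended (PIdl x) i"
    interpret J: ideal "PIdl x" R by (rule R.cgenideal_ideal[OF x])
    have "PIdl x \<subseteq> {\<zero>} <+>\<^bsub>R\<^esub> PIdl x"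
    proof
      fix a assume a: "a \<in> PIdl x"
      have "a = \<zero> \<oplus> a" using subsetD[OF J.a_subset a] by simp
      then show "a \<in> {\<zero>} <+>\<^bsub>R\<^esub> PIdl x" unfolding set_add_def' using a by blast
    qed
    then have "c \<in> extended ({\<zero>} <+>\<^bsub>R\<^esub> PIdl x) i" using c extended_mono by blast
    then obtain e u where "e \<in> extended {\<zero>} i" "u \<in> carrier (C i)" "c = e \<oplus>\<^bsub>C i\<^esub> x \<odot>\<^bsub>C i\<^esub> u"
      using extended_adjoin[OF R.zeroideal x] by blast
    then have "c = x \<odot>\<^bsub>C i\<^esub> u" "u \<in> carrier (C i)" using extended_zero x by simp_all
    then show "c \<in> multiples x i" using multiplesI by simp
  qed
qed

text \<open>A nonzerodivisor stays one in every localization: u (x m) = 0 gives x (u m) = 0, hence u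
  m = 0 and the fraction is zero.\<close>

lemma regular_torsion_free:
  assumes x: "regular_element R x" and c: "c \<in> carrier (C i)" "x \<odot>\<^bsub>C i\<^esub> c = \<zero>\<^bsub>C i\<^esub>"
  shows "c = \<zero>\<^bsub>C i\<^esub>"
proof (rule cochain_ext[OF c(1) K.zero_closed])
  have xR: "x \<in> carrier R" and reg: "\<And>a. \<lbrakk>a \<in> carrier R; x \<otimes> a = \<zero>\<rbrakk> \<Longrightarrow> a = \<zero>"
    using x unfolding regular_element_def by blast+
  fix S assume S: "S \<in> cech_index fs i"
  note Ss = index_subset[OF S]
  interpret F: fractions R "ring_as_module R" "D S" by (rule fractions[OF Ss])
  obtain m s where m: "m \<in> carrier R" "s \<in> D S" "c S = fraction R (D S) (ring_as_module R) m s"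
    using LE[OF Ss cochain_apply[OF c(1) S]] by blast
  have "fraction R (D S) (ring_as_module R) (x \<otimes> m) s = \<zero>\<^bsub>L S\<^esub>"
    using c(2) smult_cochain[OF S, of x c] zero_cochain[OF S] L_smult[OF Ss xR m(1,2)] m(3) by simp
  then obtain u where u: "u \<in> D S" "u \<otimes> (x \<otimes> m) = \<zero>"
    using F.fraction_eq_zero_iff[of "x \<otimes> m" s] xR m by auto
  have uR: "u \<in> carrier R" by (rule denominators_closed[OF Ss u(1)])
  have "u \<otimes> m = \<zero>"
    by (rule reg) (use u(2) uR xR m(1) R.m_lcomm[of x u m] in simp_all)
  then have "\<exists>u\<in>D S. u \<odot>\<^bsub>ring_as_module R\<^esub> m = \<zero>\<^bsub>ring_as_module R\<^esub>" using u(1) by auto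
  then show "c S = \<zero>\<^bsub>C i\<^esub> S"
    unfolding zero_cochain[OF S] m(3) using F.fraction_eq_zero_iff[of m s] m by simp
qed

end

section \<open>Semilinear chain maps between Cech complexes\<close>

section \<open>Comparison of Cech complexes\<close>

text \<open>Equal lengths of the two sequences give equal index sets, so a cochain is mapped
  component by component. The instances are Frobenius on R, the projection to the ring R/J, and the
  projection to R/xR as a module over R.\<close>

locale cech_hom = A: cech R M fs + B: cech R' M' gs
  for R :: "('b, 'c) ring_scheme" and M :: "('b, 'm, 'd) module_scheme" and fs
    and R' :: "('a, 'c') ring_scheme" and M' :: "('a, 'n, 'd') module_scheme" and gs +
  fixes h :: "'m \<Rightarrow> 'n" and \<sigma> :: "'b \<Rightarrow> 'a"
  assumes length_eq: "length gs = length fs"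
    and frac_hom: "S \<subseteq> {..<length fs} \<Longrightarrow>
      frac_hom R M (denominators R fs S) R' M' (denominators R' gs S) h \<sigma>"
begin

lemma index_eq: "cech_index gs i = cech_index fs i"
  unfolding cech_index_def length_eq ..

definition cochain_map :: "nat \<Rightarrow> (nat set \<Rightarrow> ('m \<times> 'b) set) \<Rightarrow> nat set \<Rightarrow> ('n \<times> 'a) set" where
  "cochain_map i c = (\<lambda>S\<in>cech_index fs i. frac_map R' (denominators R' gs S) M' h \<sigma> (c S))"

lemma cochain_map_apply:
  "S \<in> cech_index fs i \<Longrightarrow> cochain_map i c S = frac_map R' (denominators R' gs S) M' h \<sigma> (c S)"
  unfolding cochain_map_def by simp

lemma cochain_map_closed:
  assumes "c \<in> carrier (A.C i)" shows "cochain_map i c \<in> carrier (B.C i)"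
  unfolding cochain_map_def index_eq[symmetric]
proof (rule B.cochainI)
  fix S assume "S \<in> cech_index gs i"
  then have S: "S \<in> cech_index fs i" unfolding index_eq .
  show "frac_map R' (denominators R' gs S) M' h \<sigma> (c S) \<in> carrier (B.L S)"
    by (rule frac_hom.frac_map_closed[OF frac_hom[OF A.index_subset[OF S]] A.cochain_apply[OF assms S]])
qed

lemma cochain_map_add:
  assumes "c \<in> carrier (A.C i)" "c' \<in> carrier (A.C i)"
  shows "cochain_map i (c \<oplus>\<^bsub>A.C i\<^esub> c') = cochain_map i c \<oplus>\<^bsub>B.C i\<^esub> cochain_map i c'"
proof (rule B.cochain_ext)
  show "cochain_map i (c \<oplus>\<^bsub>A.C i\<^esub> c') \<in> carrier (B.C i)"
    by (rule cochain_map_closed) (use assms in simp)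
  show "cochain_map i c \<oplus>\<^bsub>B.C i\<^esub> cochain_map i c' \<in> carrier (B.C i)"
    using cochain_map_closed[OF assms(1)] cochain_map_closed[OF assms(2)] by simp
  fix S assume S': "S \<in> cech_index gs i"
  then have S: "S \<in> cech_index fs i" unfolding index_eq .
  show "cochain_map i (c \<oplus>\<^bsub>A.C i\<^esub> c') S = (cochain_map i c \<oplus>\<^bsub>B.C i\<^esub> cochain_map i c') S"
    unfolding B.add_cochain[OF S'] cochain_map_apply[OF S] A.add_cochain[OF S]
    by (rule frac_hom.frac_map_add[OF frac_hom[OF A.index_subset[OF S]]
          A.cochain_apply[OF assms(1) S] A.cochain_apply[OF assms(2) S]])
qed

lemma cochain_map_smult:
  assumes "r \<in> carrier R" "c \<in> carrier (A.C i)"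
  shows "cochain_map i (r \<odot>\<^bsub>A.C i\<^esub> c) = \<sigma> r \<odot>\<^bsub>B.C i\<^esub> cochain_map i c"
proof (rule B.cochain_ext)
  have s: "\<sigma> r \<in> carrier R'" by (rule frac_hom.\<sigma>_closed[OF frac_hom[of "{}"] assms(1)]) simp
  show "cochain_map i (r \<odot>\<^bsub>A.C i\<^esub> c) \<in> carrier (B.C i)"
    by (rule cochain_map_closed) (use assms in simp)
  show "\<sigma> r \<odot>\<^bsub>B.C i\<^esub> cochain_map i c \<in> carrier (B.C i)"
    using cochain_map_closed[OF assms(2)] s by simp
  fix S assume S': "S \<in> cech_index gs i"
  then have S: "S \<in> cech_index fs i" unfolding index_eq .
  show "cochain_map i (r \<odot>\<^bsub>A.C i\<^esub> c) S = (\<sigma> r \<odot>\<^bsub>B.C i\<^esub> cochain_map i c) S"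
    unfolding B.smult_cochain[OF S'] cochain_map_apply[OF S] A.smult_cochain[OF S]
    by (rule frac_hom.frac_map_smult[OF frac_hom[OF A.index_subset[OF S]] assms(1)
          A.cochain_apply[OF assms(2) S]])
qed

lemma cochain_map_zero: "cochain_map i \<zero>\<^bsub>A.C i\<^esub> = \<zero>\<^bsub>B.C i\<^esub>"
proof (rule B.cochain_ext)
  fix S assume S': "S \<in> cech_index gs i"
  then have S: "S \<in> cech_index fs i" unfolding index_eq .
  show "cochain_map i \<zero>\<^bsub>A.C i\<^esub> S = \<zero>\<^bsub>B.C i\<^esub> S"
    unfolding B.zero_cochain[OF S'] cochain_map_apply[OF S] A.zero_cochain[OF S]
    by (rule frac_hom.frac_map_zero[OF frac_hom[OF A.index_subset[OF S]]])
qed (use cochain_map_closed in simp_all)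

lemma frac_map_finsum:
  assumes S: "S \<subseteq> {..<length fs}" and "finite A" "\<And>j. j \<in> A \<Longrightarrow> f j \<in> carrier (A.L S)"
  shows "frac_map R' (denominators R' gs S) M' h \<sigma> (\<Oplus>\<^bsub>A.L S\<^esub>j\<in>A. f j)
    = (\<Oplus>\<^bsub>B.L S\<^esub>j\<in>A. frac_map R' (denominators R' gs S) M' h \<sigma> (f j))"
proof -
  interpret F: frac_hom R M "denominators R fs S" R' M' "denominators R' gs S" h \<sigma> by (rule frac_hom[OF S])
  interpret S: module R "A.L S" by (rule A.module_L[OF S])
  interpret T: module R' "B.L S" by (rule B.module_L) (use S length_eq in simp)
  show ?thesis
    using assms(2,3)
  proof (induction A)
    case empty
    show ?case using F.frac_map_zero by simp
  next
    case (insert a A)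
    have f: "f \<in> A \<rightarrow> carrier (A.L S)" "f a \<in> carrier (A.L S)" using insert.prems by auto
    have "(\<lambda>j. frac_map R' (denominators R' gs S) M' h \<sigma> (f j)) \<in> A \<rightarrow> carrier (B.L S)"
      "frac_map R' (denominators R' gs S) M' h \<sigma> (f a) \<in> carrier (B.L S)"
      using insert.prems F.frac_map_closed by auto
    then show ?case
      using insert F.frac_map_add[OF f(2) S.finsum_closed[OF f(1)]] f
      by (simp add: S.finsum_insert T.finsum_insert)
  qed
qed

lemma cochain_map_diff:
  assumes c: "c \<in> carrier (A.C i)"
  shows "cochain_map (Suc i) (A.d i c) = B.d i (cochain_map i c)"
proof (rule B.cochain_ext)
  show "cochain_map (Suc i) (A.d i c) \<in> carrier (B.C (Suc i))"
    by (rule cochain_map_closed[OF A.diff_closed[OF c]])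
  show "B.d i (cochain_map i c) \<in> carrier (B.C (Suc i))"
    by (rule B.diff_closed[OF cochain_map_closed[OF c]])
  fix T assume T': "T \<in> cech_index gs (Suc i)"
  then have T: "T \<in> cech_index fs (Suc i)" unfolding index_eq .
  note Ts = A.index_subset[OF T] and Ts' = B.index_subset[OF T']
  interpret F: frac_hom R M "denominators R fs T" R' M' "denominators R' gs T" h \<sigma> by (rule frac_hom[OF Ts])
  interpret S: module R "A.L T" by (rule A.module_L[OF Ts])
  interpret T: module R' "B.L T" by (rule B.module_L[OF Ts'])
  let ?F = "\<lambda>S. frac_map R' (denominators R' gs S) M' h \<sigma>"
  have neg: "?F T (\<ominus>\<^bsub>A.L T\<^esub> U) = \<ominus>\<^bsub>B.L T\<^esub> ?F T U" if U: "U \<in> carrier (A.L T)" for U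
  proof -
    have "?F T (\<ominus>\<^bsub>A.L T\<^esub> U) \<oplus>\<^bsub>B.L T\<^esub> ?F T U = \<zero>\<^bsub>B.L T\<^esub>"
      using F.frac_map_add[of "\<ominus>\<^bsub>A.L T\<^esub> U" U] U F.frac_map_zero by (simp add: S.l_neg)
    then show ?thesis
      using T.minus_equality[of "?F T (\<ominus>\<^bsub>A.L T\<^esub> U)" "?F T U"] F.frac_map_closed U by simp
  qed
  \<comment> \<open>The signs of the two complexes are scalars of different rings. They are matched
    through negation in the modules, which an additive map respects, and not through the image of -1
    under \<open>\<sigma>\<close>.\<close>
  have sign: "?F T (A.sign T j \<odot>\<^bsub>A.L T\<^esub> U) = B.sign T j \<odot>\<^bsub>B.L T\<^esub> ?F T U" if U: "U \<in> carrier (A.L T)" for U j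
    using neg[OF U] U F.frac_map_closed[OF U]
    unfolding A.sign_def B.sign_def by (simp add: S.smult_l_minus T.smult_l_minus)
  have res: "?F T (A.res T U) = B.res T (?F S U)" if S: "S \<subseteq> T" and U: "U \<in> carrier (A.L S)" for S U
  proof -
    have Ss: "S \<subseteq> {..<length fs}" using S Ts by blast
    interpret G: frac_hom R M "denominators R fs S" R' M' "denominators R' gs S" h \<sigma> by (rule frac_hom[OF Ss])
    obtain m s where m: "m \<in> carrier M" "s \<in> denominators R fs S" "U = fraction R (denominators R fs S) M m s"
      using U by (rule G.A.localizationE)
    have sT: "s \<in> denominators R fs T" using A.denominators_mono[OF Ts S] m(2) by blast
    show ?thesis
      unfolding m(3) A.restrict_fraction[OF Ts S m(1,2)] F.frac_map_fraction[OF m(1) sT]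
        G.frac_map_fraction[OF m(1,2)]
      by (rule B.restrict_fraction[OF Ts' S G.h_closed[OF m(1)] G.\<sigma>_D[OF m(2)], symmetric])
  qed
  have "cochain_map (Suc i) (A.d i c) T = ?F T (\<Oplus>\<^bsub>A.L T\<^esub>j\<in>T. A.sign T j \<odot>\<^bsub>A.L T\<^esub> A.res T (c (T - {j})))"
    unfolding cochain_map_apply[OF T] A.diff_apply[OF c T] ..
  also have "\<dots> = (\<Oplus>\<^bsub>B.L T\<^esub>j\<in>T. ?F T (A.sign T j \<odot>\<^bsub>A.L T\<^esub> A.res T (c (T - {j}))))"
    by (rule frac_map_finsum[OF Ts A.index_finite[OF T]]) (use A.diff_term_closed[OF c T] in simp)
  also have "\<dots> = (\<Oplus>\<^bsub>B.L T\<^esub>j\<in>T. B.sign T j \<odot>\<^bsub>B.L T\<^esub> B.res T (cochain_map i c (T - {j})))"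
  proof (rule T.finsum_cong')
    fix j assume j: "j \<in> T"
    have "?F T (A.res T (c (T - {j}))) = B.res T (?F (T - {j}) (c (T - {j})))"
      by (rule res[OF _ A.cochain_apply[OF c A.index_remove[OF T j]]]) blast
    then show "?F T (A.sign T j \<odot>\<^bsub>A.L T\<^esub> A.res T (c (T - {j}))) =
        B.sign T j \<odot>\<^bsub>B.L T\<^esub> B.res T (cochain_map i c (T - {j}))"
      using sign[OF A.diff_term_closed[OF c T j], of j] cochain_map_apply[OF A.index_remove[OF T j]] by simp
  qed (use B.diff_term_closed[OF cochain_map_closed[OF c] T'] in simp_all)
  also have "\<dots> = B.d i (cochain_map i c) T"
    by (rule B.diff_apply[OF cochain_map_closed[OF c] T', symmetric])
  finally show "cochain_map (Suc i) (A.d i c) T = B.d i (cochain_map i c) T" .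
qed

lemma cochain_map_surj:
  assumes surj: "h ` carrier M = carrier M'"
    and D: "\<And>S. S \<subseteq> {..<length fs} \<Longrightarrow> \<sigma> ` denominators R fs S = denominators R' gs S"
    and c': "c' \<in> carrier (B.C i)"
  obtains c where "c \<in> carrier (A.C i)" "c' = cochain_map i c"
proof -
  let ?F = "\<lambda>S. frac_map R' (denominators R' gs S) M' h \<sigma>"
  have "\<forall>S\<in>cech_index fs i. \<exists>U. U \<in> carrier (A.L S) \<and> c' S = ?F S U"
  proof
    fix S assume S: "S \<in> cech_index fs i"
    then have S': "S \<in> cech_index gs i" unfolding index_eq .
    note Ss = A.index_subset[OF S]
    obtain U where "U \<in> carrier (A.L S)" "c' S = ?F S U"
      using frac_hom.frac_map_surj[OF frac_hom[OF Ss] surj D[OF Ss] B.cochain_apply[OF c' S']] by blast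
    then show "\<exists>U. U \<in> carrier (A.L S) \<and> c' S = ?F S U" by blast
  qed
  from bchoice[OF this] obtain f where f: "\<forall>S\<in>cech_index fs i. f S \<in> carrier (A.L S) \<and> c' S = ?F S (f S)" ..
  let ?c = "restrict f (cech_index fs i)"
  have c: "?c \<in> carrier (A.C i)" by (rule A.cochainI) (use f in blast)
  have "c' = cochain_map i ?c"
  proof (rule B.cochain_ext[OF c' cochain_map_closed[OF c]])
    fix S assume "S \<in> cech_index gs i"
    then have S: "S \<in> cech_index fs i" unfolding index_eq .
    show "c' S = cochain_map i ?c S" unfolding cochain_map_apply[OF S] using f S by simp
  qed
  with c show thesis by (rule that)
qed

lemma cochain_map_coboundaries:
  assumes "b \<in> A.coboundaries i" shows "cochain_map i b \<in> B.coboundaries i"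
proof (cases i)
  case 0
  then show ?thesis using assms cochain_map_zero by simp
next
  case (Suc j)
  then obtain a where a: "a \<in> carrier (A.C j)" "b = A.d j a" using assms by auto
  then show ?thesis unfolding Suc using cochain_map_diff[OF a(1)] cochain_map_closed[OF a(1)] by simp
qed

lemma cochain_map_coboundaries_surj:
  assumes surj: "h ` carrier M = carrier M'"
    and D: "\<And>S. S \<subseteq> {..<length fs} \<Longrightarrow> \<sigma> ` denominators R fs S = denominators R' gs S"
    and b': "b' \<in> B.coboundaries i"
  obtains b where "b \<in> A.coboundaries i" "b' = cochain_map i b"
proof (cases i)
  case 0
  show thesis
    by (rule that[of "\<zero>\<^bsub>A.C i\<^esub>"]) (use 0 b' cochain_map_zero in simp_all)
next
  case (Suc j)
  then obtain a' where a': "a' \<in> carrier (B.C j)" "b' = B.d j a'" using b' by auto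
  obtain a where a: "a \<in> carrier (A.C j)" "a' = cochain_map j a"
    using cochain_map_surj[OF surj D a'(1)] by blast
  show thesis
    by (rule that[of "A.d j a"]) (use a a'(2) Suc cochain_map_diff[OF a(1)] in simp_all)
qed

end

section \<open>The p-th power map and its action on the Cech complex\<close>

section \<open>Frobenius on the Cech complex\<close>

context cring
begin

lemma binomial_expansion:
  assumes a: "a \<in> carrier R" and b: "b \<in> carrier R"
  shows "(a \<oplus> b) [^] n = (\<Oplus>k\<in>{..n}. [(n choose k)] \<cdot> (a [^] k \<otimes> b [^] (n - k)))"
proof (induction n)
  case 0
  show ?case using a b by (simp add: Pi_def)
next
  case (Suc n)
  define T where "T n k = [(n choose k)] \<cdot> (a [^] k \<otimes> b [^] (n - k))" for n k :: nat
  have T: "T m k \<in> carrier R" for m k unfolding T_def using a b by simp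
  have T0: "T (Suc n) 0 = b \<otimes> T n 0"
    unfolding T_def using a b by (simp add: m_comm)
  have TS: "T (Suc n) (Suc k) = a \<otimes> T n k \<oplus> b \<otimes> T n (Suc k)" if "k \<le> n" for k
  proof -
    let ?y = "a [^] Suc k \<otimes> b [^] (n - k)"
    have y: "?y \<in> carrier R" using a b by simp
    have 1: "a \<otimes> T n k = [(n choose k)] \<cdot> ?y"
      unfolding T_def using a b by (simp add: add_pow_rdistr m_ac)
    \<comment> \<open>For k = n the binomial coefficient is zero, so the truncated exponent n - (n +
      1) does no harm. For k < n the exponent is genuinely lowered by one and the factor b restores
      it.\<close>
    have 2: "b \<otimes> T n (Suc k) = [(n choose Suc k)] \<cdot> ?y"
    proof (cases "k < n")
      case True
      then have "n - k = Suc (n - Suc k)" by simp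
      then show ?thesis unfolding T_def using a b by (simp add: add_pow_rdistr m_ac)
    next
      case False
      then have z: "n choose Suc k = 0" by simp
      show ?thesis unfolding T_def z using a b y by simp
    qed
    show ?thesis
      unfolding 1 2 unfolding T_def using add.nat_pow_mult[OF y, of "n choose k" "n choose Suc k"] by simp
  qed
  have Tn: "T n (Suc n) = \<zero>" unfolding T_def using a b by (simp add: binomial_eq_0)
  have Ta: "(\<Oplus>k\<in>{..n}. a \<otimes> T n k) = a \<otimes> (\<Oplus>k\<in>{..n}. T n k)"
    by (rule finsum_rdistr[symmetric]) (use a T in auto)
  have Tb: "(\<Oplus>k\<in>{..n}. b \<otimes> T n k) = b \<otimes> (\<Oplus>k\<in>{..n}. T n k)"
    by (rule finsum_rdistr[symmetric]) (use b T in auto)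
  have bT: "(\<lambda>k. b \<otimes> T n k) \<in> A \<rightarrow> carrier R" "(\<lambda>k. b \<otimes> T n (Suc k)) \<in> A \<rightarrow> carrier R"
    "(\<lambda>k. a \<otimes> T n k) \<in> A \<rightarrow> carrier R" for A using a b T by auto
  have "(\<Oplus>k\<in>{..n}. b \<otimes> T n (Suc k)) \<oplus> b \<otimes> T n 0 = (\<Oplus>k\<in>{..Suc n}. b \<otimes> T n k)"
    by (rule finsum_Suc2[symmetric, OF bT(1)])
  also have "\<dots> = b \<otimes> (\<Oplus>k\<in>{..n}. T n k)"
    using finsum_Suc[OF bT(1), of n] Tn Tb b T by (simp add: finsum_closed Pi_def)
  finally have s: "(\<Oplus>k\<in>{..n}. b \<otimes> T n (Suc k)) \<oplus> b \<otimes> T n 0 = b \<otimes> (\<Oplus>k\<in>{..n}. T n k)" .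
  have "(\<Oplus>k\<in>{..Suc n}. T (Suc n) k) = (\<Oplus>k\<in>{..n}. T (Suc n) (Suc k)) \<oplus> T (Suc n) 0"
    by (rule finsum_Suc2) (use T in auto)
  also have "(\<Oplus>k\<in>{..n}. T (Suc n) (Suc k)) = (\<Oplus>k\<in>{..n}. a \<otimes> T n k \<oplus> b \<otimes> T n (Suc k))"
    by (rule finsum_cong') (use TS a b T in auto)
  also have "\<dots> = (\<Oplus>k\<in>{..n}. a \<otimes> T n k) \<oplus> (\<Oplus>k\<in>{..n}. b \<otimes> T n (Suc k))"
    by (rule finsum_addf[OF bT(3,2)])
  also have "\<dots> \<oplus> T (Suc n) 0 = a \<otimes> (\<Oplus>k\<in>{..n}. T n k) \<oplus> b \<otimes> (\<Oplus>k\<in>{..n}. T n k)"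
    unfolding T0 s[symmetric] Ta[symmetric]
    by (rule a_assoc) (use a b T in \<open>auto intro!: finsum_closed\<close>)
  also have "\<dots> = (a \<oplus> b) \<otimes> (\<Oplus>k\<in>{..n}. T n k)"
    by (rule l_distr[symmetric]) (use a b T in \<open>auto intro!: finsum_closed\<close>)
  also have "(\<Oplus>k\<in>{..n}. T n k) = (a \<oplus> b) [^] n" unfolding T_def Suc.IH ..
  also have "(a \<oplus> b) \<otimes> (a \<oplus> b) [^] n = (a \<oplus> b) [^] Suc n" using a b by (simp add: m_comm)
  finally show ?case unfolding T_def by simp
qed

text \<open>The prime p divides every binomial coefficient except the two outer ones, and p
  annihilates the ring.\<close>

lemma freshmans_dream:
  assumes p: "Factorial_Ring.prime (p::nat)" "[p] \<cdot> \<one> = \<zero>"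
    and a: "a \<in> carrier R" and b: "b \<in> carrier R"
  shows "(a \<oplus> b) [^] p = a [^] p \<oplus> b [^] p"
proof -
  have "2 \<le> p" by (rule prime_ge_2_nat[OF p(1)])
  \<comment> \<open>Writing p = q + 2 isolates the two outer terms of the sum and leaves exactly the
    indices 1, ..., q + 1 for the divisibility argument.\<close>
  then obtain q where q: "p = Suc (Suc q)" by (metis add_2_eq_Suc le_Suc_ex)
  define T where "T k = [(p choose k)] \<cdot> (a [^] k \<otimes> b [^] (p - k))" for k :: nat
  have T: "T \<in> A \<rightarrow> carrier R" "(\<lambda>k. T (Suc k)) \<in> A \<rightarrow> carrier R" for A
    unfolding T_def using a b by auto
  have T0: "T (Suc k) = \<zero>" if "k \<le> q" for k
  proof -
    have "p dvd (p choose Suc k)"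
      by (rule dvd_choose_prime) (use p that q in auto)
    then obtain m where m: "p choose Suc k = p * m" by blast
    let ?y = "a [^] Suc k \<otimes> b [^] (p - Suc k)"
    have y: "?y \<in> carrier R" using a b by simp
    have "[p] \<cdot> ?y = ([p] \<cdot> \<one>) \<otimes> ?y" using y by (simp add: add_pow_ldistr)
    then have "[p] \<cdot> ?y = \<zero>" using p(2) y by simp
    then have "[(p * m)] \<cdot> ?y = \<zero>" using add.nat_pow_pow[OF y, of m p] by simp
    then show ?thesis unfolding T_def m by simp
  qed
  have z: "(\<Oplus>k\<in>{..q}. T (Suc k)) = \<zero>"
    by (rule add.finprod_one_eqI) (use T0 in auto)
  have "(a \<oplus> b) [^] p = (\<Oplus>k\<in>{..Suc (Suc q)}. T k)"
    unfolding T_def binomial_expansion[OF a b] q ..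
  also have "\<dots> = (\<Oplus>k\<in>{..Suc q}. T (Suc k)) \<oplus> T 0" by (rule finsum_Suc2[OF T(1)])
  also have "(\<Oplus>k\<in>{..Suc q}. T (Suc k)) = T (Suc (Suc q)) \<oplus> (\<Oplus>k\<in>{..q}. T (Suc k))"
    by (rule finsum_Suc[OF T(2)])
  also have "\<dots> = a [^] p" unfolding z unfolding T_def using a b q by simp
  also have "T 0 = b [^] p" unfolding T_def using a b by simp
  finally show ?thesis .
qed

end

locale frobenius_cech = ring_cech R fs for R :: "('a, 'c) ring_scheme" (structure) and fs +
  fixes p :: nat
  assumes prime_p: "Factorial_Ring.prime p" and char_p: "[p] \<cdot> \<one> = \<zero>"
begin

abbreviation "\<phi> i \<equiv> cech_frobenius p R fs i"

lemma frobenius_add: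
  "\<lbrakk>a \<in> carrier R; b \<in> carrier R\<rbrakk> \<Longrightarrow> (a \<oplus> b) [^] p = a [^] p \<oplus> b [^] p"
  by (rule R.freshmans_dream[OF prime_p char_p])

lemma denominators_pow:
  assumes S: "S \<subseteq> {..<length fs}" and a: "a \<in> D S" shows "a [^] (n::nat) \<in> D S"
  by (induction n) (simp_all add: denominators_one denominators_mult[OF S _ a])

lemma frobenius_cech_hom:
  "cech_hom R (ring_as_module R) fs R (ring_as_module R) fs (\<lambda>a. a [^] p) (\<lambda>a. a [^] p)"
proof (intro cech_hom.intro cech_hom_axioms.intro cech_axioms refl)
  fix S assume S: "S \<subseteq> {..<length fs}"
  show "frac_hom R (ring_as_module R) (D S) R (ring_as_module R) (D S) (\<lambda>a. a [^] p) (\<lambda>a. a [^] p)"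
    by (intro frac_hom.intro frac_hom_axioms.intro fractions[OF S])
      (simp_all add: frobenius_add R.nat_pow_distrib denominators_pow[OF S])
qed

sublocale F: cech_hom R "ring_as_module R" fs R "ring_as_module R" fs "\<lambda>a. a [^] p" "\<lambda>a. a [^] p"
  by (rule frobenius_cech_hom)

lemma cech_frobenius_eq: "\<phi> i = F.cochain_map i"
  unfolding cech_frobenius_def F.cochain_map_def frac_map_def by simp

lemmas \<phi>_closed = F.cochain_map_closed[folded cech_frobenius_eq]
  and \<phi>_add = F.cochain_map_add[folded cech_frobenius_eq]
  and \<phi>_smult = F.cochain_map_smult[folded cech_frobenius_eq]
  and \<phi>_zero = F.cochain_map_zero[folded cech_frobenius_eq]
  and \<phi>_diff = F.cochain_map_diff[folded cech_frobenius_eq]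
  and \<phi>_coboundaries = F.cochain_map_coboundaries[folded cech_frobenius_eq]

lemma frobenius_action_coset:
  assumes z: "z \<in> carrier (C i)"
  shows "frobenius_action p R fs i (coboundaries i +>\<^bsub>C i\<^esub> z) = coboundaries i +>\<^bsub>C i\<^esub> \<phi> i z"
  unfolding frobenius_action_def coboundaries_eq[symmetric]
proof (rule UN_constant)
  note B = submodule_coboundaries[of i]
  have "z = \<zero>\<^bsub>C i\<^esub> \<oplus>\<^bsub>C i\<^esub> z" using z by simp
  then show "z \<in> coboundaries i +>\<^bsub>C i\<^esub> z"
    unfolding K.mem_coset_iff using K.submodule_zero[OF B] by blast
  fix c assume "c \<in> coboundaries i +>\<^bsub>C i\<^esub> z"
  then obtain b where b: "b \<in> coboundaries i" "c = b \<oplus>\<^bsub>C i\<^esub> z" unfolding K.mem_coset_iff by blast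
  have bc: "b \<in> carrier (C i)" by (rule coboundaries_subset[OF b(1)])
  have "\<phi> i c \<ominus>\<^bsub>C i\<^esub> \<phi> i z = \<phi> i b"
    unfolding b(2) \<phi>_add[OF bc z] by (rule K.add_diff_cancel(1)[OF \<phi>_closed[OF bc] \<phi>_closed[OF z]])
  then show "coboundaries i +>\<^bsub>C i\<^esub> \<phi> i c = coboundaries i +>\<^bsub>C i\<^esub> \<phi> i z"
    using K.coset_eq_iff[OF B, of "\<phi> i c" "\<phi> i z"] \<phi>_coboundaries[OF b(1)] \<phi>_closed b(2) bc z by simp
qed

text \<open>Frobenius is additive on cohomology, so injectivity is triviality of the kernel. This
  moves the statement from cosets to cochains, where the abstract complexes work.\<close>

lemma inj_frobenius_action_iff:
  "inj_on (frobenius_action p R fs i) (carrier (local_cohomology R fs (ring_as_module R) i)) \<longleftrightarrow>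
    (\<forall>z\<in>carrier (C i). d i z = \<zero>\<^bsub>C (Suc i)\<^esub> \<longrightarrow> \<phi> i z \<in> coboundaries i \<longrightarrow> z \<in> coboundaries i)"
  (is "?inj \<longleftrightarrow> ?ker")
proof -
  note B = submodule_coboundaries[of i]
  have car: "carrier (local_cohomology R fs (ring_as_module R) i) =
      (\<lambda>z. coboundaries i +>\<^bsub>C i\<^esub> z) ` {z \<in> carrier (C i). d i z = \<zero>\<^bsub>C (Suc i)\<^esub>}"
    unfolding local_cohomology_def subquotient_def coboundaries_eq cech_cocycles_def by simp
  show ?thesis
  proof
    assume inj: ?inj
    show ?ker
    proof (intro ballI impI)
      fix z assume z: "z \<in> carrier (C i)" "d i z = \<zero>\<^bsub>C (Suc i)\<^esub>" "\<phi> i z \<in> coboundaries i"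
      have "frobenius_action p R fs i (coboundaries i +>\<^bsub>C i\<^esub> z)
          = frobenius_action p R fs i (coboundaries i +>\<^bsub>C i\<^esub> \<zero>\<^bsub>C i\<^esub>)"
        unfolding frobenius_action_coset[OF z(1)] frobenius_action_coset[OF K.zero_closed]
        unfolding \<phi>_zero K.coset_zero[OF B]
        using K.coset_eq_self_iff[OF B \<phi>_closed[OF z(1)]] z(3) by simp
      then have "coboundaries i +>\<^bsub>C i\<^esub> z = coboundaries i +>\<^bsub>C i\<^esub> \<zero>\<^bsub>C i\<^esub>"
        by (rule inj_onD[OF inj]) (use z d_zero in \<open>simp_all add: car\<close>)
      then show "z \<in> coboundaries i"
        unfolding K.coset_zero[OF B] K.coset_eq_self_iff[OF B z(1)] .
    qed
  next
    assume ker: ?ker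
    show ?inj
    proof (rule inj_onI)
      fix U V assume "U \<in> carrier (local_cohomology R fs (ring_as_module R) i)"
        "V \<in> carrier (local_cohomology R fs (ring_as_module R) i)"
      then obtain u v where u: "u \<in> carrier (C i)" "d i u = \<zero>\<^bsub>C (Suc i)\<^esub>" "U = coboundaries i +>\<^bsub>C i\<^esub> u"
        and v: "v \<in> carrier (C i)" "d i v = \<zero>\<^bsub>C (Suc i)\<^esub>" "V = coboundaries i +>\<^bsub>C i\<^esub> v"
        unfolding car by blast
      assume "frobenius_action p R fs i U = frobenius_action p R fs i V"
      then have *: "\<phi> i u \<ominus>\<^bsub>C i\<^esub> \<phi> i v \<in> coboundaries i"
        unfolding u(3) v(3) frobenius_action_coset[OF u(1)] frobenius_action_coset[OF v(1)]
        using K.coset_eq_iff[OF B \<phi>_closed[OF u(1)] \<phi>_closed[OF v(1)]] by simp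
      let ?w = "u \<ominus>\<^bsub>C i\<^esub> v"
      have w: "?w \<in> carrier (C i)" using u(1) v(1) by simp
      have "\<phi> i ?w \<oplus>\<^bsub>C i\<^esub> \<phi> i v = \<phi> i u"
        unfolding \<phi>_add[OF w v(1), symmetric] K.diff_add_cancel[OF u(1) v(1)] ..
      then have "\<phi> i ?w = \<phi> i u \<ominus>\<^bsub>C i\<^esub> \<phi> i v"
        using K.add_diff_cancel(1)[OF \<phi>_closed[OF w] \<phi>_closed[OF v(1)]] by simp
      then have "\<phi> i ?w \<in> coboundaries i" using * by simp
      moreover have "d i ?w = \<zero>\<^bsub>C (Suc i)\<^esub>"
        unfolding d_diff[OF u(1) v(1)] u(2) v(2)
        using K.add_diff_cancel(1)[OF K.zero_closed K.zero_closed] by simp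
      ultimately have "?w \<in> coboundaries i" using ker w by blast
      then show "U = V" unfolding u(3) v(3) using K.coset_eq_iff[OF B u(1) v(1)] by simp
    qed
  qed
qed

end

context frobenius_cech
begin

lemma frobenius_pow_add:
  assumes "a \<in> carrier R" "b \<in> carrier R"
  shows "(a \<oplus> b) [^] (p ^ e) = a [^] (p ^ e) \<oplus> b [^] (p ^ e)"
proof (induction e)
  case 0
  then show ?case using assms by simp
next
  case (Suc e)
  have s: "(c [^] (p ^ e)) [^] p = c [^] (p ^ Suc e)" if "c \<in> carrier R" for c
    using that by (simp add: R.nat_pow_pow mult.commute)
  have "(a \<oplus> b) [^] (p ^ Suc e) = (a [^] (p ^ e) \<oplus> b [^] (p ^ e)) [^] p"
    using s[of "a \<oplus> b"] Suc assms by simp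
  also have "\<dots> = a [^] (p ^ Suc e) \<oplus> b [^] (p ^ Suc e)"
    using frobenius_add[of "a [^] (p ^ e)" "b [^] (p ^ e)"] s assms by simp
  finally show ?case .
qed

text \<open>Among powers of the form r^(p^e), the elements r that move \<open>c\<close> into
  \<open>W\<close> are closed under sums, because the p^e-th power is additive. They thus form an
  ideal, and torsion with respect to the generators passes to the whole ideal without counting
  exponents.\<close>

lemma torsion_ideal:
  assumes W: "submodule W R (C i)" and c: "c \<in> carrier (C i)"
    and gens: "\<And>f. f \<in> set fs \<Longrightarrow> \<exists>n::nat. (f [^] n) \<odot>\<^bsub>C i\<^esub> c \<in> W"
    and r: "r \<in> Idl (set fs)"
  shows "\<exists>n::nat. (r [^] n) \<odot>\<^bsub>C i\<^esub> c \<in> W"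
proof -
  have mono: "(a [^] n) \<odot>\<^bsub>C i\<^esub> c \<in> W" if a: "a \<in> carrier R" and "m \<le> n" "(a [^] m) \<odot>\<^bsub>C i\<^esub> c \<in> W"
    for a and m n :: nat
  proof -
    have "a [^] n = a [^] (n - m) \<otimes> a [^] m" using that by (simp add: R.nat_pow_mult)
    then have "(a [^] n) \<odot>\<^bsub>C i\<^esub> c = (a [^] (n - m)) \<odot>\<^bsub>C i\<^esub> ((a [^] m) \<odot>\<^bsub>C i\<^esub> c)"
      using a c by (simp add: K.smult_assoc1)
    then show ?thesis using K.submoduleE(4)[OF W _ that(3), of "a [^] (n - m)"] a by simp
  qed
  have p2: "2 \<le> p" by (rule prime_ge_2_nat[OF prime_p])
  have le: "n \<le> p ^ n" for n using power_gt_expt[of p n] p2 by simp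
  define T where "T = {r \<in> carrier R. \<exists>e. (r [^] (p ^ e)) \<odot>\<^bsub>C i\<^esub> c \<in> W}"
  have "ideal T R"
  proof (rule R.cring_idealI)
    show "T \<subseteq> carrier R" unfolding T_def by blast
    have "(\<zero> [^] (p ^ 0)) \<odot>\<^bsub>C i\<^esub> c \<in> W" using c K.submodule_zero[OF W] by simp
    then show "\<zero> \<in> T" unfolding T_def by blast
    fix a b assume b: "b \<in> T"
    obtain e where bR: "b \<in> carrier R" and e: "(b [^] (p ^ e)) \<odot>\<^bsub>C i\<^esub> c \<in> W" using b unfolding T_def by blast
    {
      assume "a \<in> T"
      then obtain e' where aR: "a \<in> carrier R" and e': "(a [^] (p ^ e')) \<odot>\<^bsub>C i\<^esub> c \<in> W" unfolding T_def by blast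
      have pow: "p ^ e \<le> p ^ (e + e')" "p ^ e' \<le> p ^ (e + e')"
        using p2 by (simp_all add: power_increasing)
      have A: "(a [^] (p ^ (e + e'))) \<odot>\<^bsub>C i\<^esub> c \<in> W" by (rule mono[OF aR pow(2) e'])
      have B: "(b [^] (p ^ (e + e'))) \<odot>\<^bsub>C i\<^esub> c \<in> W" by (rule mono[OF bR pow(1) e])
      have "((a \<oplus> b) [^] (p ^ (e + e'))) \<odot>\<^bsub>C i\<^esub> c
          = (a [^] (p ^ (e + e'))) \<odot>\<^bsub>C i\<^esub> c \<oplus>\<^bsub>C i\<^esub> (b [^] (p ^ (e + e'))) \<odot>\<^bsub>C i\<^esub> c"
        unfolding frobenius_pow_add[OF aR bR] by (rule K.smult_l_distr) (use aR bR c in simp_all)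
      then have "((a \<oplus> b) [^] (p ^ (e + e'))) \<odot>\<^bsub>C i\<^esub> c \<in> W"
        using K.submoduleE(5)[OF W A B] by simp
      then show "a \<oplus> b \<in> T" unfolding T_def using aR bR by blast
    }
    {
      assume aR: "a \<in> carrier R"
      have "((a \<otimes> b) [^] (p ^ e)) \<odot>\<^bsub>C i\<^esub> c = (a [^] (p ^ e)) \<odot>\<^bsub>C i\<^esub> ((b [^] (p ^ e)) \<odot>\<^bsub>C i\<^esub> c)"
        using aR bR c by (simp add: R.nat_pow_distrib K.smult_assoc1)
      then have "((a \<otimes> b) [^] (p ^ e)) \<odot>\<^bsub>C i\<^esub> c \<in> W"
        using K.submoduleE(4)[OF W _ e, of "a [^] (p ^ e)"] aR by simp
      then show "a \<otimes> b \<in> T" unfolding T_def using aR bR by blast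
    }
  qed
  moreover have "set fs \<subseteq> T"
  proof
    fix f assume f: "f \<in> set fs"
    have fR: "f \<in> carrier R" using f fs_subset by blast
    obtain n :: nat where "(f [^] n) \<odot>\<^bsub>C i\<^esub> c \<in> W" using gens[OF f] by blast
    then have "(f [^] (p ^ n)) \<odot>\<^bsub>C i\<^esub> c \<in> W" by (rule mono[OF fR le])
    then show "f \<in> T" unfolding T_def using fR by blast
  qed
  ultimately have "Idl (set fs) \<subseteq> T" by (rule R.genideal_minimal)
  then show ?thesis using r unfolding T_def by blast
qed

end

section \<open>Reduction to R/Q as a module and as a ring, and transport of the hypotheses\<close>

section \<open>Reduction modulo an element\<close>

text \<open>\<open>Q\<close> is the ideal that becomes zero in \<open>M'\<close>, so \<open>M'\<close> is \<open>R/Q\<close>, as a module over \<open>R\<close> or over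
  itself.\<close>

locale cech_quotient = cech_hom R "ring_as_module R" fs R' M' gs h \<sigma> + A: ring_cech R fs
  for R :: "('b, 'c) ring_scheme" and fs
    and R' :: "('a, 'c') ring_scheme" and M' :: "('a, 'n, 'd') module_scheme" and gs
    and h :: "'b \<Rightarrow> 'n" and \<sigma> +
  fixes Q :: "'b set"
  assumes Q: "ideal Q R"
    and h_surj: "h ` carrier R = carrier M'"
    and denominators_surj: "S \<subseteq> {..<length fs} \<Longrightarrow> \<sigma> ` denominators R fs S = denominators R' gs S"
    and kernel: "a \<in> carrier R \<Longrightarrow> h a = \<zero>\<^bsub>M'\<^esub> \<longleftrightarrow> a \<in> Q"
begin

text \<open>The kernel of the reduction is Q C^i. In each component this is exactness of
  localization: the image of m/s is zero exactly when some denominator carries m into Q.\<close>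

lemma cochain_map_eq_zero_iff:
  assumes c: "c \<in> carrier (A.C i)"
  shows "cochain_map i c = \<zero>\<^bsub>B.C i\<^esub> \<longleftrightarrow> c \<in> A.extended Q i"
proof -
  have comp: "cochain_map i c S = \<zero>\<^bsub>B.C i\<^esub> S \<longleftrightarrow> c S \<in> A.extension Q S" if S: "S \<in> cech_index fs i" for S
  proof -
    note Ss = A.index_subset[OF S]
    have S': "S \<in> cech_index gs i" using S index_eq by simp
    interpret F: frac_hom R "ring_as_module R" "denominators R fs S" R' M' "denominators R' gs S" h \<sigma>
      by (rule frac_hom[OF Ss])
    obtain m s where m: "m \<in> carrier R" "s \<in> denominators R fs S"
      "c S = fraction R (denominators R fs S) (ring_as_module R) m s"
      using A.LE[OF Ss A.cochain_apply[OF c S]] by blast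
    have mM: "m \<in> carrier (ring_as_module R)" using m(1) by simp
    have "cochain_map i c S = \<zero>\<^bsub>B.C i\<^esub> S \<longleftrightarrow>
        fraction R' (denominators R' gs S) M' (h m) (\<sigma> s) = \<zero>\<^bsub>B.L S\<^esub>"
      unfolding cochain_map_apply[OF S] B.zero_cochain[OF S'] m(3) F.frac_map_fraction[OF mM m(2)] ..
    also have "\<dots> \<longleftrightarrow> (\<exists>u\<in>denominators R' gs S. u \<odot>\<^bsub>M'\<^esub> h m = \<zero>\<^bsub>M'\<^esub>)"
      by (rule F.B.fraction_eq_zero_iff[OF F.h_closed[OF mM] F.\<sigma>_D[OF m(2)]])
    also have "\<dots> \<longleftrightarrow> (\<exists>u\<in>denominators R fs S. \<sigma> u \<odot>\<^bsub>M'\<^esub> h m = \<zero>\<^bsub>M'\<^esub>)"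
      unfolding denominators_surj[OF Ss, symmetric] by blast
    also have "\<dots> \<longleftrightarrow> (\<exists>u\<in>denominators R fs S. u \<otimes>\<^bsub>R\<^esub> m \<in> Q)"
    proof (rule bex_cong[OF refl])
      fix u assume "u \<in> denominators R fs S"
      then have u: "u \<in> carrier R" by (rule A.denominators_closed[OF Ss])
      show "(\<sigma> u \<odot>\<^bsub>M'\<^esub> h m = \<zero>\<^bsub>M'\<^esub>) = (u \<otimes>\<^bsub>R\<^esub> m \<in> Q)"
        using F.h_smult[OF u mM] kernel[of "u \<otimes>\<^bsub>R\<^esub> m"] u m(1) by simp
    qed
    also have "\<dots> \<longleftrightarrow> c S \<in> A.extension Q S"
      unfolding m(3) by (rule A.fraction_extension_iff[OF Ss Q m(1,2), symmetric])
    finally show ?thesis .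
  qed
  have "cochain_map i c = \<zero>\<^bsub>B.C i\<^esub> \<longleftrightarrow> (\<forall>S\<in>cech_index fs i. cochain_map i c S = \<zero>\<^bsub>B.C i\<^esub> S)"
    using B.cochain_ext[OF cochain_map_closed[OF c] B.K.zero_closed] index_eq by metis
  then show ?thesis using comp c unfolding A.extended_def by auto
qed

lemma cochain_map_cocycle_iff:
  assumes c: "c \<in> carrier (A.C i)"
  shows "B.d i (cochain_map i c) = \<zero>\<^bsub>B.C (Suc i)\<^esub> \<longleftrightarrow> A.d i c \<in> A.extended Q (Suc i)"
  unfolding cochain_map_diff[OF c, symmetric]
  by (rule cochain_map_eq_zero_iff[OF A.diff_closed[OF c]])

text \<open>The reduction is surjective on cochains, so a coboundary over the quotient comes from
  one over R, and the difference of two preimages lies in Q C^i.\<close>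

lemma cochain_map_coboundary_iff:
  assumes c: "c \<in> carrier (A.C i)"
  shows "cochain_map i c \<in> B.coboundaries i \<longleftrightarrow> c \<in> A.coboundaries i <+>\<^bsub>A.C i\<^esub> A.extended Q i"
proof
  note E = A.submodule_extended[OF Q, of i]
  {
    assume "cochain_map i c \<in> B.coboundaries i"
    then obtain b where b: "b \<in> A.coboundaries i" "cochain_map i c = cochain_map i b"
      using cochain_map_coboundaries_surj[OF _ denominators_surj] h_surj by auto
    have bc: "b \<in> carrier (A.C i)" by (rule A.coboundaries_subset[OF b(1)])
    let ?e = "c \<ominus>\<^bsub>A.C i\<^esub> b"
    have e: "?e \<in> carrier (A.C i)" using c bc by simp
    have ec: "cochain_map i ?e \<in> carrier (B.C i)" by (rule cochain_map_closed[OF e])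
    have "cochain_map i ?e \<oplus>\<^bsub>B.C i\<^esub> cochain_map i b = cochain_map i b"
      unfolding cochain_map_add[OF e bc, symmetric] A.K.diff_add_cancel[OF c bc] b(2) ..
    then have "cochain_map i ?e = \<zero>\<^bsub>B.C i\<^esub>"
      using ec cochain_map_closed[OF bc] by simp
    then have "?e \<in> A.extended Q i" using cochain_map_eq_zero_iff[OF e] by simp
    moreover have "c = b \<oplus>\<^bsub>A.C i\<^esub> ?e"
      using A.K.diff_add_cancel[OF c bc] A.K.a_comm[OF bc e] by simp
    ultimately show "c \<in> A.coboundaries i <+>\<^bsub>A.C i\<^esub> A.extended Q i"
      unfolding A.K.set_add_iff using b(1) by blast
  next
    assume "c \<in> A.coboundaries i <+>\<^bsub>A.C i\<^esub> A.extended Q i"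
    then obtain b e where be: "b \<in> A.coboundaries i" "e \<in> A.extended Q i" "c = b \<oplus>\<^bsub>A.C i\<^esub> e"
      unfolding A.K.set_add_iff by blast
    have bc: "b \<in> carrier (A.C i)" by (rule A.coboundaries_subset[OF be(1)])
    have ec: "e \<in> carrier (A.C i)" by (rule A.K.submodule_subset[OF E be(2)])
    have "cochain_map i c = cochain_map i b"
      using cochain_map_add[OF bc ec] cochain_map_eq_zero_iff[OF ec] be(2,3) cochain_map_closed[OF bc] by simp
    then show "cochain_map i c \<in> B.coboundaries i" using cochain_map_coboundaries[OF be(1)] by simp
  }
qed

end

text \<open>Two versions of the reduction are required. FLC speaks of R/xR as a module over R,
  localized at denominators from R, so \<open>\<sigma>\<close> is the identity here. F-injectivity
  speaks of the ring R/xR, where \<open>\<sigma>\<close> is the projection.\<close>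

locale cech_module_quotient = cech_quotient R fs R M' fs h "\<lambda>r. r" Q
  for R :: "('a, 'c) ring_scheme" and fs and M' :: "('a, 'n, 'd) module_scheme" and h and Q
begin

text \<open>Submodules of cochains between the two bounds are sent to submodules of the local
  cohomology of the quotient. Strictness of inclusions survives because the lower bound is the full
  set of cochains with zero class, so a chain upstairs is no longer than one downstairs.\<close>

lemma finite_length_imp_bounded_chains:
  assumes fl: "finite_length R (local_cohomology R fs M' i)"
  shows "bounded_chains R (A.C i) (A.coboundaries i <+>\<^bsub>A.C i\<^esub> A.extended Q i)
    {c \<in> carrier (A.C i). A.d i c \<in> A.extended Q (Suc i)}"
proof -
  let ?H = "local_cohomology R fs M' i" and ?q = "\<lambda>c. B.coboundaries i +>\<^bsub>B.C i\<^esub> cochain_map i c"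
  let ?W = "A.coboundaries i <+>\<^bsub>A.C i\<^esub> A.extended Q i"
  let ?Z = "{c \<in> carrier (A.C i). A.d i c \<in> A.extended Q (Suc i)}"
  let ?Z' = "{c \<in> carrier (B.C i). B.d i c = \<zero>\<^bsub>B.C (Suc i)\<^esub>}"
  note B' = B.submodule_coboundaries[of i]
  have H_eq: "?H = subquotient (B.C i) ?Z' (B.coboundaries i)"
    unfolding local_cohomology_def cech_cocycles_def B.coboundaries_eq ..
  interpret H: module R ?H
    unfolding H_eq by (rule B.K.module_subquotient[OF B' B.submodule_cocycles])
  obtain n :: nat where n: "\<And>N k. (\<forall>j\<le>k. submodule (N j) R ?H) \<and> (\<forall>j<k. N j \<subset> N (Suc j)) \<Longrightarrow> k \<le> n"
    using fl unfolding finite_length_def by metis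
  have submod: "submodule (?q ` N) R ?H" if N: "submodule N R (A.C i)" and NZ: "N \<subseteq> ?Z" for N
  proof -
    note Nc = A.K.submodule_subset[OF N] and N' = A.K.submoduleE[OF N]
    have m: "cochain_map i c \<in> ?Z'" if "c \<in> N" for c
      using NZ that cochain_map_cocycle_iff[of c i] cochain_map_closed[of c i] by blast
    have mc: "cochain_map i c \<in> carrier (B.C i)" if "c \<in> N" for c using m[OF that] by blast
    have smult: "r \<odot>\<^bsub>?H\<^esub> U \<in> ?q ` N" if r: "r \<in> carrier R" and U: "U \<in> ?q ` N" for r U
    proof -
      obtain c where c: "c \<in> N" "U = ?q c" using U by blast
      have "r \<odot>\<^bsub>?H\<^esub> U = ?q (r \<odot>\<^bsub>A.C i\<^esub> c)"
        unfolding c(2) H_eq B.K.subquotient_simps B.K.coset_smult[OF B' r mc[OF c(1)]]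
          cochain_map_smult[OF r Nc[OF c(1)]] ..
      then show ?thesis using N'(4)[OF r c(1)] by blast
    qed
    show ?thesis
    proof (rule H.submoduleI)
      show car: "?q ` N \<subseteq> carrier ?H"
        unfolding H_eq B.K.subquotient_simps using m by blast
      have "\<zero>\<^bsub>?H\<^esub> = ?q \<zero>\<^bsub>A.C i\<^esub>"
        unfolding H_eq B.K.subquotient_simps cochain_map_zero B.K.coset_zero[OF B'] ..
      then show "\<zero>\<^bsub>?H\<^esub> \<in> ?q ` N" using A.K.submodule_zero[OF N] by blast
      show "\<ominus>\<^bsub>?H\<^esub> U \<in> ?q ` N" if U: "U \<in> ?q ` N" for U
      proof -
        have "U \<in> carrier ?H" using U car by (rule rev_subsetD)
        then show ?thesis using smult[OF _ U, of "\<ominus>\<^bsub>R\<^esub> \<one>\<^bsub>R\<^esub>"] by (simp add: H.smult_l_minus)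
      qed
      show "U \<oplus>\<^bsub>?H\<^esub> V \<in> ?q ` N" if U: "U \<in> ?q ` N" and V: "V \<in> ?q ` N" for U V
      proof -
        obtain c where c: "c \<in> N" "U = ?q c" using U by blast
        obtain c' where c': "c' \<in> N" "V = ?q c'" using V by blast
        have "U \<oplus>\<^bsub>?H\<^esub> V = ?q (c \<oplus>\<^bsub>A.C i\<^esub> c')"
          unfolding c(2) c'(2) H_eq B.K.subquotient_simps B.K.coset_add[OF B' mc[OF c(1)] mc[OF c'(1)]]
            cochain_map_add[OF Nc[OF c(1)] Nc[OF c'(1)]] ..
        then show ?thesis using N'(5)[OF c(1) c'(1)] by blast
      qed
    qed (rule smult)
  qed
  have strict: "?q ` N \<subset> ?q ` N'"
    if N: "submodule N R (A.C i)" "?W \<subseteq> N" and N': "submodule N' R (A.C i)" and less: "N \<subset> N'" for N N'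
  proof -
    note Nc = A.K.submodule_subset[OF N(1)] and N'c = A.K.submodule_subset[OF N']
    obtain c where c: "c \<in> N'" "c \<notin> N" using less by blast
    have "?q c \<notin> ?q ` N"
    proof
      assume "?q c \<in> ?q ` N"
      then obtain c' where c': "c' \<in> N" "?q c = ?q c'" by blast
      let ?u = "c \<ominus>\<^bsub>A.C i\<^esub> c'"
      have u: "?u \<in> carrier (A.C i)" using N'c[OF c(1)] Nc[OF c'(1)] by simp
      have "cochain_map i ?u \<oplus>\<^bsub>B.C i\<^esub> cochain_map i c' = cochain_map i c"
        unfolding cochain_map_add[OF u Nc[OF c'(1)], symmetric]
          A.K.diff_add_cancel[OF N'c[OF c(1)] Nc[OF c'(1)]] ..
      then have "cochain_map i ?u = cochain_map i c \<ominus>\<^bsub>B.C i\<^esub> cochain_map i c'"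
        using B.K.add_diff_cancel(1)[OF cochain_map_closed[OF u] cochain_map_closed[OF Nc[OF c'(1)]]] by simp
      moreover have "cochain_map i c \<ominus>\<^bsub>B.C i\<^esub> cochain_map i c' \<in> B.coboundaries i"
        using c'(2) B.K.coset_eq_iff[OF B' cochain_map_closed[OF N'c[OF c(1)]] cochain_map_closed[OF Nc[OF c'(1)]]]
        by simp
      ultimately have "cochain_map i ?u \<in> B.coboundaries i" by simp
      then have "?u \<in> N" using cochain_map_coboundary_iff[OF u] N(2) by blast
      then have "?u \<oplus>\<^bsub>A.C i\<^esub> c' \<in> N" by (rule A.K.submoduleE(5)[OF N(1) _ c'(1)])
      then show False using A.K.diff_add_cancel[OF N'c[OF c(1)] Nc[OF c'(1)]] c(2) by simp
    qed
    then show ?thesis using less c(1) by blast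
  qed
  show ?thesis
    unfolding bounded_chains_def
  proof (intro exI[of _ n] allI impI)
    fix N :: "nat \<Rightarrow> (nat set \<Rightarrow> ('a \<times> 'a) set) set" and k
    assume N: "(\<forall>j\<le>k. submodule (N j) R (A.C i) \<and> ?W \<subseteq> N j \<and> N j \<subseteq> ?Z) \<and> (\<forall>j<k. N j \<subset> N (Suc j))"
    show "k \<le> n"
    proof (rule n[of k "\<lambda>j. ?q ` N j"], intro conjI allI impI)
      fix j assume "j \<le> k"
      then have "submodule (N j) R (A.C i)" "N j \<subseteq> ?Z" using N by blast+
      then show "submodule (?q ` N j) R ?H" by (rule submod)
    next
      fix j assume j: "j < k"
      then have "submodule (N j) R (A.C i)" "?W \<subseteq> N j" using N by (meson less_imp_le)+
      moreover have "submodule (N (Suc j)) R (A.C i)" "N j \<subset> N (Suc j)" using N j by (meson Suc_leI)+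
      ultimately show "?q ` N j \<subset> ?q ` N (Suc j)" by (rule strict)
    qed
  qed
qed

end

lemma carrier_FactRing: "carrier (R Quot J) = (\<lambda>a. J +>\<^bsub>R\<^esub> a) ` carrier R"
  unfolding FactRing_def A_RCOSETS_def' by auto

lemma zero_FactRing: "\<zero>\<^bsub>R Quot J\<^esub> = J"
  unfolding FactRing_def by simp

context ring_cech
begin

lemma cech_module_quotient:
  assumes x: "x \<in> carrier R"
  shows "cech_module_quotient R fs (quotient_by_element R x) (\<lambda>a. PIdl x +>\<^bsub>R\<^esub> a) (PIdl x)"
proof -
  let ?J = "PIdl x" and ?M' = "quotient_by_element R x"
  have J: "ideal ?J R" by (rule R.cgenideal_ideal[OF x])
  note sub = R.ideal_submodule[OF J]
  have carR: "submodule (carrier R) R (ring_as_module R)"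
    using carrier_is_submodule by simp
  have simps: "carrier ?M' = (\<lambda>a. ?J +>\<^bsub>R\<^esub> a) ` carrier R" "\<zero>\<^bsub>?M'\<^esub> = ?J"
    "U \<oplus>\<^bsub>?M'\<^esub> V = U <+>\<^bsub>ring_as_module R\<^esub> V"
    "r \<odot>\<^bsub>?M'\<^esub> U = (\<Union>z\<in>U. ?J +>\<^bsub>ring_as_module R\<^esub> (r \<odot>\<^bsub>ring_as_module R\<^esub> z))" for U V r
    unfolding quotient_by_element_def subquotient_simps by simp_all
  have "module R ?M'"
    unfolding quotient_by_element_def by (rule module_subquotient[OF sub carR])
  then have B: "cech R ?M' fs" by (intro cech.intro cech_axioms.intro fs_subset)
  show ?thesis
  proof (intro cech_module_quotient.intro cech_quotient.intro cech_quotient_axioms.intro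
      cech_hom.intro cech_hom_axioms.intro cech_axioms B ring_cech_axioms refl J)
    fix S assume S: "S \<subseteq> {..<length fs}"
    show "frac_hom R (ring_as_module R) (D S) R ?M' (D S) (\<lambda>a. ?J +>\<^bsub>R\<^esub> a) (\<lambda>r. r)"
    proof (intro frac_hom.intro frac_hom_axioms.intro fractions[OF S] cech.fractions[OF B S])
      fix m assume m: "m \<in> carrier (ring_as_module R)"
      show "?J +>\<^bsub>R\<^esub> m \<in> carrier ?M'" using m unfolding simps by simp
      show "?J +>\<^bsub>R\<^esub> (m \<oplus>\<^bsub>ring_as_module R\<^esub> n) = (?J +>\<^bsub>R\<^esub> m) \<oplus>\<^bsub>?M'\<^esub> (?J +>\<^bsub>R\<^esub> n)"
        if "n \<in> carrier (ring_as_module R)" for n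
        using coset_add[OF sub m that] unfolding simps by simp
      show "?J +>\<^bsub>R\<^esub> (r \<odot>\<^bsub>ring_as_module R\<^esub> m) = r \<odot>\<^bsub>?M'\<^esub> (?J +>\<^bsub>R\<^esub> m)" if "r \<in> carrier R" for r
        using coset_smult[OF sub that m] unfolding simps by simp
    qed simp_all
  next
    show "(\<lambda>a. ?J +>\<^bsub>R\<^esub> a) ` carrier R = carrier ?M'" unfolding simps ..
    show "(?J +>\<^bsub>R\<^esub> a = \<zero>\<^bsub>?M'\<^esub>) = (a \<in> ?J)" if "a \<in> carrier R" for a
      using coset_eq_self_iff[OF sub, of a] that unfolding simps by simp
  qed simp
qed

lemma denominators_quotient:
  assumes J: "ideal J R" and S: "S \<subseteq> {..<length fs}"
  shows "(\<lambda>a. J +>\<^bsub>R\<^esub> a) ` D S = denominators (R Quot J) (map (\<lambda>a. J +>\<^bsub>R\<^esub> a) fs) S"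
proof -
  interpret J: ideal J R by (rule J)
  let ?A = "R Quot J" and ?\<sigma> = "(+>\<^bsub>R\<^esub>) J"
  interpret h: ring_hom_cring R ?A ?\<sigma> by (rule J.rcos_ring_hom_cring[OF R.is_cring])
  have eq: "?\<sigma> (finprod R (\<lambda>s. (fs ! s) [^] (e s :: nat)) S)
      = finprod ?A (\<lambda>s. (map ?\<sigma> fs ! s) [^]\<^bsub>?A\<^esub> e s) S" for e
  proof -
    have "?\<sigma> (finprod R (\<lambda>s. (fs ! s) [^] e s) S) = finprod ?A (?\<sigma> \<circ> (\<lambda>s. (fs ! s) [^] e s)) S"
      by (rule h.hom_finprod) (use nth_fs[OF S] in simp)
    also have "\<dots> = finprod ?A (\<lambda>s. (map ?\<sigma> fs ! s) [^]\<^bsub>?A\<^esub> e s) S"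
    proof (rule h.S.finprod_cong')
      fix s assume s: "s \<in> S"
      then have "s < length fs" using S by blast
      then show "(?\<sigma> \<circ> (\<lambda>s. (fs ! s) [^] e s)) s = (map ?\<sigma> fs ! s) [^]\<^bsub>?A\<^esub> e s"
        using nth_fs[OF S s] by simp
    next
      show "(\<lambda>s. (map ?\<sigma> fs ! s) [^]\<^bsub>?A\<^esub> e s) \<in> S \<rightarrow> carrier ?A"
      proof
        fix s assume s: "s \<in> S"
        then have "s < length fs" using S by blast
        then show "(map ?\<sigma> fs ! s) [^]\<^bsub>?A\<^esub> e s \<in> carrier ?A"
          using h.hom_closed[OF nth_fs[OF S s]] by simp
      qed
    qed simp
    finally show ?thesis .
  qed
  show ?thesis
  proof
    show "?\<sigma> ` D S \<subseteq> denominators ?A (map ?\<sigma> fs) S"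
    proof
      fix V assume "V \<in> ?\<sigma> ` D S"
      then obtain e where "V = ?\<sigma> (finprod R (\<lambda>s. (fs ! s) [^] (e s :: nat)) S)"
        unfolding denominators_def by blast
      then show "V \<in> denominators ?A (map ?\<sigma> fs) S" unfolding denominators_def eq by blast
    qed
    show "denominators ?A (map ?\<sigma> fs) S \<subseteq> ?\<sigma> ` D S"
    proof
      fix V assume "V \<in> denominators ?A (map ?\<sigma> fs) S"
      then obtain e where "V = finprod ?A (\<lambda>s. (map ?\<sigma> fs ! s) [^]\<^bsub>?A\<^esub> (e s :: nat)) S"
        unfolding denominators_def by blast
      then have "V = ?\<sigma> (finprod R (\<lambda>s. (fs ! s) [^] e s) S)" unfolding eq .
      moreover have "finprod R (\<lambda>s. (fs ! s) [^] e s) S \<in> D S" unfolding denominators_def by blast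
      ultimately show "V \<in> ?\<sigma> ` D S" by (rule image_eqI)
    qed
  qed
qed

lemma cech_ring_quotient:
  assumes J: "ideal J R"
  shows "cech_quotient R fs (R Quot J) (ring_as_module (R Quot J)) (map (\<lambda>a. J +>\<^bsub>R\<^esub> a) fs)
    (\<lambda>a. J +>\<^bsub>R\<^esub> a) (\<lambda>a. J +>\<^bsub>R\<^esub> a) J"
proof -
  interpret J: ideal J R by (rule J)
  let ?A = "R Quot J" and ?\<sigma> = "(+>\<^bsub>R\<^esub>) J"
  interpret h: ring_hom_cring R ?A ?\<sigma> by (rule J.rcos_ring_hom_cring[OF R.is_cring])
  have surj: "?\<sigma> ` carrier R = carrier ?A"
    by (rule carrier_FactRing[symmetric])
  have B: "cech ?A (ring_as_module ?A) (map ?\<sigma> fs)"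
    proof (intro cech.intro cech_axioms.intro h.S.module_ring_as_module)
    show "set (map ?\<sigma> fs) \<subseteq> carrier ?A"
      using h.hom_closed subsetD[OF fs_subset] by (simp add: image_subset_iff)
  qed
  have D: "?\<sigma> ` D S = denominators ?A (map ?\<sigma> fs) S" if "S \<subseteq> {..<length fs}" for S
    by (rule denominators_quotient[OF J that])
  have hom: "cech_hom R (ring_as_module R) fs ?A (ring_as_module ?A) (map ?\<sigma> fs) ?\<sigma> ?\<sigma>"
  proof (rule cech_hom.intro[OF cech_axioms B], rule cech_hom_axioms.intro)
    show "length (map ?\<sigma> fs) = length fs" by simp
    fix S assume S: "S \<subseteq> {..<length fs}"
    then have S': "S \<subseteq> {..<length (map ?\<sigma> fs)}" by simp
    show "frac_hom R (ring_as_module R) (D S) ?A (ring_as_module ?A)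
        (denominators ?A (map ?\<sigma> fs) S) ?\<sigma> ?\<sigma>"
    proof (rule frac_hom.intro[OF fractions[OF S] cech.fractions[OF B S']], rule frac_hom_axioms.intro)
      show "?\<sigma> s \<in> denominators ?A (map ?\<sigma> fs) S" if "s \<in> D S" for s
        using D[OF S] that by blast
      show "?\<sigma> (a \<oplus>\<^bsub>ring_as_module R\<^esub> b) = ?\<sigma> a \<oplus>\<^bsub>ring_as_module ?A\<^esub> ?\<sigma> b"
        if "a \<in> carrier (ring_as_module R)" "b \<in> carrier (ring_as_module R)" for a b
        using h.hom_add[of a b] that by simp
      show "?\<sigma> (r \<odot>\<^bsub>ring_as_module R\<^esub> a) = ?\<sigma> r \<odot>\<^bsub>ring_as_module ?A\<^esub> ?\<sigma> a"
        if "r \<in> carrier R" "a \<in> carrier (ring_as_module R)" for r a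
        using h.hom_mult[of r a] that by simp
      show "?\<sigma> a \<in> carrier (ring_as_module ?A)" if "a \<in> carrier (ring_as_module R)" for a
        using h.hom_closed[of a] that by simp
      show "?\<sigma> a \<in> carrier ?A" if "a \<in> carrier R" for a
        by (rule h.hom_closed[OF that])
    qed
  qed
  show ?thesis
  proof (rule cech_quotient.intro[OF hom ring_cech_axioms], rule cech_quotient_axioms.intro)
    show "ideal J R" by (rule J)
    show "?\<sigma> ` carrier R = carrier (ring_as_module ?A)" using surj by simp
    show "?\<sigma> ` D S = denominators ?A (map ?\<sigma> fs) S" if "S \<subseteq> {..<length fs}" for S by (rule D[OF that])
    show "(J +>\<^bsub>R\<^esub> a = \<zero>\<^bsub>ring_as_module ?A\<^esub>) = (a \<in> J)" if a: "a \<in> carrier R" for a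
    proof -
      have "\<zero>\<^bsub>ring_as_module ?A\<^esub> = J" unfolding ring_as_module_simps by (rule zero_FactRing)
      then show ?thesis
        using coset_eq_self_iff[OF R.ideal_submodule[OF J], of a] a by simp
    qed
  qed
qed

end

text \<open>F-injectivity of R/xR is a hypothesis about sequences that generate the image of the
  maximal ideal; the images of \<open>fs\<close> are such a sequence. One inclusion uses minimality
  in the quotient, the other minimality in R for the inverse image of the ideal.\<close>

lemma (in cring) generates_quotient:
  assumes gen: "generates R fs I" and J: "ideal J R"
  shows "generates (R Quot J) (map (\<lambda>a. J +>\<^bsub>R\<^esub> a) fs) ((\<lambda>a. J +>\<^bsub>R\<^esub> a) ` I)"
proof -
  interpret J: ideal J R by (rule J)
  let ?A = "R Quot J" and ?\<sigma> = "(+>\<^bsub>R\<^esub>) J"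
  interpret h: ring_hom_cring R ?A ?\<sigma> by (rule J.rcos_ring_hom_cring[OF is_cring])
  have fs: "set fs \<subseteq> carrier R" and I: "I = Idl (set fs)" using gen unfolding generates_def by auto
  have idI: "ideal I R" unfolding I by (rule genideal_ideal[OF fs])
  have fsA: "?\<sigma> ` set fs \<subseteq> carrier ?A" using fs by auto
  have "Idl\<^bsub>?A\<^esub> (?\<sigma> ` set fs) = ?\<sigma> ` I"
  proof
    show "Idl\<^bsub>?A\<^esub> (?\<sigma> ` set fs) \<subseteq> ?\<sigma> ` I"
      by (rule h.S.genideal_minimal[OF ring_ideal_imp_quot_ideal[OF J idI]])
        (use genideal_self[OF fs] I in blast)
    have "I \<subseteq> {r \<in> carrier R. ?\<sigma> r \<in> Idl\<^bsub>?A\<^esub> (?\<sigma> ` set fs)}"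
      unfolding I
      by (rule genideal_minimal[OF ring_hom_ring.ideal_vimage[OF J.rcos_ring_hom_ring h.S.genideal_ideal[OF fsA]]])
        (use fs h.S.genideal_self[OF fsA] in blast)
    then show "?\<sigma> ` I \<subseteq> Idl\<^bsub>?A\<^esub> (?\<sigma> ` set fs)" by blast
  qed
  then show ?thesis unfolding generates_def using fsA by simp
qed

text \<open>Primes over J have prime images in R/J with the same strict inclusions. It is used in
  the contrapositive: a small dimension of R/J excludes long chains over J.\<close>

lemma (in cring) prime_chain_le_krull_dim:
  assumes J: "ideal J R" and "prime_chain J n"
  shows "enat n \<le> krull_dim (R Quot J)"
proof -
  interpret J: ideal J R by (rule J)
  let ?A = "R Quot J" and ?\<sigma> = "(+>\<^bsub>R\<^esub>) J"
  interpret h: ring_hom_cring R ?A ?\<sigma> by (rule J.rcos_ring_hom_cring[OF is_cring])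
  obtain P where P: "\<And>j. j \<le> n \<Longrightarrow> primeideal (P j) R \<and> J \<subseteq> P j" "\<And>j. j < n \<Longrightarrow> P j \<subset> P (Suc j)"
    using assms(2) unfolding prime_chain_def by blast
  note carA = carrier_FactRing[of R J]
  \<comment> \<open>Since J lies in \<open>P j\<close>, whether an element belongs to
    \<open>P j\<close> depends only on its coset. Primality and strictness of inclusions for the
    images follow from this equivalence.\<close>
  have mem: "?\<sigma> a \<in> ?\<sigma> ` P j \<longleftrightarrow> a \<in> P j" if j: "j \<le> n" and a: "a \<in> carrier R" for a j
  proof
    interpret Pj: primeideal "P j" R using P(1)[OF j] by blast
    assume "?\<sigma> a \<in> ?\<sigma> ` P j"
    then obtain b where b: "b \<in> P j" "?\<sigma> a = ?\<sigma> b" by blast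
    have bR: "b \<in> carrier R" using b(1) Pj.a_subset by blast
    have "a \<ominus> b \<in> J" using b(2) quotient_eq_iff_same_a_r_cos[OF J a bR] by simp
    then have "a \<ominus> b \<in> P j" using P(1)[OF j] by blast
    then have "(a \<ominus> b) \<oplus> b \<in> P j" using b(1) by (rule Pj.a_closed)
    then show "a \<in> P j" using a bR by (simp add: minus_eq a_assoc l_neg)
  qed blast
  have prime: "primeideal (?\<sigma> ` P j) ?A" if j: "j \<le> n" for j
  proof -
    interpret Pj: primeideal "P j" R using P(1)[OF j] by blast
    show ?thesis
    proof (rule primeidealI[OF ring_ideal_imp_quot_ideal[OF J Pj.is_ideal] h.S.is_cring])
      show "carrier ?A \<noteq> ?\<sigma> ` P j"
      proof
        assume "carrier ?A = ?\<sigma> ` P j"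
        then have "a \<in> P j" if "a \<in> carrier R" for a using mem[OF j that] that carA by blast
        then show False using Pj.I_notcarr Pj.a_subset by blast
      qed
      fix U V assume UV: "U \<in> carrier ?A" "V \<in> carrier ?A" "U \<otimes>\<^bsub>?A\<^esub> V \<in> ?\<sigma> ` P j"
      obtain a b where ab: "a \<in> carrier R" "U = ?\<sigma> a" "b \<in> carrier R" "V = ?\<sigma> b"
        using UV(1,2) unfolding carA by blast
      have "?\<sigma> (a \<otimes> b) \<in> ?\<sigma> ` P j" using UV(3) h.hom_mult[OF ab(1,3)] ab(2,4) by simp
      then have "a \<otimes> b \<in> P j" using mem[OF j, of "a \<otimes> b"] ab(1,3) by simp
      then have "a \<in> P j \<or> b \<in> P j" by (rule Pj.I_prime[OF ab(1,3)])
      then show "U \<in> ?\<sigma> ` P j \<or> V \<in> ?\<sigma> ` P j" using ab(2,4) by blast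
    qed
  qed
  have strict: "?\<sigma> ` P j \<subset> ?\<sigma> ` P (Suc j)" if j: "j < n" for j
  proof -
    obtain a where a: "a \<in> P (Suc j)" "a \<notin> P j" using P(2)[OF j] by blast
    interpret Pj: primeideal "P (Suc j)" R using P(1)[of "Suc j"] j by simp
    have "a \<in> carrier R" using a(1) Pj.a_subset by blast
    then have "?\<sigma> a \<notin> ?\<sigma> ` P j" using mem[of j a] a(2) j by simp
    then show ?thesis using a(1) P(2)[OF j] by blast
  qed
  show ?thesis
    unfolding krull_dim_def
    by (rule Sup_upper, intro CollectI exI[of _ n] conjI refl exI[of _ "\<lambda>j. ?\<sigma> ` P j"])
      (use prime strict in blast)+
qed

text \<open>\<open>module_dim\<close> is defined through the annihilator; this identifies the
  dimension in the FLC hypothesis as that of the ring R/(x).\<close>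

lemma (in cring) annihilator_quotient_by_element:
  assumes x: "x \<in> carrier R"
  shows "annihilator R (quotient_by_element R x) = PIdl x"
proof -
  have J: "ideal (PIdl x) R" by (rule cgenideal_ideal[OF x])
  interpret J: ideal "PIdl x" R by (rule J)
  interpret RM: module R "ring_as_module R" by (rule module_ring_as_module)
  note sub = ideal_submodule[OF J]
  have smult: "r \<odot>\<^bsub>quotient_by_element R x\<^esub> (PIdl x +>\<^bsub>R\<^esub> a) = PIdl x +>\<^bsub>R\<^esub> (r \<otimes> a)"
    if "r \<in> carrier R" "a \<in> carrier R" for r a
    unfolding quotient_by_element_def RM.subquotient_simps
    using RM.coset_smult[OF sub that(1), of a] that(2) by simp
  have zero: "PIdl x +>\<^bsub>R\<^esub> a = \<zero>\<^bsub>quotient_by_element R x\<^esub> \<longleftrightarrow> a \<in> PIdl x" if "a \<in> carrier R" for a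
    unfolding quotient_by_element_def RM.subquotient_simps
    using RM.coset_eq_self_iff[OF sub, of a] that by simp
  have car: "carrier (quotient_by_element R x) = (\<lambda>a. PIdl x +>\<^bsub>R\<^esub> a) ` carrier R"
    unfolding quotient_by_element_def RM.subquotient_simps by simp
  have "(\<forall>U\<in>carrier (quotient_by_element R x). r \<odot>\<^bsub>quotient_by_element R x\<^esub> U = \<zero>\<^bsub>quotient_by_element R x\<^esub>)
      \<longleftrightarrow> r \<in> PIdl x" if r: "r \<in> carrier R" for r
  proof -
    have "(\<forall>U\<in>carrier (quotient_by_element R x). r \<odot>\<^bsub>quotient_by_element R x\<^esub> U = \<zero>\<^bsub>quotient_by_element R x\<^esub>)
        \<longleftrightarrow> (\<forall>a\<in>carrier R. r \<odot>\<^bsub>quotient_by_element R x\<^esub> (PIdl x +>\<^bsub>R\<^esub> a) = \<zero>\<^bsub>quotient_by_element R x\<^esub>)"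
      unfolding car by blast
    also have "\<dots> \<longleftrightarrow> (\<forall>a\<in>carrier R. r \<otimes> a \<in> PIdl x)"
      by (rule ball_cong[OF refl]) (use smult[OF r] zero r in simp)
    also have "\<dots> \<longleftrightarrow> r \<in> PIdl x"
    proof
      assume "\<forall>a\<in>carrier R. r \<otimes> a \<in> PIdl x"
      then have "r \<otimes> \<one> \<in> PIdl x" by (rule bspec) simp
      then show "r \<in> PIdl x" using r by simp
    next
      assume "r \<in> PIdl x"
      then show "\<forall>a\<in>carrier R. r \<otimes> a \<in> PIdl x" using J.I_r_closed by blast
    qed
    finally show ?thesis .
  qed
  then show ?thesis unfolding annihilator_def using J.a_subset by blast
qed

section \<open>Assembly: the Cech complex of a generating sequence satisfies the abstract
  hypotheses\<close>

section \<open>Frobenius injectivity\<close>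

lemma (in ring_hom_cring) hom_add_pow:
  assumes "a \<in> carrier R" shows "h (add_pow R (n::nat) a) = add_pow S n (h a)"
  by (induction n) (use assms in simp_all)

context frobenius_cech
begin

text \<open>Turns F-injectivity of the ring R/xR into a statement about cochains over R, by pushing
  \<open>c\<close> to the quotient complex and pulling the conclusion back along the kernel
  description of the reduction.\<close>

lemma F_injective_quotient:
  assumes x: "x \<in> carrier R"
    and F: "F_injective p (R Quot (PIdl x)) ((\<lambda>a. PIdl x +>\<^bsub>R\<^esub> a) ` (Idl (set fs)))"
    and c: "c \<in> carrier (C i)" "d i c \<in> extended (PIdl x) (Suc i)"
      "\<phi> i c \<in> coboundaries i <+>\<^bsub>C i\<^esub> extended (PIdl x) i"
  shows "c \<in> coboundaries i <+>\<^bsub>C i\<^esub> extended (PIdl x) i"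
proof -
  define J where "J = PIdl x"
  have J: "ideal J R" unfolding J_def by (rule R.cgenideal_ideal[OF x])
  define A where "A = R Quot J"
  define \<sigma> where "\<sigma> = (\<lambda>a. J +>\<^bsub>R\<^esub> a)"
  interpret J: ideal J R by (rule J)
  interpret h: ring_hom_cring R A \<sigma>
    unfolding A_def \<sigma>_def by (rule J.rcos_ring_hom_cring[OF R.is_cring])
  interpret Q: cech_quotient R fs A "ring_as_module A" "map \<sigma> fs" \<sigma> \<sigma> J
    unfolding A_def \<sigma>_def by (rule cech_ring_quotient[OF J])
  have "add_pow A p \<one>\<^bsub>A\<^esub> = \<zero>\<^bsub>A\<^esub>"
    using h.hom_add_pow[OF R.one_closed, of p] char_p by simp
  then interpret FA: frobenius_cech A "map \<sigma> fs" p
    by (intro frobenius_cech.intro ring_cech.intro Q.B.cech_axioms frobenius_cech_axioms.intro prime_p)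
  have "generates R fs (Idl (set fs))" unfolding generates_def using fs_subset by simp
  then have "generates A (map \<sigma> fs) (\<sigma> ` (Idl (set fs)))"
    unfolding A_def \<sigma>_def by (rule R.generates_quotient[OF _ J])
  then have inj: "inj_on (frobenius_action p A (map \<sigma> fs) i)
      (carrier (local_cohomology A (map \<sigma> fs) (ring_as_module A) i))"
    using F unfolding F_injective_def A_def \<sigma>_def J_def by blast
  \<comment> \<open>Reduction and Frobenius commute because the projection is a ring homomorphism
    and so preserves p-th powers of numerators and of denominators.\<close>
  have comm: "FA.\<phi> i (Q.cochain_map i c) = Q.cochain_map i (\<phi> i c)"
  proof (rule Q.B.cochain_ext[OF FA.\<phi>_closed[OF Q.cochain_map_closed[OF c(1)]]
        Q.cochain_map_closed[OF \<phi>_closed[OF c(1)]]])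
    fix S assume S': "S \<in> cech_index (map \<sigma> fs) i"
    then have S: "S \<in> cech_index fs i" unfolding Q.index_eq .
    note Ss = index_subset[OF S] and Ss' = Q.B.index_subset[OF S']
    obtain m s where m: "m \<in> carrier R" "s \<in> D S" "c S = fraction R (D S) (ring_as_module R) m s"
      using LE[OF Ss cochain_apply[OF c(1) S]] by blast
    have mM: "m \<in> carrier (ring_as_module R)" using m(1) by simp
    have mp: "m [^] p \<in> carrier (ring_as_module R)" using m(1) by simp
    have sp: "s [^] p \<in> D S" by (rule denominators_pow[OF Ss m(2)])
    have sR: "s \<in> carrier R" by (rule denominators_closed[OF Ss m(2)])
    have \<sigma>m: "\<sigma> m \<in> carrier (ring_as_module A)" using m(1) by simp
    have \<sigma>s: "\<sigma> s \<in> denominators A (map \<sigma> fs) S" using Q.denominators_surj[OF Ss] m(2) by blast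
    have l: "FA.\<phi> i (Q.cochain_map i c) S = fraction A (denominators A (map \<sigma> fs) S) (ring_as_module A)
        ((\<sigma> m) [^]\<^bsub>A\<^esub> p) ((\<sigma> s) [^]\<^bsub>A\<^esub> p)"
      unfolding FA.cech_frobenius_eq FA.F.cochain_map_apply[OF S'] Q.cochain_map_apply[OF S] m(3)
        frac_hom.frac_map_fraction[OF Q.frac_hom[OF Ss] mM m(2)]
        frac_hom.frac_map_fraction[OF FA.F.frac_hom[OF Ss'] \<sigma>m \<sigma>s] ..
    have r: "Q.cochain_map i (\<phi> i c) S = fraction A (denominators A (map \<sigma> fs) S) (ring_as_module A)
        (\<sigma> (m [^] p)) (\<sigma> (s [^] p))"
      unfolding cech_frobenius_eq Q.cochain_map_apply[OF S] F.cochain_map_apply[OF S] m(3)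
        frac_hom.frac_map_fraction[OF F.frac_hom[OF Ss] mM m(2)]
        frac_hom.frac_map_fraction[OF Q.frac_hom[OF Ss] mp sp] ..
    show "FA.\<phi> i (Q.cochain_map i c) S = Q.cochain_map i (\<phi> i c) S"
      unfolding l r h.hom_pow[OF m(1)] h.hom_pow[OF sR] ..
  qed
  have "Q.B.d i (Q.cochain_map i c) = \<zero>\<^bsub>Q.B.C (Suc i)\<^esub>"
    using Q.cochain_map_cocycle_iff[OF c(1)] c(2) unfolding J_def by blast
  moreover have "Q.cochain_map i (\<phi> i c) \<in> Q.B.coboundaries i"
    using Q.cochain_map_coboundary_iff[OF \<phi>_closed[OF c(1)]] c(3) unfolding J_def by blast
  then have "FA.\<phi> i (Q.cochain_map i c) \<in> Q.B.coboundaries i" unfolding comm .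
  ultimately have "Q.cochain_map i c \<in> Q.B.coboundaries i"
    using inj Q.cochain_map_closed[OF c(1)] unfolding FA.inj_frobenius_action_iff by blast
  then show ?thesis
    using Q.cochain_map_coboundary_iff[OF c(1)] unfolding J_def by blast
qed

end

text \<open>The class of a has a p-th root in the residue field; any lift b of that root leaves a -
  b^p in I.\<close>

lemma (in cring) perfect_residue_field:
  assumes I: "ideal I R" and perfect: "perfect_field p (R Quot I)" and a: "a \<in> carrier R"
  shows "\<exists>b\<in>carrier R. \<exists>r\<in>I. a = b [^] p \<oplus> r"
proof -
  interpret I: ideal I R by (rule I)
  let ?\<sigma> = "(+>\<^bsub>R\<^esub>) I"
  interpret h: ring_hom_cring R "R Quot I" ?\<sigma> by (rule I.rcos_ring_hom_cring[OF is_cring])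
  have "?\<sigma> a \<in> (\<lambda>b. b [^]\<^bsub>R Quot I\<^esub> p) ` carrier (R Quot I)"
    using perfect h.hom_closed[OF a] unfolding perfect_field_def by simp
  then obtain b where b: "b \<in> carrier R" "?\<sigma> a = (?\<sigma> b) [^]\<^bsub>R Quot I\<^esub> p"
    unfolding carrier_FactRing by blast
  have bp: "b [^] p \<in> carrier R" using b(1) by simp
  have "?\<sigma> a = ?\<sigma> (b [^] p)" using b h.hom_pow[OF b(1)] by simp
  then have "a \<ominus> b [^] p \<in> I" using quotient_eq_iff_same_a_r_cos[OF I a bp] by simp
  moreover have "a = b [^] p \<oplus> (a \<ominus> b [^] p)"
    using a bp by (simp add: minus_eq a_comm[of a] r_neg2)
  ultimately show ?thesis using b(1) by blast
qed

theorem mainTheorem2: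
  fixes R :: "('a, 'c) ring_scheme" and \<mm> :: "'a set" and p :: nat and x :: 'a
  assumes "noetherian_local_ring R \<mm>"
    and "prime_characteristic p R"
    and "perfect_field p (R Quot \<mm>)"
    and "x \<in> \<mm>"
    and "regular_element R x"
    and "FLC R \<mm> (quotient_by_element R x)"
    and "F_injective p (R Quot (PIdl\<^bsub>R\<^esub> x)) ((\<lambda>a. PIdl\<^bsub>R\<^esub> x +>\<^bsub>R\<^esub> a) ` \<mm>)"
  shows "F_injective p R \<mm>"
  unfolding F_injective_def
proof (intro allI impI)
  \<comment> \<open>The conclusion concerns every generating sequence. For a given
    \<open>fs\<close>, FLC is used for the same \<open>fs\<close> and F-injectivity for its image in
    R/xR, so the cohomology of different sequences is never compared.\<close>
  fix fs i assume gen: "generates R fs \<mm>"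
  have R: "cring R" and noeth: "noetherian_ring R" and max: "maximalideal \<mm> R"
    using assms(1) unfolding noetherian_local_ring_def by auto
  interpret R: cring R by (rule R)
  interpret \<mm>: maximalideal \<mm> R by (rule max)
  have x: "x \<in> carrier R" using assms(5) unfolding regular_element_def by simp
  have fs: "set fs \<subseteq> carrier R" and \<mm>: "\<mm> = Idl\<^bsub>R\<^esub> (set fs)"
    using gen unfolding generates_def by auto
  have p: "Factorial_Ring.prime p" "add_pow R p \<one>\<^bsub>R\<^esub> = \<zero>\<^bsub>R\<^esub>"
    using assms(2) unfolding prime_characteristic_def by auto
  interpret frobenius_cech R fs p
    by (intro frobenius_cech.intro ring_cech.intro cech.intro cech_axioms.intro
        frobenius_cech_axioms.intro R.module_ring_as_module fs p)
  let ?J = "PIdl\<^bsub>R\<^esub> x" and ?M = "quotient_by_element R x"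
  have J: "ideal ?J R" by (rule R.cgenideal_ideal[OF x])
  note mult = multiples_eq_extended[OF x]
  interpret T: torsion_free_complex R "cech_cochains R fs (ring_as_module R)"
    "cech_diff R fs (ring_as_module R)" x
    by (rule torsion_free_complex.intro[OF cochain_complex_axioms], rule torsion_free_complex_axioms.intro[OF x])
      (rule regular_torsion_free[OF assms(5)])
  have red: "T.reduced_coboundaries i = coboundaries i <+>\<^bsub>C i\<^esub> extended ?J i" for i
    unfolding T.reduced_coboundaries_def mult ..
  interpret P: frobenius_complex R "cech_cochains R fs (ring_as_module R)"
    "cech_diff R fs (ring_as_module R)" x p "cech_frobenius p R fs"
  proof (rule frobenius_complex.intro[OF T.torsion_free_complex_axioms], rule frobenius_complex_axioms.intro)
    show "2 \<le> p" by (rule prime_ge_2_nat[OF p(1)])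
    show "c \<in> T.reduced_coboundaries i" if "c \<in> carrier (C i)" "d i c \<in> multiples x (Suc i)"
      "\<phi> i c \<in> T.reduced_coboundaries i" for c i
      unfolding red
      by (rule F_injective_quotient[OF x])
        (use assms(7) that in \<open>simp_all add: \<mm>[symmetric] mult red\<close>)
  qed (simp_all add: \<phi>_closed \<phi>_add \<phi>_smult \<phi>_diff)
  interpret M: cech_module_quotient R fs ?M "\<lambda>a. ?J +>\<^bsub>R\<^esub> a" ?J
    by (rule cech_module_quotient[OF x])
  \<comment> \<open>Below the dimension of R/xR the lifts come from Frobenius and finite length;
    from the dimension on, they come from vanishing one degree higher.\<close>
  have lift: "T.liftable i" for i
  proof (cases "enat i < module_dim R ?M")
    case True
    then have fl: "finite_length R (local_cohomology R fs ?M i)"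
      using assms(6) gen unfolding FLC_def by blast
    have bc: "bounded_chains R (C i) (T.reduced_coboundaries i) (P.reduced_cocycles i)"
      using M.finite_length_imp_bounded_chains[OF fl] unfolding red P.reduced_cocycles_def mult .
    show ?thesis
    proof (rule P.finite_length_imp_liftable[OF bc \<mm>.a_subset])
      show "\<exists>b\<in>carrier R. \<exists>r\<in>\<mm>. a = b [^]\<^bsub>R\<^esub> p \<oplus>\<^bsub>R\<^esub> r" if "a \<in> carrier R" for a
        by (rule R.perfect_residue_field[OF \<mm>.is_ideal assms(3) that])
      fix r c assume r: "r \<in> \<mm>" and c: "c \<in> P.reduced_cocycles i"
      note c' = P.reduced_cocyclesD[OF c]
      show "\<exists>n::nat. (r [^]\<^bsub>R\<^esub> n) \<odot>\<^bsub>C i\<^esub> c \<in> T.reduced_coboundaries i"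
      proof (rule torsion_ideal[OF T.submodule_reduced_coboundaries c'(1)])
        show "r \<in> Idl\<^bsub>R\<^esub> (set fs)" using r \<mm> by simp
        show "\<exists>n::nat. (f [^]\<^bsub>R\<^esub> n) \<odot>\<^bsub>C i\<^esub> c \<in> T.reduced_coboundaries i" if "f \<in> set fs" for f
          using extended_torsion[OF J that c'(1)] c'(2) unfolding mult red by blast
      qed
    qed
  next
    case False
    \<comment> \<open>The boundary case is i equal to the dimension of R/xR: H^i(R/xR) itself is not
      covered by vanishing, but the obstruction to lifting lives in degree i + 1, which exceeds the
      dimension.\<close>
    have "\<not> R.prime_chain ?J (Suc i)"
    proof
      assume "R.prime_chain ?J (Suc i)"
      then have "enat (Suc i) \<le> module_dim R ?M"
        unfolding module_dim_def R.annihilator_quotient_by_element[OF x]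
        by (rule R.prime_chain_le_krull_dim[OF J])
      moreover have "module_dim R ?M \<le> enat i" using False by simp
      ultimately have "enat (Suc i) \<le> enat i" by (rule order_trans)
      then show False by simp
    qed
    then show ?thesis
      by (intro T.vanishing_imp_liftable) (unfold red mult, rule vanishing[OF noeth J])
  qed
  \<comment> \<open>The zero ideal in \<open>extended_torsion\<close> shows that each generator has
    a power killing the class, and \<open>torsion_ideal\<close> passes from the generators to
    \<open>x\<close>, an element of the maximal ideal.\<close>
  have torsion: "\<exists>n::nat. (x [^]\<^bsub>R\<^esub> n) \<odot>\<^bsub>C i\<^esub> z \<in> coboundaries i"
    if z: "z \<in> carrier (C i)" "d i z = \<zero>\<^bsub>C (Suc i)\<^esub>" for z i
  proof (rule torsion_ideal[OF submodule_coboundaries z(1)])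
    show "x \<in> Idl\<^bsub>R\<^esub> (set fs)" using assms(4) \<mm> by simp
    fix f assume f: "f \<in> set fs"
    have "d i z \<in> extended {\<zero>\<^bsub>R\<^esub>} (Suc i)" unfolding z(2) extended_zero by simp
    from extended_torsion[OF R.zeroideal f z(1) this] obtain n :: nat
      where "(f [^]\<^bsub>R\<^esub> n) \<odot>\<^bsub>C i\<^esub> z \<in> coboundaries i <+>\<^bsub>C i\<^esub> extended {\<zero>\<^bsub>R\<^esub>} i" by blast
    then obtain b where b: "b \<in> coboundaries i" "(f [^]\<^bsub>R\<^esub> n) \<odot>\<^bsub>C i\<^esub> z = b \<oplus>\<^bsub>C i\<^esub> \<zero>\<^bsub>C i\<^esub>"
      unfolding K.set_add_iff extended_zero by blast
    then show "\<exists>n::nat. (f [^]\<^bsub>R\<^esub> n) \<odot>\<^bsub>C i\<^esub> z \<in> coboundaries i"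
      using coboundaries_subset[OF b(1)] by (intro exI[of _ n]) simp
  qed
  show "inj_on (frobenius_action p R fs i) (carrier (local_cohomology R fs (ring_as_module R) i))"
    unfolding inj_frobenius_action_iff
    using P.\<phi>_injective[OF lift torsion] by blast
qed

end
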